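(* Let $f\in L_p^0(\mathbb{T}^2)$, $1<p<\infty$, have Fourier series $$\sum_{n_1=1}^\infty\sum_{n_2=1}^\infty\big(a_{n_1,n_2}\cos n_1x\cos n_2y+b_{n_1,n_2}\sin n_1x\cos n_2y+c_{n_1,n_2}\cos n_1x\sin n_2y+d_{n_1,n_2}\sin n_1x\sin n_2y\big),$$ and put $\rho_{n_1,n_2}=|a_{n_1,n_2}|+|b_{n_1,n_2}|+|c_{n_1,n_2}|+|d_{n_1,n_2}|$. Let $\tau:=\max(2,p)$, $\theta:=\min(2,p)$, $\alpha_1>0$, $\alpha_2>0$, $n_1\in\mathbb{N}$, $n_2\in\mathbb{N}$. Then $$\mathbb{I}(\theta)\lesssim\omega_{\alpha_1,\alpha_2}\Big(f,\frac1{n_1},\frac1{n_2}\Big)_{L_p(\mathbb{T}^2)}\lesssim\mathbb{I}(\tau),$$ where, for $1<s<\infty$, $$\begin{aligned}\mathbb{I}(s):=\;&\frac1{n_1^{\alpha_1}}\frac1{n_2^{\alpha_2}}\Big\{\sum_{\nu_1=1}^{n_1}\sum_{\nu_2=1}^{n_2}\rho_{\nu_1,\nu_2}^s\nu_1^{(\alpha_1+1)s-2}\nu_2^{(\alpha_2+1)s-2}\Big\}^{1/s}+\frac1{n_1^{\alpha_1}}\Big\{\sum_{\nu_1=1}^{n_1}\sum_{\nu_2=n_2+1}^{\infty}\rho_{\nu_1,\nu_2}^s\nu_1^{(\alpha_1+1)s-2}\nu_2^{s-2}\Big\}^{1/s}\\&+\frac1{n_2^{\alpha_2}}\Big\{\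sum_{\nu_1=n_1+1}^{\infty}\sum_{\nu_2=1}^{n_2}\rho_{\nu_1,\nu_2}^s\nu_1^{s-2}\nu_2^{(\alpha_2+1)s-2}\Big\}^{1/s}+\Big\{\sum_{\nu_1=n_1+1}^{\infty}\sum_{\nu_2=n_2+1}^{\infty}\rho_{\nu_1,\nu_2}^s(\nu_1\nu_2)^{s-2}\Big\}^{1/s}.\end{aligned}$$
   Context: $L_p(\mathbb{T}^2)$, $1<p<\infty$, is the space of measurable functions $f(x,y)$ that are $2\pi$-periodic in each variable with $\|f\|_{L_p(\mathbb{T}^2)}=\big(\int_0^{2\pi}\int_0^{2\pi}|f(x,y)|^p\,dx\,dy\big)^{1/p}<\infty$; $L_p^0(\mathbb{T}^2)$ is the set of $f\in L_p(\mathbb{T}^2)$ with $\int_0^{2\pi}f(x,y)\,dy=0$ for a.e. $x$ and $\int_0^{2\pi}f(x,y)\,dx=0$ for a.e. $y$. $\mathbb{N}=\{1,2,\ldots\}$. For $\alpha_1,\alpha_2>0$ the (fractional) differences are $\Delta_{h_1}^{\alpha_1}(f)=\sum_{\nu=0}^\infty(-1)^\nu\binom{\alpha_1}{\nu}f(x+(\alpha_1-\nu)h_1,y)$ and $\Delta_{h_2}^{\alpha_2}(f)=\sum_{\nu=0}^\infty(-1)^\nu\binom{\alpha_2}{\nu}f(x,y+(\alpha_2-\nu)h_2)$, where $\binom{\alpha}{0}=1$, $\binom{\alpha}{\nu}=\frac{\alpha(\alpha-1)\cdots(\alpha-\nu+1)}{\nu!}$ for $\nu\ge1$. The mixed modulus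 of smoothness is $\omega_{\alpha_1,\alpha_2}(f,\delta_1,\delta_2)_{L_p(\mathbb{T}^2)}=\sup_{|h_i|\le\delta_i,\,i=1,2}\|\Delta_{h_1}^{\alpha_1}(\Delta_{h_2}^{\alpha_2}(f))\|_{L_p(\mathbb{T}^2)}$. $A\lesssim B$ means $A\le CB$ with a constant $C>0$ independent of $f,n_1,n_2$ ($C$ may depend on $p,\alpha_1,\alpha_2$). *)

theory Defs
  imports "HOL-Analysis.Analysis"
begin

text \<open>Norms, moduli of smoothness and coefficient sums take values in \<^typ>\<open>ennreal\<close>, so that an
  infinite value is not silently turned into a finite one. Only powers with a positive exponent
  are used, for which the power of \<open>\<infinity>\<close> is \<open>\<infinity>\<close>.\<close>

definition ennpow :: "ennreal \<Rightarrow> real \<Rightarrow> ennreal" where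
  "ennpow u r = (if u = \<infinity> then \<infinity> else ennreal (enn2real u powr r))"

definition period_box :: "(real \<times> real) set" where
  "period_box = {0..2*pi} \<times> {0..2*pi}"

definition Lp_norm :: "real \<Rightarrow> (real \<times> real \<Rightarrow> real) \<Rightarrow> ennreal" where
  "Lp_norm p f = ennpow (\<integral>\<^sup>+z\<in>period_box. ennreal (\<bar>f z\<bar> powr p) \<partial>lebesgue) (1 / p)"

definition Lp_torus :: "real \<Rightarrow> (real \<times> real \<Rightarrow> real) set" where
  "Lp_torus p = {f. f \<in> borel_measurable lebesgue
      \<and> (\<forall>x y. f (x + 2*pi, y) = f (x, y) \<and> f (x, y + 2*pi) = f (x, y))
      \<and> Lp_norm p f < \<infinity>}"

definition Lp0_torus :: "real \<Rightarrow> (real \<times> real \<Rightarrow> real) set" where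
  "Lp0_torus p = {f \<in> Lp_torus p.
      (AE x in lebesgue. (LINT y:{0..2*pi}|lebesgue. f (x, y)) = 0)
      \<and> (AE y in lebesgue. (LINT x:{0..2*pi}|lebesgue. f (x, y)) = 0)}"

text \<open>The coefficients of the double Fourier series. For \<open>f\<close> in \<open>Lp0_torus p\<close> all coefficients with
  \<open>n1 = 0\<close> or \<open>n2 = 0\<close> vanish; the normalisation below is the one for \<open>n1, n2 \<ge> 1\<close>.\<close>

definition coeff_a :: "(real \<times> real \<Rightarrow> real) \<Rightarrow> nat \<Rightarrow> nat \<Rightarrow> real" where
  "coeff_a f n1 n2 =
     1 / pi\<^sup>2 * (LINT (x, y):period_box|lebesgue. f (x, y) * cos (real n1 * x) * cos (real n2 * y))"

definition coeff_b :: "(real \<times> real \<Rightarrow> real) \<Rightarrow> nat \<Rightarrow> nat \<Rightarrow> real" where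
  "coeff_b f n1 n2 =
     1 / pi\<^sup>2 * (LINT (x, y):period_box|lebesgue. f (x, y) * sin (real n1 * x) * cos (real n2 * y))"

definition coeff_c :: "(real \<times> real \<Rightarrow> real) \<Rightarrow> nat \<Rightarrow> nat \<Rightarrow> real" where
  "coeff_c f n1 n2 =
     1 / pi\<^sup>2 * (LINT (x, y):period_box|lebesgue. f (x, y) * cos (real n1 * x) * sin (real n2 * y))"

definition coeff_d :: "(real \<times> real \<Rightarrow> real) \<Rightarrow> nat \<Rightarrow> nat \<Rightarrow> real" where
  "coeff_d f n1 n2 =
     1 / pi\<^sup>2 * (LINT (x, y):period_box|lebesgue. f (x, y) * sin (real n1 * x) * sin (real n2 * y))"

definition rho :: "(real \<times> real \<Rightarrow> real) \<Rightarrow> nat \<Rightarrow> nat \<Rightarrow> real" where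
  "rho f n1 n2 =
     \<bar>coeff_a f n1 n2\<bar> + \<bar>coeff_b f n1 n2\<bar> + \<bar>coeff_c f n1 n2\<bar> + \<bar>coeff_d f n1 n2\<bar>"

text \<open>For \<open>\<alpha> > 0\<close> the binomial coefficients are absolutely summable, so for \<open>f\<close> in \<open>Lp_torus p\<close> with
  \<open>p \<ge> 1\<close> the series below converge absolutely at almost every point, to their sum in \<open>L\<^sub>p\<close>. The value
  of the pointwise sum on the exceptional null set is irrelevant.\<close>

definition diff1 :: "real \<Rightarrow> real \<Rightarrow> (real \<times> real \<Rightarrow> real) \<Rightarrow> real \<times> real \<Rightarrow> real" where
  "diff1 \<alpha> h f = (\<lambda>(x, y). \<Sum>\<nu>. (-1) ^ \<nu> * (\<alpha> gchoose \<nu>) * f (x + (\<alpha> - real \<nu>) * h, y))"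

definition diff2 :: "real \<Rightarrow> real \<Rightarrow> (real \<times> real \<Rightarrow> real) \<Rightarrow> real \<times> real \<Rightarrow> real" where
  "diff2 \<alpha> h f = (\<lambda>(x, y). \<Sum>\<nu>. (-1) ^ \<nu> * (\<alpha> gchoose \<nu>) * f (x, y + (\<alpha> - real \<nu>) * h))"

definition mixed_modulus ::
    "real \<Rightarrow> real \<Rightarrow> real \<Rightarrow> (real \<times> real \<Rightarrow> real) \<Rightarrow> real \<Rightarrow> real \<Rightarrow> ennreal" where
  "mixed_modulus p \<alpha>1 \<alpha>2 f \<delta>1 \<delta>2 =
     (SUP (h1, h2) \<in> {(h1, h2). \<bar>h1\<bar> \<le> \<delta>1 \<and> \<bar>h2\<bar> \<le> \<delta>2}.
        Lp_norm p (diff1 \<alpha>1 h1 (diff2 \<alpha>2 h2 f)))"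

definition coeff_sum ::
    "real \<Rightarrow> real \<Rightarrow> (real \<times> real \<Rightarrow> real) \<Rightarrow> nat \<Rightarrow> nat \<Rightarrow> real \<Rightarrow> ennreal" where
  "coeff_sum \<alpha>1 \<alpha>2 f n1 n2 s =
     ennreal (1 / real n1 powr \<alpha>1 * (1 / real n2 powr \<alpha>2)) *
       ennpow (\<Sum>\<nu>1=1..n1. \<Sum>\<nu>2=1..n2.
         ennreal (rho f \<nu>1 \<nu>2 powr s * real \<nu>1 powr ((\<alpha>1 + 1) * s - 2)
                                      * real \<nu>2 powr ((\<alpha>2 + 1) * s - 2))) (1 / s)
   + ennreal (1 / real n1 powr \<alpha>1) *
       ennpow (\<Sum>\<nu>1=1..n1. \<Sum>\<^sub>\<infinity>\<nu>2\<in>{n2+1..}.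
         ennreal (rho f \<nu>1 \<nu>2 powr s * real \<nu>1 powr ((\<alpha>1 + 1) * s - 2)
                                      * real \<nu>2 powr (s - 2))) (1 / s)
   + ennreal (1 / real n2 powr \<alpha>2) *
       ennpow (\<Sum>\<^sub>\<infinity>\<nu>1\<in>{n1+1..}. \<Sum>\<nu>2=1..n2.
         ennreal (rho f \<nu>1 \<nu>2 powr s * real \<nu>1 powr (s - 2)
                                      * real \<nu>2 powr ((\<alpha>2 + 1) * s - 2))) (1 / s)
   + ennpow (\<Sum>\<^sub>\<infinity>\<nu>1\<in>{n1+1..}. \<Sum>\<^sub>\<infinity>\<nu>2\<in>{n2+1..}.
         ennreal (rho f \<nu>1 \<nu>2 powr s * real (\<nu>1 * \<nu>2) powr (s - 2))) (1 / s)"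

end

theory Submission
  imports Defs
begin

text \<open>
  Throughout, the coefficients of \<open>f\<close> at the frequency \<open>(m, n)\<close> are condensed into the amplitude
  \<open>A m n\<close>, the Euclidean norm of the four numbers \<open>\<integral> f e\<^sub>m e\<^sub>n\<close>, which is comparable with
  \<open>\<rho> m n\<close>. Two facts carry the proof.

  First, a fractional difference of order \<open>\<alpha>\<close> and step \<open>h\<close> in the variable \<open>x\<close> rotates the pair of cosine and
  sine coefficients at frequency \<open>m\<close> and multiplies it by \<open>\<bar>1 - exp (i m h)\<bar> powr \<alpha>\<close>, so that the
  amplitude of the mixed difference is
  \<open>\<bar>2 sin (m h1 / 2)\<bar> powr \<alpha>1 * \<bar>2 sin (n h2 / 2)\<bar> powr \<alpha>2 * A m n\<close> (\<open>amplitude_mixed_difference\<close>).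

  Second, Paley's inequality (\<open>paley_torus\<close>): for \<open>1 < s \<le> 2\<close> the sum of
  \<open>(m n) powr (s - 2) * A m n powr s\<close> over \<open>m, n \<ge> 1\<close> is at most a constant times
  \<open>\<integral> \<bar>F\<bar> powr s\<close>; and for \<open>s \<ge> 2\<close> the opposite
  inequality holds for functions without frequencies on the axes (\<open>dual_paley_torus\<close>).

  With \<open>h\<close> bounded by \<open>1/n1\<close> the multiplier is at most a constant times \<open>min 1 (m/n1) powr \<alpha>1\<close>, and
  \<open>\<I>(s)\<close> is comparable with the \<open>s\<close>-th root of the sum of
  \<open>(m n) powr (s - 2) * \<rho> m n powr s * min 1 (m/n1) powr (\<alpha>1 s) * min 1 (n/n2) powr (\<alpha>2 s)\<close>: its four
  terms are the roots of the four parts of that sum in which the minima are resolved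
  (\<open>coeff_sum_eq_blocks\<close>). The upper estimate is therefore the dual inequality with \<open>s = \<tau>\<close> applied to
  each mixed difference, together with \<open>\<parallel>G\<parallel>\<^sub>p \<le> C \<parallel>G\<parallel>\<^sub>\<tau>\<close> on the torus.

  For the lower estimate Paley's inequality with \<open>s = \<theta>\<close> is applied to each mixed difference. A single
  step \<open>h\<close> is not enough, since \<open>sin (m h / 2)\<close> may vanish for large \<open>m\<close>; but the modulus dominates all
  steps, and the mean of \<open>\<bar>2 sin (m h / 2)\<bar> powr \<beta>\<close> over \<open>0 \<le> h \<le> 1/n\<close> is at least a constant times
  \<open>min 1 (m/n) powr \<beta>\<close> (\<open>abs_sin_power_average\<close>). Averaging over both steps gives the claim.

  Paley's inequality on the circle follows from Bessel's inequality and the trivial bound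
  \<open>\<bar>\<integral> g e\<^sub>m\<bar> \<le> \<integral> \<bar>g\<bar>\<close> by Marcinkiewicz interpolation, and on the torus by iteration, one variable at a
  time. The dual inequality is obtained by testing \<open>F\<close> against trigonometric polynomials that
  converge boundedly almost everywhere to \<open>sgn F * \<bar>F\<bar> powr (s - 1)\<close>, truncated where \<open>\<bar>F\<bar>\<close> is
  large; such polynomials exist by the theorems of Stone--Weierstrass and Tietze
  (\<open>trig_polys_dense\<close>).
\<close>

section \<open>Sums over the positive integers\<close>

text \<open>Sums over the positive integers in \<open>ennreal\<close>, written as integrals over the counting measure so that
  Tonelli's theorem applies.\<close>

abbreviation pos_sum :: "(nat \<Rightarrow> ennreal) \<Rightarrow> ennreal"  (binder "\<Sum>\<^sup>+" [61] 61) where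
  "pos_sum f \<equiv> (\<integral>\<^sup>+m. f m \<partial>count_space {1..})"

lemma infsum_eq_nn_integral_count_space:
  fixes f :: "nat \<Rightarrow> ennreal"
  shows "infsum f A = (\<integral>\<^sup>+m. f m \<partial>count_space A)"
proof (rule antisym)
  have sup: "infsum f A = (SUP F\<in>{F. finite F \<and> F \<subseteq> A}. sum f F)"
    by (rule nonneg_infsum_complete) simp
  show "infsum f A \<le> (\<integral>\<^sup>+m. f m \<partial>count_space A)"
    unfolding sup
  proof (rule SUP_least)
    fix F assume "F \<in> {F. finite F \<and> F \<subseteq> A}"
    then have F: "finite F" "F \<subseteq> A" by auto
    have "sum f F = (\<integral>\<^sup>+m. f m \<partial>count_space F)"
      by (rule nn_integral_count_space_finite[symmetric]) (use F in auto)
    also have "\<dots> = (\<integral>\<^sup>+m. f m * indicator F m \<partial>count_space UNIV)"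
      by (rule nn_integral_count_space_indicator) auto
    also have "\<dots> \<le> (\<integral>\<^sup>+m. f m * indicator A m \<partial>count_space UNIV)"
      by (intro nn_integral_mono) (use F in \<open>auto split: split_indicator\<close>)
    also have "\<dots> = (\<integral>\<^sup>+m. f m \<partial>count_space A)"
      by (rule nn_integral_count_space_indicator[symmetric]) auto
    finally show "sum f F \<le> (\<integral>\<^sup>+m. f m \<partial>count_space A)" .
  qed
  have "(\<integral>\<^sup>+m. f m \<partial>count_space A) = (\<Sum>m. f m * indicator A m)"
    by (subst nn_integral_count_space_indicator) (auto simp: nn_integral_count_space_nat)
  also have "\<dots> = (SUP n. \<Sum>m<n. f m * indicator A m)"
    by (rule suminf_eq_SUP)
  also have "\<dots> \<le> infsum f A"
    unfolding sup
  proof (rule SUP_least)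
    fix n :: nat
    have "(\<Sum>m<n. f m * indicator A m) = sum f ({..<n} \<inter> A)"
      by (simp add: sum.inter_restrict indicator_def if_distrib cong: if_cong)
    also have "\<dots> \<le> (SUP F\<in>{F. finite F \<and> F \<subseteq> A}. sum f F)"
      by (rule SUP_upper) auto
    finally show "(\<Sum>m<n. f m * indicator A m) \<le> (SUP F\<in>{F. finite F \<and> F \<subseteq> A}. sum f F)" .
  qed
  finally show "(\<integral>\<^sup>+m. f m \<partial>count_space A) \<le> infsum f A" .
qed

lemma nn_integral_count_space_leI:
  fixes f :: "nat \<Rightarrow> ennreal"
  assumes "\<And>S. finite S \<Longrightarrow> S \<subseteq> A \<Longrightarrow> sum f S \<le> K"
  shows "(\<integral>\<^sup>+m. f m \<partial>count_space A) \<le> K"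
  unfolding infsum_eq_nn_integral_count_space[symmetric]
  by (subst nonneg_infsum_complete) (auto intro!: SUP_least assms)

section \<open>Paley's inequality for a bounded orthogonal system\<close>

lemma bessel_inequality:
  fixes \<phi> :: "nat \<Rightarrow> 'a \<Rightarrow> real"
  assumes "finite_measure M"
    and phi[measurable]: "\<And>m. \<phi> m \<in> borel_measurable M"
    and bd: "\<And>m x. \<bar>\<phi> m x\<bar> \<le> 1"
    and orth: "\<And>m n. 1 \<le> m \<Longrightarrow> 1 \<le> n \<Longrightarrow> (LINT x|M. \<phi> m x * \<phi> n x) = (if m = n then B else 0)"
    and B: "0 < B" and g[measurable]: "g \<in> borel_measurable M"
  shows "(\<Sum>\<^sup>+m. ennreal ((LINT x|M. g x * \<phi> m x)\<^sup>2))
    \<le> ennreal B * (\<integral>\<^sup>+x. ennreal ((g x)\<^sup>2) \<partial>M)"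
proof (cases "(\<integral>\<^sup>+x. ennreal ((g x)\<^sup>2) \<partial>M) = \<infinity>")
  case True
  then show ?thesis using B by (simp add: ennreal_mult_top)
next
  case False
  interpret finite_measure M by fact
  have g2: "integrable M (\<lambda>x. (g x)\<^sup>2)"
    by (rule integrableI_nonneg) (use False in \<open>auto simp: less_top[symmetric]\<close>)
  have g1: "integrable M g"
  proof (rule Bochner_Integration.integrable_bound)
    show "integrable M (\<lambda>x. 1 + (g x)\<^sup>2)" using g2 by simp
    show "AE x in M. norm (g x) \<le> norm (1 + (g x)\<^sup>2)"
    proof (rule AE_I2)
      fix x
      have "0 \<le> (\<bar>g x\<bar> - 1)\<^sup>2 + \<bar>g x\<bar>\<^sup>2 + 1" by (intro add_nonneg_nonneg) auto
      then show "norm (g x) \<le> norm (1 + (g x)\<^sup>2)" by (simp add: power2_eq_square algebra_simps)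
    qed
  qed simp
  define c where "c m = (LINT x|M. g x * \<phi> m x)" for m
  have gp: "integrable M (\<lambda>x. g x * \<phi> m x)" for m
    by (rule Bochner_Integration.integrable_bound[OF g1])
      (use bd in \<open>auto simp: abs_mult intro!: AE_I2 mult_left_le\<close>)
  have pp: "integrable M (\<lambda>x. \<phi> m x * \<phi> n x)" for m n
    by (rule integrable_const_bound[where B=1])
      (use bd in \<open>auto simp: abs_mult intro!: AE_I2 mult_le_one\<close>)
  show ?thesis
  proof (rule nn_integral_count_space_leI)
    fix S :: "nat set" assume S: "finite S" "S \<subseteq> {1..}"
    define s where "s = (\<Sum>m\<in>S. (c m)\<^sup>2)"
    define T where "T x = (\<Sum>m\<in>S. c m / B * \<phi> m x)" for x
    have gT: "integrable M (\<lambda>x. g x * T x)" "(LINT x|M. g x * T x) = s / B"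
    proof -
      have eq: "(\<lambda>x. g x * T x) = (\<lambda>x. \<Sum>m\<in>S. c m / B * (g x * \<phi> m x))"
        by (auto simp: T_def sum_distrib_left mult_ac)
      show "integrable M (\<lambda>x. g x * T x)" unfolding eq using gp by auto
      show "(LINT x|M. g x * T x) = s / B" unfolding eq using gp
        by (simp add: Bochner_Integration.integral_sum s_def c_def[symmetric] sum_divide_distrib power2_eq_square)
    qed
    have TT: "integrable M (\<lambda>x. T x * T x)" "(LINT x|M. T x * T x) = s / B"
    proof -
      have eq: "(\<lambda>x. T x * T x) = (\<lambda>x. \<Sum>m\<in>S. \<Sum>n\<in>S. c m / B * (c n / B) * (\<phi> m x * \<phi> n x))"
        by (auto simp: T_def sum_product mult_ac)
      show "integrable M (\<lambda>x. T x * T x)" unfolding eq using pp by auto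
      have "(LINT x|M. T x * T x) = (\<Sum>m\<in>S. \<Sum>n\<in>S. c m / B * (c n / B) * (if m = n then B else 0))"
        unfolding eq using pp S
        by (subst Bochner_Integration.integral_sum, force)+ (auto intro!: sum.cong simp: orth subset_eq)
      also have "\<dots> = (\<Sum>m\<in>S. c m / B * (c m / B) * B)"
        by (intro sum.cong refl) (use S in \<open>simp add: if_distrib sum.delta' cong: if_cong\<close>)
      also have "\<dots> = s / B" using B by (simp add: s_def sum_divide_distrib power2_eq_square)
      finally show "(LINT x|M. T x * T x) = s / B" .
    qed
    \<comment> \<open>Expanding the distance from \<open>g\<close> to its projection \<open>T\<close> on the finitely many functions.\<close>
    have "0 \<le> (LINT x|M. (g x - T x)\<^sup>2)" by simp
    also have "(LINT x|M. (g x - T x)\<^sup>2) = (LINT x|M. (g x)\<^sup>2 - 2 * (g x * T x) + T x * T x)"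
      by (intro Bochner_Integration.integral_cong) (auto simp: power2_eq_square algebra_simps)
    also have "\<dots> = (LINT x|M. (g x)\<^sup>2) - s / B"
      using g2 gT TT by simp
    finally have "s \<le> B * (LINT x|M. (g x)\<^sup>2)" using B by (simp add: field_simps)
    then have "ennreal s \<le> ennreal B * ennreal (LINT x|M. (g x)\<^sup>2)"
      using B by (simp add: ennreal_mult[symmetric] ennreal_leI)
    also have "ennreal (LINT x|M. (g x)\<^sup>2) = (\<integral>\<^sup>+x. ennreal ((g x)\<^sup>2) \<partial>M)"
      by (rule nn_integral_eq_integral[symmetric]) (use g2 in auto)
    finally show "(\<Sum>m\<in>S. ennreal ((LINT x|M. g x * \<phi> m x)\<^sup>2)) \<le> ennreal B * (\<integral>\<^sup>+x. ennreal ((g x)\<^sup>2) \<partial>M)"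
      by (simp add: s_def c_def)
  qed
qed

lemma nn_integral_powr_from_0:
  assumes "0 < a" "0 \<le> u"
  shows "(\<integral>\<^sup>+t. ennreal (t powr (a - 1)) * indicator {0<..<u} t \<partial>lborel) = ennreal (u powr a / a)"
proof -
  have "((\<lambda>t. t powr (a - 1)) has_integral (u powr (a - 1 + 1) / (a - 1 + 1))) {0..u}"
    by (rule has_integral_powr_from_0) (use assms in auto)
  then have "((\<lambda>t. t powr (a - 1)) has_integral (u powr a / a)) {0<..<u}"
    by (simp add: has_integral_Icc_iff_Ioo)
  then have "((\<lambda>t. if t \<in> {0<..<u} then t powr (a - 1) else 0) has_integral (u powr a / a)) UNIV"
    by (simp only: has_integral_restrict_UNIV)
  from nn_integral_has_integral_lborel[OF _ _ this]
  have "(\<integral>\<^sup>+t. ennreal (if t \<in> {0<..<u} then t powr (a - 1) else 0) \<partial>lborel) = ennreal (u powr a / a)"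
    by auto
  also have "(\<integral>\<^sup>+t. ennreal (if t \<in> {0<..<u} then t powr (a - 1) else 0) \<partial>lborel)
    = (\<integral>\<^sup>+t. ennreal (t powr (a - 1)) * indicator {0<..<u} t \<partial>lborel)"
    by (intro nn_integral_cong) (auto split: split_indicator)
  finally show ?thesis .
qed

lemma nn_integral_powr_atLeast:
  assumes "0 < a" "0 < u"
  shows "(\<integral>\<^sup>+t. ennreal (t powr (- a - 1)) * indicator {u..} t \<partial>lborel) = ennreal (u powr (- a) / a)"
proof -
  have "(\<integral>\<^sup>+t. ennreal (t powr (- a - 1)) * indicator {u..} t \<partial>lborel) = ennreal (0 - (- (u powr (- a) / a)))"
  proof (rule nn_integral_FTC_atLeast)
    fix t assume "u \<le> t"
    then show "((\<lambda>t. - (t powr (- a) / a)) has_real_derivative t powr (- a - 1)) (at t)"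
      using assms by (auto intro!: derivative_eq_intros)
    show "0 \<le> t powr (- a - 1)" by simp
  next
    have "((\<lambda>t::real. t powr (- a)) \<longlongrightarrow> 0) at_top"
      by (rule tendsto_neg_powr) (use assms in \<open>auto simp: filterlim_ident\<close>)
    from tendsto_minus[OF tendsto_divide[OF this tendsto_const[of a]]] assms
    show "((\<lambda>t. - (t powr (- a) / a)) \<longlongrightarrow> 0) at_top" by simp
  qed simp
  then show ?thesis by simp
qed

lemma tail_sum_inverse_squares:
  assumes "0 \<le> x"
  shows "(\<Sum>\<^sup>+m. ennreal (1 / (real m)\<^sup>2) * indicator {m. 1 < x * real m} m) \<le> ennreal (2 * x)"
proof (rule nn_integral_count_space_leI)
  fix S :: "nat set" assume S: "finite S" "S \<subseteq> {1..}"
  define S' where "S' = {m\<in>S. 1 < x * real m}"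
  have S': "finite S'" "S' \<subseteq> {1..}" using S by (auto simp: S'_def)
  have "(\<Sum>m\<in>S'. 1 / (real m)\<^sup>2) \<le> 2 * x"
  proof (cases "S' = {}")
    case True
    then show ?thesis using assms by simp
  next
    case False
    define k where "k = Min S'"
    have k: "k \<in> S'" using S' False by (simp add: k_def)
    then have k1: "1 \<le> k" "1 < x * real k" using S' by (auto simp: S'_def)
    define l where "l = Max S'"
    have "S' \<subseteq> {k..l}" using S' by (auto simp: k_def l_def)
    have kl: "k \<le> l" using k S' by (auto simp: l_def)
    have "(\<Sum>m\<in>S'. 1 / (real m)\<^sup>2) \<le> (\<Sum>m=k..l. 1 / (real m)\<^sup>2)"
      by (rule sum_mono2) (use \<open>S' \<subseteq> {k..l}\<close> in auto)
    \<comment> \<open>The sum of \<open>1/m\<^sup>2\<close> over \<open>m \<ge> k\<close> is at most \<open>2/k\<close>, by comparison with a telescoping series.\<close>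
    also have "\<dots> \<le> (\<Sum>m=k..l. 2 * (1 / real m - 1 / real (Suc m)))"
    proof (rule sum_mono)
      fix m assume "m \<in> {k..l}"
      then have "1 \<le> real m" using k1 by simp
      have "1 / real m - 1 / real (Suc m) = 1 / (real m * (real m + 1))"
        using \<open>1 \<le> real m\<close> by (simp add: field_simps)
      moreover have "1 / (real m)\<^sup>2 \<le> 2 / (real m * (real m + 1))"
      proof -
        have "real m * (real m + 1) \<le> 2 * (real m)\<^sup>2"
          using mult_left_mono[of 1 "real m" "real m"] \<open>1 \<le> real m\<close>
          by (simp add: power2_eq_square distrib_left)
        then have "2 / (2 * (real m)\<^sup>2) \<le> 2 / (real m * (real m + 1))"
          using \<open>1 \<le> real m\<close> by (intro divide_left_mono mult_pos_pos) auto
        then show ?thesis by simp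
      qed
      ultimately show "1 / (real m)\<^sup>2 \<le> 2 * (1 / real m - 1 / real (Suc m))" by simp
    qed
    also have "\<dots> = 2 * (1 / real k - 1 / real (Suc l))"
      unfolding sum_distrib_left[symmetric]
      using kl sum_Suc_diff[of k l "\<lambda>m. - (1 / real m)"] by simp
    also have "\<dots> \<le> 2 * (1 / real k)" by simp
    also have "\<dots> \<le> 2 * x" using k1 by (simp add: field_simps)
    finally show ?thesis .
  qed
  moreover have "(\<Sum>m\<in>S. ennreal (1 / (real m)\<^sup>2) * indicator {m. 1 < x * real m} m) = (\<Sum>m\<in>S'. ennreal (1 / (real m)\<^sup>2))"
    unfolding S'_def sum.inter_filter[OF S(1)] by (auto intro!: sum.cong split: split_indicator)
  ultimately show "(\<Sum>m\<in>S. ennreal (1 / (real m)\<^sup>2) * indicator {m. 1 < x * real m} m) \<le> ennreal (2 * x)"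
    by (simp add: sum_ennreal ennreal_leI)
qed

text \<open>The weak-type estimate behind Marcinkiewicz interpolation. On the positive integers with masses
  \<open>1/m\<^sup>2\<close>, the map sending \<open>g\<close> to \<open>m * \<integral> g \<phi>\<^sub>m\<close> is bounded on \<open>L\<^sub>2\<close> by Bessel's inequality and of weak
  type \<open>(1,1)\<close> because \<open>\<bar>\<phi>\<^sub>m\<bar> \<le> 1\<close>. At level \<open>2t\<close> the part of \<open>g\<close> with \<open>\<bar>g\<bar> \<le> t\<close> is treated by the former and the
  part with \<open>\<bar>g\<bar> > t\<close> by the latter.\<close>

lemma paley_distribution_bound:
  fixes \<phi> :: "nat \<Rightarrow> 'a \<Rightarrow> real" and g :: "'a \<Rightarrow> real"
  assumes phi[measurable]: "\<And>m. \<phi> m \<in> borel_measurable M"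
    and bd: "\<And>m x. \<bar>\<phi> m x\<bar> \<le> 1"
    and bessel: "\<And>u. u \<in> borel_measurable M \<Longrightarrow>
      (\<Sum>\<^sup>+m. ennreal ((LINT x|M. u x * \<phi> m x)\<^sup>2))
        \<le> ennreal B * (\<integral>\<^sup>+x. ennreal ((u x)\<^sup>2) \<partial>M)"
    and g: "integrable M g" and t: "0 < t"
  shows "(\<Sum>\<^sup>+m. ennreal (1 / (real m)\<^sup>2)
        * indicator {m. 2 * t < real m * \<bar>LINT x|M. g x * \<phi> m x\<bar>} m)
    \<le> ennreal (t powr -2) * (ennreal B * (\<integral>\<^sup>+x. ennreal ((g x)\<^sup>2) * indicator {x. \<bar>g x\<bar> \<le> t} x \<partial>M))
      + ennreal (t powr -1) * (2 * (\<integral>\<^sup>+x. ennreal \<bar>g x\<bar> * indicator {x. t < \<bar>g x\<bar>} x \<partial>M))"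
proof -
  have [measurable]: "g \<in> borel_measurable M" using g by auto
  define g0 where "g0 x = g x * indicator {x. \<bar>g x\<bar> \<le> t} x" for x
  define g1 where "g1 x = g x * indicator {x. t < \<bar>g x\<bar>} x" for x
  have [measurable]: "g0 \<in> borel_measurable M" "g1 \<in> borel_measurable M"
    by (auto simp: g0_def[abs_def] g1_def[abs_def] indicator_def)
  have int0: "integrable M g0" and int1: "integrable M g1"
    by (rule Bochner_Integration.integrable_bound[OF g]; auto simp: g0_def g1_def split: split_indicator)+
  have intp: "integrable M (\<lambda>x. u x * \<phi> m x)" if "integrable M u" for u m
    by (rule Bochner_Integration.integrable_bound[OF that])
      (use bd that in \<open>auto simp: abs_mult intro!: AE_I2 mult_left_le\<close>)
  define c0 where "c0 m = (LINT x|M. g0 x * \<phi> m x)" for m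
  define a where "a = (LINT x|M. \<bar>g1 x\<bar>)"
  have a: "0 \<le> a" by (simp add: a_def)
  have split_c: "\<bar>LINT x|M. g x * \<phi> m x\<bar> \<le> \<bar>c0 m\<bar> + a" for m
  proof -
    have "(LINT x|M. g x * \<phi> m x) = (LINT x|M. g0 x * \<phi> m x + g1 x * \<phi> m x)"
      by (intro Bochner_Integration.integral_cong) (auto simp: g0_def g1_def split: split_indicator)
    also have "\<dots> = c0 m + (LINT x|M. g1 x * \<phi> m x)"
      using intp int0 int1 by (simp add: c0_def)
    finally have "\<bar>LINT x|M. g x * \<phi> m x\<bar> \<le> \<bar>c0 m\<bar> + \<bar>LINT x|M. g1 x * \<phi> m x\<bar>" by simp
    also have "\<bar>LINT x|M. g1 x * \<phi> m x\<bar> \<le> (LINT x|M. \<bar>g1 x * \<phi> m x\<bar>)"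
      by (rule integral_abs_bound)
    also have "(LINT x|M. \<bar>g1 x * \<phi> m x\<bar>) \<le> a"
      unfolding a_def
    proof (rule integral_mono)
      show "integrable M (\<lambda>x. \<bar>g1 x * \<phi> m x\<bar>)" using intp[OF int1, of m] by (rule integrable_abs)
      show "integrable M (\<lambda>x. \<bar>g1 x\<bar>)" using int1 by (rule integrable_abs)
      show "\<bar>g1 x * \<phi> m x\<bar> \<le> \<bar>g1 x\<bar>" for x
        using bd by (simp add: abs_mult mult_left_le)
    qed
    finally show ?thesis by simp
  qed
  have "(\<Sum>\<^sup>+m. ennreal (1 / (real m)\<^sup>2)
        * indicator {m. 2 * t < real m * \<bar>LINT x|M. g x * \<phi> m x\<bar>} m)
    \<le> (\<Sum>\<^sup>+m. ennreal (t powr -2) * ennreal ((c0 m)\<^sup>2)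
        + ennreal (1 / (real m)\<^sup>2) * indicator {m. 1 < (a / t) * real m} m)"
  proof (rule nn_integral_mono)
    fix m :: nat assume "m \<in> space (count_space {1..})"
    then have m: "1 \<le> real m" by simp
    show "ennreal (1 / (real m)\<^sup>2) * indicator {m. 2 * t < real m * \<bar>LINT x|M. g x * \<phi> m x\<bar>} m
      \<le> ennreal (t powr -2) * ennreal ((c0 m)\<^sup>2)
        + ennreal (1 / (real m)\<^sup>2) * indicator {m. 1 < (a / t) * real m} m"
    proof (cases "2 * t < real m * \<bar>LINT x|M. g x * \<phi> m x\<bar> \<and> \<not> 1 < (a / t) * real m")
      case True
      then have "real m * a \<le> t" using t by (simp add: field_simps)
      moreover have "2 * t < real m * (\<bar>c0 m\<bar> + a)"
        using True split_c[of m] m by (meson less_le_trans mult_left_mono of_nat_0_le_iff)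
      ultimately have "t \<le> real m * \<bar>c0 m\<bar>" by (simp add: algebra_simps)
      then have "t\<^sup>2 \<le> (real m)\<^sup>2 * (c0 m)\<^sup>2"
        using t power_mono[of t "real m * \<bar>c0 m\<bar>" 2] by (simp add: power_mult_distrib)
      then have "1 / (real m)\<^sup>2 \<le> t powr -2 * (c0 m)\<^sup>2"
        using t m by (simp add: powr_minus powr_numeral field_simps)
      then show ?thesis using True by (auto simp: ennreal_mult[symmetric] intro!: ennreal_leI)
    next
      case False
      then show ?thesis by (auto split: split_indicator)
    qed
  qed
  also have "\<dots> = ennreal (t powr -2) * (\<Sum>\<^sup>+m. ennreal ((c0 m)\<^sup>2))
      + (\<Sum>\<^sup>+m. ennreal (1 / (real m)\<^sup>2) * indicator {m. 1 < (a / t) * real m} m)"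
    by (simp add: nn_integral_add nn_integral_cmult)
  also have "\<dots> \<le> ennreal (t powr -2) * (ennreal B * (\<integral>\<^sup>+x. ennreal ((g0 x)\<^sup>2) \<partial>M))
      + ennreal (2 * (a / t))"
    unfolding c0_def
    by (intro add_mono mult_left_mono bessel tail_sum_inverse_squares) (use a t in auto)
  also have "(\<integral>\<^sup>+x. ennreal ((g0 x)\<^sup>2) \<partial>M) = (\<integral>\<^sup>+x. ennreal ((g x)\<^sup>2) * indicator {x. \<bar>g x\<bar> \<le> t} x \<partial>M)"
    by (intro nn_integral_cong) (auto simp: g0_def split: split_indicator)
  also have "ennreal (2 * (a / t)) = ennreal (t powr -1) * (2 * ennreal a)"
    using a t by (simp add: powr_minus ennreal_mult[symmetric] divide_inverse mult_ac flip: ennreal_numeral)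
  also have "ennreal a = (\<integral>\<^sup>+x. ennreal \<bar>g1 x\<bar> \<partial>M)"
    unfolding a_def by (rule nn_integral_eq_integral[symmetric]) (use int1 in auto)
  also have "\<dots> = (\<integral>\<^sup>+x. ennreal \<bar>g x\<bar> * indicator {x. t < \<bar>g x\<bar>} x \<partial>M)"
    by (intro nn_integral_cong) (auto simp: g1_def split: split_indicator)
  finally show ?thesis .
qed

text \<open>Integrating the distributional bound against \<open>t powr (p - 1)\<close> and exchanging the integrations gives
  Paley's inequality with a constant that blows up as \<open>p\<close> approaches 1 or 2. The end point \<open>p = 2\<close> is
  Bessel's inequality itself.\<close>

lemma paley_inequality:
  fixes \<phi> :: "nat \<Rightarrow> 'a \<Rightarrow> real"
  assumes "sigma_finite_measure M" and phi[measurable]: "\<And>m. \<phi> m \<in> borel_measurable M"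
    and bd: "\<And>m x. \<bar>\<phi> m x\<bar> \<le> 1"
    and bessel: "\<And>u. u \<in> borel_measurable M \<Longrightarrow>
      (\<Sum>\<^sup>+m. ennreal ((LINT x|M. u x * \<phi> m x)\<^sup>2))
        \<le> ennreal B * (\<integral>\<^sup>+x. ennreal ((u x)\<^sup>2) \<partial>M)"
    and B: "0 < B" and p: "1 < p" "p \<le> 2"
  shows "\<exists>C>0. \<forall>g::'a \<Rightarrow> real. integrable M g \<longrightarrow>
    (\<Sum>\<^sup>+m. ennreal (real m powr (p - 2) * \<bar>LINT x|M. g x * \<phi> m x\<bar> powr p))
      \<le> ennreal C * (\<integral>\<^sup>+x. ennreal (\<bar>g x\<bar> powr p) \<partial>M)"
proof (cases "p = 2")
  case True
  have "(\<Sum>\<^sup>+m. ennreal (real m powr (p - 2) * \<bar>LINT x|M. g x * \<phi> m x\<bar> powr p))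
      \<le> ennreal B * (\<integral>\<^sup>+x. ennreal (\<bar>g x\<bar> powr p) \<partial>M)"
    if "integrable M g" for g :: "'a \<Rightarrow> real"
  proof -
    have "(\<Sum>\<^sup>+m. ennreal (real m powr (p - 2) * \<bar>LINT x|M. g x * \<phi> m x\<bar> powr p))
      = (\<Sum>\<^sup>+m. ennreal ((LINT x|M. g x * \<phi> m x)\<^sup>2))"
      by (intro nn_integral_cong) (simp add: True powr_numeral)
    then show ?thesis using bessel[of g] that by (simp add: True powr_numeral)
  qed
  then show ?thesis using B by blast
next
  case False
  then have p2: "p < 2" using p by simp
  interpret sigma_finite_measure M by fact
  interpret LM: pair_sigma_finite lborel M ..
  define C where "C = 2 powr p * p * (B / (2 - p) + 2 / (p - 1))"
  have C: "0 < C" unfolding C_def using p p2 B by (intro mult_pos_pos add_pos_pos) auto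
  show ?thesis
  proof (intro exI[of _ C] conjI allI impI C)
    fix g :: "'a \<Rightarrow> real" assume g: "integrable M g"
    then have [measurable]: "g \<in> borel_measurable M" by auto
    define u where "u m = real m * \<bar>LINT x|M. g x * \<phi> m x\<bar>" for m
    have u0: "0 \<le> u m" for m by (simp add: u_def)
    let ?W = "\<lambda>m t. ennreal (1 / (real m)\<^sup>2) * indicator {m. 2 * t < u m} m"
    let ?P = "\<lambda>t. ennreal (t powr (p - 1)) * indicator {0<..} t :: ennreal"
    let ?G0 = "\<lambda>t. \<integral>\<^sup>+x. ennreal ((g x)\<^sup>2) * indicator {x. \<bar>g x\<bar> \<le> t} x \<partial>M"
    let ?G1 = "\<lambda>t. \<integral>\<^sup>+x. ennreal \<bar>g x\<bar> * indicator {x. t < \<bar>g x\<bar>} x \<partial>M"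
    let ?K0 = "\<lambda>t x. ennreal (t powr (p - 3)) * indicator {0<..} t * indicator {x. \<bar>g x\<bar> \<le> t} x"
    let ?K1 = "\<lambda>t x. ennreal (t powr (p - 2)) * indicator {0<..} t * indicator {x. t < \<bar>g x\<bar>} x"
    let ?E = "\<lambda>t x. ennreal B * ennreal ((g x)\<^sup>2) * ?K0 t x + 2 * ennreal \<bar>g x\<bar> * ?K1 t x"
    let ?D = "\<lambda>t. ennreal (t powr -2) * (ennreal B * ?G0 t) + ennreal (t powr -1) * (2 * ?G1 t)"
    \<comment> \<open>The layer-cake formula for \<open>(m * c) powr p\<close>, with levels written as \<open>2t\<close>.\<close>
    have pow: "ennreal (real m powr (p - 2) * \<bar>LINT x|M. g x * \<phi> m x\<bar> powr p)
       = ennreal (2 powr p * p) * (\<integral>\<^sup>+t. ?P t * ?W m t \<partial>lborel)"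
      if m: "1 \<le> m" for m
    proof -
      have "(\<integral>\<^sup>+t. ?P t * ?W m t \<partial>lborel)
        = (\<integral>\<^sup>+t. ennreal (1 / (real m)\<^sup>2) * (ennreal (t powr (p - 1)) * indicator {0<..<u m / 2} t) \<partial>lborel)"
        by (intro nn_integral_cong) (auto split: split_indicator simp: mult_ac)
      also have "\<dots> = ennreal (1 / (real m)\<^sup>2) * ennreal ((u m / 2) powr p / p)"
        using nn_integral_powr_from_0[of p "u m / 2"] p u0[of m] by (simp add: nn_integral_cmult)
      finally show ?thesis
        using p m u0[of m]
        by (simp add: ennreal_mult[symmetric] u_def powr_mult powr_divide powr_diff powr_numeral field_simps)
    qed
    have "(\<Sum>\<^sup>+m. ennreal (real m powr (p - 2) * \<bar>LINT x|M. g x * \<phi> m x\<bar> powr p))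
      = ennreal (2 powr p * p) * (\<Sum>\<^sup>+m. \<integral>\<^sup>+t. ?P t * ?W m t \<partial>lborel)" (is "?L = _ * ?R")
      by (subst nn_integral_cmult[symmetric], simp) (intro nn_integral_cong, use pow in auto)
    then have layers: "?L = ennreal (2 powr p * p) * ?R" .
    have "(\<Sum>\<^sup>+m. \<integral>\<^sup>+t. ?P t * ?W m t \<partial>lborel)
       = (\<integral>\<^sup>+t. \<Sum>\<^sup>+m. ?P t * ?W m t \<partial>lborel)"
      by (rule nn_integral_count_space_nn_integral[symmetric]) (auto simp: indicator_def)
    also have "\<dots> = (\<integral>\<^sup>+t. ?P t * (\<Sum>\<^sup>+m. ?W m t) \<partial>lborel)"
      by (simp add: nn_integral_cmult)
    also have "\<dots> \<le> (\<integral>\<^sup>+t. ?P t * ?D t \<partial>lborel)"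
    proof (rule nn_integral_mono)
      fix t :: real
      show "?P t * (\<Sum>\<^sup>+m. ?W m t)
        \<le> ?P t * ?D t"
      proof (cases "0 < t")
        case True
        from paley_distribution_bound[OF phi bd bessel g True] show ?thesis
          by (intro mult_left_mono) (auto simp: u_def)
      qed auto
    qed
    also have "\<dots> = (\<integral>\<^sup>+t. \<integral>\<^sup>+x. ?E t x \<partial>M \<partial>lborel)"
    proof (rule nn_integral_cong)
      fix t :: real
      show "?P t * ?D t = (\<integral>\<^sup>+x. ?E t x \<partial>M)"
      proof (cases "0 < t")
        case True
        have e: "t powr (p - 1) * t powr -2 = t powr (p - 3)" "t powr (p - 1) * t powr -1 = t powr (p - 2)"
          using powr_add[of t "p - 1" "-2"] powr_add[of t "p - 1" "-1"] by (simp_all del: powr_neg_numeral)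
        have "(\<integral>\<^sup>+x. ?E t x \<partial>M)
          = (\<integral>\<^sup>+x. ennreal (t powr (p - 3)) * ennreal B * (ennreal ((g x)\<^sup>2) * indicator {x. \<bar>g x\<bar> \<le> t} x)
            + ennreal (t powr (p - 2)) * 2 * (ennreal \<bar>g x\<bar> * indicator {x. t < \<bar>g x\<bar>} x) \<partial>M)"
          using True by (intro nn_integral_cong) (simp add: mult_ac)
        also have "\<dots> = ennreal (t powr (p - 3)) * ennreal B * ?G0 t
            + ennreal (t powr (p - 2)) * 2 * ?G1 t"
          by (subst nn_integral_add) (auto simp: nn_integral_cmult)
        finally have eq: "(\<integral>\<^sup>+x. ?E t x \<partial>M) = \<dots>" .
        have i: "indicator {0<..} t = (1::ennreal)" using True by simp
        show ?thesis
          unfolding eq unfolding i e[symmetric] ennreal_mult[OF powr_ge_zero powr_ge_zero]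
          by (simp only: distrib_left mult.assoc mult_1_left mult_1_right)
      qed simp
    qed
    also have "\<dots> = (\<integral>\<^sup>+x. \<integral>\<^sup>+t. ?E t x \<partial>lborel \<partial>M)"
      by (rule LM.Fubini'[symmetric]) (simp add: indicator_def)
    also have "\<dots> = (\<integral>\<^sup>+x. ennreal (B / (2 - p) + 2 / (p - 1)) * ennreal (\<bar>g x\<bar> powr p) \<partial>M)"
    proof (rule nn_integral_cong)
      fix x
      let ?G = "\<bar>g x\<bar>"
      have "(\<integral>\<^sup>+t. ?E t x \<partial>lborel)
        = ennreal B * ennreal ((g x)\<^sup>2) * (\<integral>\<^sup>+t. ?K0 t x \<partial>lborel)
        + 2 * ennreal \<bar>g x\<bar> * (\<integral>\<^sup>+t. ?K1 t x \<partial>lborel)"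
        by (subst nn_integral_add) (auto simp: nn_integral_cmult indicator_def)
      also have "\<dots> = ennreal (B / (2 - p) + 2 / (p - 1)) * ennreal (\<bar>g x\<bar> powr p)"
      proof (cases "g x = 0")
        case False
        have "(\<integral>\<^sup>+t. ?K0 t x \<partial>lborel)
          = (\<integral>\<^sup>+t. ennreal (t powr (- (2 - p) - 1)) * indicator {?G..} t \<partial>lborel)"
          using False by (intro nn_integral_cong) (auto split: split_indicator)
        also have "\<dots> = ennreal (?G powr (- (2 - p)) / (2 - p))"
          by (rule nn_integral_powr_atLeast) (use False p2 in auto)
        finally have 1: "(\<integral>\<^sup>+t. ?K0 t x \<partial>lborel)
          = ennreal (?G powr (p - 2) / (2 - p))" by simp
        have "(\<integral>\<^sup>+t. ?K1 t x \<partial>lborel)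
          = (\<integral>\<^sup>+t. ennreal (t powr ((p - 1) - 1)) * indicator {0<..<?G} t \<partial>lborel)"
          by (intro nn_integral_cong) (auto split: split_indicator)
        also have "\<dots> = ennreal (?G powr (p - 1) / (p - 1))"
          by (rule nn_integral_powr_from_0) (use p in auto)
        finally have 2: "(\<integral>\<^sup>+t. ?K1 t x \<partial>lborel)
          = ennreal (?G powr (p - 1) / (p - 1))" .
        have e: "?G\<^sup>2 * ?G powr (p - 2) = ?G powr p" "?G * ?G powr (p - 1) = ?G powr p"
          using False by (simp_all add: powr_diff powr_numeral)
        have "ennreal B * ennreal ((g x)\<^sup>2) * ennreal (?G powr (p - 2) / (2 - p)) + 2 * ennreal ?G * ennreal (?G powr (p - 1) / (p - 1))
          = ennreal (B * ?G\<^sup>2 * (?G powr (p - 2) / (2 - p)) + 2 * ?G * (?G powr (p - 1) / (p - 1)))"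
        proof -
          have "ennreal B * ennreal s * ennreal a + 2 * ennreal v * ennreal b = ennreal (B * s * a + 2 * v * b)"
            if "0 \<le> s" "0 \<le> a" "0 \<le> v" "0 \<le> b" for s a v b
            using that B by (simp add: ennreal_mult ennreal_plus)
          from this[of "?G\<^sup>2" "?G powr (p - 2) / (2 - p)" ?G "?G powr (p - 1) / (p - 1)"] p p2
          show ?thesis by simp
        qed
        also have "B * ?G\<^sup>2 * (?G powr (p - 2) / (2 - p)) + 2 * ?G * (?G powr (p - 1) / (p - 1))
          = B / (2 - p) * (?G\<^sup>2 * ?G powr (p - 2)) + 2 / (p - 1) * (?G * ?G powr (p - 1))" by simp
        also have "\<dots> = (B / (2 - p) + 2 / (p - 1)) * ?G powr p"
          unfolding e by (simp add: distrib_right)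
        finally show ?thesis unfolding 1 2 using B p p2 by (simp add: ennreal_mult)
      qed simp
      finally show "(\<integral>\<^sup>+t. ?E t x \<partial>lborel)
        = ennreal (B / (2 - p) + 2 / (p - 1)) * ennreal (\<bar>g x\<bar> powr p)" .
    qed
    also have "\<dots> = ennreal (B / (2 - p) + 2 / (p - 1)) * (\<integral>\<^sup>+x. ennreal (\<bar>g x\<bar> powr p) \<partial>M)"
      by (rule nn_integral_cmult) simp
    finally have "?L \<le> ennreal (2 powr p * p) * (ennreal (B / (2 - p) + 2 / (p - 1)) * (\<integral>\<^sup>+x. ennreal (\<bar>g x\<bar> powr p) \<partial>M))"
      unfolding layers by (rule mult_left_mono) simp
    also have "ennreal (2 powr p * p) * (ennreal (B / (2 - p) + 2 / (p - 1)) * (\<integral>\<^sup>+x. ennreal (\<bar>g x\<bar> powr p) \<partial>M))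
      = ennreal C * (\<integral>\<^sup>+x. ennreal (\<bar>g x\<bar> powr p) \<partial>M)"
      using B p p2 by (simp add: C_def ennreal_mult mult.assoc)
    finally show "(\<Sum>\<^sup>+m. ennreal (real m powr (p - 2) * \<bar>LINT x|M. g x * \<phi> m x\<bar> powr p))
      \<le> ennreal C * (\<integral>\<^sup>+x. ennreal (\<bar>g x\<bar> powr p) \<partial>M)"
      .
  qed
qed

section \<open>The torus and the trigonometric system\<close>

text \<open>Lebesgue measure on \<open>[0, 2\<pi>]\<close>, kept as a Borel measure on the whole line so that measurability and
  translations need no restriction to the interval.\<close>

definition circle :: "real measure" where
  "circle = density lborel (indicator {0..2*pi})"

text \<open>The product measure, that is, Lebesgue measure on \<open>period_box\<close> as a Borel measure on the plane.\<close>

definition torus :: "(real \<times> real) measure" where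
  "torus = circle \<Otimes>\<^sub>M circle"

lemma sets_circle [simp, measurable_cong]: "sets circle = sets borel"
  and space_circle [simp]: "space circle = UNIV"
  by (simp_all add: circle_def)

lemma nn_integral_circle:
  assumes [measurable]: "f \<in> borel_measurable borel"
  shows "(\<integral>\<^sup>+x. f x \<partial>circle) = (\<integral>\<^sup>+x. f x * indicator {0..2*pi} x \<partial>lborel)"
  unfolding circle_def by (subst nn_integral_density) (auto simp: mult.commute)

lemma emeasure_circle: "emeasure circle UNIV = ennreal (2 * pi)"
  using nn_integral_circle[of "\<lambda>_. 1"] by (simp add: nn_integral_indicator)

lemma finite_measure_circle: "finite_measure circle"
proof (rule finite_measureI)
  show "emeasure circle (space circle) \<noteq> \<infinity>" by (simp only: space_circle emeasure_circle) simp
qed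

interpretation circle: finite_measure circle
  by (rule finite_measure_circle)

lemma sets_torus [simp, measurable_cong]: "sets torus = sets borel"
  and space_torus [simp]: "space torus = UNIV"
proof -
  show "sets torus = sets borel"
    unfolding torus_def borel_prod[symmetric] by (rule sets_pair_measure_cong) simp_all
  show "space torus = UNIV" by (simp add: torus_def space_pair_measure)
qed

interpretation circle_pair: pair_sigma_finite circle circle ..

interpretation torus: finite_measure torus
  unfolding torus_def by (rule finite_measure_pair_measure; rule finite_measure_circle)

lemma AE_circle: 
  assumes "AE x in lborel. P x" shows "AE x in circle. P x"
  using assms unfolding circle_def by (subst AE_density) auto

lemma period_box_borel [measurable]: "period_box \<in> sets borel"
  unfolding period_box_def by (intro borel_closed closed_Times) auto

lemma nn_integral_torus_lborel:
  assumes [measurable]: "f \<in> borel_measurable borel"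
  shows "(\<integral>\<^sup>+z. f z \<partial>torus) = (\<integral>\<^sup>+z. f z * indicator period_box z \<partial>lborel)"
proof -
  have [measurable]: "f \<in> borel_measurable (borel \<Otimes>\<^sub>M borel)" by (simp add: borel_prod)
  have "(\<integral>\<^sup>+z. f z \<partial>torus) = (\<integral>\<^sup>+x. \<integral>\<^sup>+y. f (x, y) \<partial>circle \<partial>circle)"
    unfolding torus_def by (rule circle.nn_integral_fst[symmetric]) simp
  also have "\<dots> = (\<integral>\<^sup>+x. \<integral>\<^sup>+y. f (x, y) * indicator period_box (x, y) \<partial>lborel \<partial>lborel)"
    by (auto simp: nn_integral_circle period_box_def nn_integral_multc[symmetric] mult.assoc
        intro!: nn_integral_cong split: split_indicator)
  also have "\<dots> = (\<integral>\<^sup>+z. f z * indicator period_box z \<partial>(lborel \<Otimes>\<^sub>M lborel))"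
    by (rule lborel.nn_integral_fst) (simp add: lborel_prod)
  finally show ?thesis by (simp add: lborel_prod)
qed

lemma torus_eq_density: "torus = density lborel (indicator period_box)"
proof (rule measure_eqI)
  fix A assume "A \<in> sets torus"
  then have [measurable]: "A \<in> sets borel" by simp
  have "emeasure torus A = (\<integral>\<^sup>+z. indicator A z \<partial>torus)" by simp
  also have "\<dots> = (\<integral>\<^sup>+z. indicator A z * indicator period_box z \<partial>lborel)"
    by (rule nn_integral_torus_lborel) simp
  also have "\<dots> = emeasure (density lborel (indicator period_box)) A"
    by (simp add: emeasure_density mult.commute)
  finally show "emeasure torus A = emeasure (density lborel (indicator period_box)) A" .
qed simp

lemma nn_integral_torus:
  assumes f: "f \<in> borel_measurable borel"
  shows "(\<integral>\<^sup>+z. f z \<partial>torus) = (\<integral>\<^sup>+y. \<integral>\<^sup>+x. f (x, y) \<partial>circle \<partial>circle)"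
proof -
  have "f \<in> borel_measurable (borel \<Otimes>\<^sub>M borel)" using f by (simp add: borel_prod)
  then show ?thesis
    unfolding torus_def by (intro circle_pair.nn_integral_snd[symmetric]) simp
qed

text \<open>The trigonometric system: \<open>trig False m\<close> is \<open>cos (m x)\<close> and \<open>trig True m\<close> is \<open>sin (m x)\<close>. The flag makes
  the four kinds of double Fourier coefficients one family.\<close>

definition trig :: "bool \<Rightarrow> nat \<Rightarrow> real \<Rightarrow> real" where
  "trig b m x = (if b then sin (real m * x) else cos (real m * x))"

lemma trig_measurable [measurable]: "trig b m \<in> borel_measurable borel"
  unfolding trig_def[abs_def] by simp

lemma abs_trig_le: "\<bar>trig b m x\<bar> \<le> 1"
  by (simp add: trig_def)

lemma trig_periodic: "trig b m (x + 2 * pi) = trig b m x"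
proof -
  have "real m * (x + 2 * pi) = real m * x + 2 * real m * pi" by (simp add: algebra_simps)
  then show ?thesis by (simp add: trig_def sin_add cos_add)
qed

lemma integrable_circle_bounded:
  fixes f :: "real \<Rightarrow> real"
  assumes "f \<in> borel_measurable borel" "\<And>x. \<bar>f x\<bar> \<le> K"
  shows "integrable circle f"
  by (rule circle.integrable_const_bound[where B=K]) (use assms in auto)

lemma integral_circle_FTC:
  fixes f F :: "real \<Rightarrow> real"
  assumes "\<And>x. (F has_real_derivative f x) (at x)" and cont: "continuous_on UNIV f"
  shows "(LINT x|circle. f x) = F (2 * pi) - F 0"
proof -
  have "(LINT x|circle. f x) = (LINT x|lborel. indicator {0..2*pi} x *\<^sub>R f x)"
    unfolding circle_def ennreal_indicator[symmetric]
    by (rule integral_density) (use cont in \<open>auto intro: borel_measurable_continuous_onI\<close>)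
  also have "\<dots> = F (2 * pi) - F 0"
  proof (rule integral_FTC_Icc)
    show "(F has_vector_derivative f x) (at x within {0..2*pi})" for x
      using assms(1)[of x] has_real_derivative_iff_has_vector_derivative has_vector_derivative_at_within by blast
    show "continuous_on {0..2*pi} f" using cont continuous_on_subset by blast
  qed auto
  finally show ?thesis .
qed

lemma integral_circle_cos: "(LINT x|circle. cos (of_int k * x)) = (if k = 0 then 2 * pi else 0)"
proof (cases "k = 0")
  case True
  then show ?thesis by (simp add: measure_def emeasure_circle)
next
  case False
  have "(LINT x|circle. cos (of_int k * x)) = sin (of_int k * (2 * pi)) / of_int k - sin (of_int k * 0) / of_int k"
    by (rule integral_circle_FTC) (use False in \<open>auto intro!: derivative_eq_intros continuous_intros\<close>)
  also have "sin (of_int k * (2 * pi)) = 0" by (metis mult.assoc mult.commute sin_int_2pin)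
  finally show ?thesis using False by simp
qed

lemma integral_circle_sin: "(LINT x|circle. sin (of_int k * x)) = 0"
proof (cases "k = 0")
  case False
  have "(LINT x|circle. sin (of_int k * x)) = - cos (of_int k * (2 * pi)) / of_int k - (- cos (of_int k * 0) / of_int k)"
    by (rule integral_circle_FTC) (use False in \<open>auto intro!: derivative_eq_intros continuous_intros\<close>)
  also have "cos (of_int k * (2 * pi)) = 1" by (metis mult.assoc mult.commute cos_int_2pin)
  finally show ?thesis using False by simp
qed simp

text \<open>The squared \<open>L\<^sub>2\<close> norm of \<open>trig b m\<close>, except that the zero function \<open>trig True 0\<close> also receives \<open>2\<pi>\<close>; its
  coefficients vanish, so it only ever appears in quotients with numerator 0.\<close>

definition trig_norm :: "nat \<Rightarrow> real" where
  "trig_norm m = (if m = 0 then 2 * pi else pi)"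

lemma trig_orthogonal:
  "(LINT x|circle. trig b m x * trig c n x) =
     (if b = c \<and> m = n \<and> \<not> (b \<and> m = 0) then trig_norm m else 0)"
proof -
  define d s where "d = int m - int n" and "s = int m + int n"
  have r: "real m * x - real n * x = of_int d * x" "real m * x + real n * x = of_int s * x" for x
    by (simp_all add: algebra_simps d_def s_def)
  have ic: "integrable circle (\<lambda>x. cos (of_int k * x))" "integrable circle (\<lambda>x. sin (of_int k * x))" for k
    by (rule integrable_circle_bounded[where K=1]; simp)+
  have C: "(LINT x|circle. cos (of_int d * x)) = (if m = n then 2 * pi else 0)"
    "(LINT x|circle. cos (of_int s * x)) = (if m = 0 \<and> n = 0 then 2 * pi else 0)"
    unfolding integral_circle_cos d_def s_def by auto
  consider "\<not> b" "\<not> c" | "b" "c" | "b" "\<not> c" | "\<not> b" "c" by blast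
  then show ?thesis
  proof cases
    case 1
    have "(LINT x|circle. trig b m x * trig c n x) = (LINT x|circle. (cos (of_int d * x) + cos (of_int s * x)) / 2)"
      using 1 by (intro Bochner_Integration.integral_cong) (simp_all only: trig_def cos_times_cos r if_False)
    also have "\<dots> = ((LINT x|circle. cos (of_int d * x)) + (LINT x|circle. cos (of_int s * x))) / 2"
      using ic by simp
    finally show ?thesis using 1 unfolding C by (auto simp: trig_norm_def)
  next
    case 2
    have "(LINT x|circle. trig b m x * trig c n x) = (LINT x|circle. (cos (of_int d * x) - cos (of_int s * x)) / 2)"
      using 2 by (intro Bochner_Integration.integral_cong) (simp_all only: trig_def sin_times_sin r if_True)
    also have "\<dots> = ((LINT x|circle. cos (of_int d * x)) - (LINT x|circle. cos (of_int s * x))) / 2"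
      using ic by simp
    finally show ?thesis using 2 unfolding C by (cases "m = n") (auto simp: trig_norm_def)
  next
    case 3
    have "(LINT x|circle. trig b m x * trig c n x) = (LINT x|circle. (sin (of_int s * x) + sin (of_int d * x)) / 2)"
      using 3 by (intro Bochner_Integration.integral_cong) (simp_all only: trig_def sin_times_cos r if_True if_False)
    also have "\<dots> = ((LINT x|circle. sin (of_int s * x)) + (LINT x|circle. sin (of_int d * x))) / 2"
      using ic by simp
    finally show ?thesis using 3 by (simp add: integral_circle_sin)
  next
    case 4
    have "(LINT x|circle. trig b m x * trig c n x) = (LINT x|circle. (sin (of_int s * x) - sin (of_int d * x)) / 2)"
      using 4 by (intro Bochner_Integration.integral_cong) (simp_all only: trig_def cos_times_sin r if_True if_False)
    also have "\<dots> = ((LINT x|circle. sin (of_int s * x)) - (LINT x|circle. sin (of_int d * x))) / 2"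
      using ic by simp
    finally show ?thesis using 4 by (simp add: integral_circle_sin)
  qed
qed

lemma paley_circle:
  assumes p: "1 < p" "p \<le> 2"
  shows "\<exists>C>0. \<forall>g::real \<Rightarrow> real. integrable circle g \<longrightarrow>
    (\<Sum>\<^sup>+m. ennreal (real m powr (p - 2) * \<bar>LINT x|circle. g x * trig b m x\<bar> powr p))
      \<le> ennreal C * (\<integral>\<^sup>+x. ennreal (\<bar>g x\<bar> powr p) \<partial>circle)"
proof (rule paley_inequality[where B=pi])
  show "(\<Sum>\<^sup>+m. ennreal ((LINT x|circle. u x * trig b m x)\<^sup>2))
    \<le> ennreal pi * (\<integral>\<^sup>+x. ennreal ((u x)\<^sup>2) \<partial>circle)" if "u \<in> borel_measurable circle" for u
    by (rule bessel_inequality)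
      (use that in \<open>auto simp: abs_trig_le trig_orthogonal trig_norm_def circle.finite_measure_axioms\<close>)
qed (use p in \<open>auto simp: abs_trig_le circle.sigma_finite_measure_axioms\<close>)

section \<open>Fourier coefficients and Paley's inequality on the torus\<close>

lemma trig_False_0: "trig False 0 x = 1"
  by (simp add: trig_def)

text \<open>The unnormalised coefficients \<open>\<integral> F e\<^sub>m e\<^sub>n\<close>; the flags choose cosine or sine in each variable.\<close>

definition fourier_coeff :: "(real \<times> real \<Rightarrow> real) \<Rightarrow> bool \<Rightarrow> bool \<Rightarrow> nat \<Rightarrow> nat \<Rightarrow> real" where
  "fourier_coeff F b c m n = (LINT z|torus. F z * (trig b m (fst z) * trig c n (snd z)))"

text \<open>The Euclidean norm of the four coefficients at one frequency. Unlike their sum of absolute values it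
  is multiplied exactly when the coefficients are rotated and scaled, as happens under differences.\<close>

definition amplitude :: "(real \<times> real \<Rightarrow> real) \<Rightarrow> nat \<Rightarrow> nat \<Rightarrow> real" where
  "amplitude F m n = sqrt (\<Sum>b\<in>UNIV. \<Sum>c\<in>UNIV. (fourier_coeff F b c m n)\<^sup>2)"

text \<open>The sum in Paley's inequality, for the amplitudes and for one of the four kinds of coefficients.\<close>

abbreviation amplitude_sum :: "real \<Rightarrow> (real \<times> real \<Rightarrow> real) \<Rightarrow> ennreal" where
  "amplitude_sum p F \<equiv> (\<Sum>\<^sup>+m. \<Sum>\<^sup>+n.
     ennreal (real m powr (p - 2) * real n powr (p - 2) * amplitude F m n powr p))"

abbreviation coeff_power_sum :: "real \<Rightarrow> (real \<times> real \<Rightarrow> real) \<Rightarrow> bool \<Rightarrow> bool \<Rightarrow> ennreal" where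
  "coeff_power_sum p F b c \<equiv> (\<Sum>\<^sup>+m. \<Sum>\<^sup>+n.
     ennreal (real m powr (p - 2) * real n powr (p - 2) * \<bar>fourier_coeff F b c m n\<bar> powr p))"

text \<open>The \<open>p\<close>-th power of the \<open>L\<^sub>p\<close> norm over the torus.\<close>

abbreviation moment :: "real \<Rightarrow> (real \<times> real \<Rightarrow> real) \<Rightarrow> ennreal" where
  "moment p F \<equiv> (\<integral>\<^sup>+z. ennreal (\<bar>F z\<bar> powr p) \<partial>torus)"

lemma amplitude_nonneg: "0 \<le> amplitude F m n"
  unfolding amplitude_def by (intro real_sqrt_ge_zero sum_nonneg) auto

lemma abs_coeff_le_amplitude: "\<bar>fourier_coeff F b c m n\<bar> \<le> amplitude F m n"
proof -
  have "(fourier_coeff F b c m n)\<^sup>2 \<le> (\<Sum>c\<in>UNIV. (fourier_coeff F b c m n)\<^sup>2)"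
    by (rule member_le_sum) auto
  also have "\<dots> \<le> (\<Sum>b\<in>UNIV. \<Sum>c\<in>UNIV. (fourier_coeff F b c m n)\<^sup>2)"
    by (rule member_le_sum) (auto intro: sum_nonneg)
  finally show ?thesis unfolding amplitude_def by (metis real_sqrt_abs real_sqrt_le_iff)
qed

lemma amplitude_le_sum: "amplitude F m n \<le> (\<Sum>b\<in>UNIV. \<Sum>c\<in>UNIV. \<bar>fourier_coeff F b c m n\<bar>)"
proof -
  have "(\<Sum>b\<in>UNIV. \<Sum>c\<in>UNIV. (fourier_coeff F b c m n)\<^sup>2) \<le> (\<Sum>b\<in>UNIV. \<Sum>c\<in>UNIV. \<bar>fourier_coeff F b c m n\<bar>)\<^sup>2"
    (is "?S \<le> _")
  proof -
    have "x1\<^sup>2 + x2\<^sup>2 + (x3\<^sup>2 + x4\<^sup>2) \<le> (\<bar>x1\<bar> + \<bar>x2\<bar> + (\<bar>x3\<bar> + \<bar>x4\<bar>))\<^sup>2" for x1 x2 x3 x4 :: real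
    proof -
      have "0 \<le> 2 * (\<bar>x1\<bar> * \<bar>x2\<bar> + \<bar>x1\<bar> * \<bar>x3\<bar> + \<bar>x1\<bar> * \<bar>x4\<bar> + \<bar>x2\<bar> * \<bar>x3\<bar> + \<bar>x2\<bar> * \<bar>x4\<bar> + \<bar>x3\<bar> * \<bar>x4\<bar>)"
        by (intro mult_nonneg_nonneg add_nonneg_nonneg) auto
      also have "\<dots> = (\<bar>x1\<bar> + \<bar>x2\<bar> + (\<bar>x3\<bar> + \<bar>x4\<bar>))\<^sup>2 - (\<bar>x1\<bar>\<^sup>2 + \<bar>x2\<bar>\<^sup>2 + (\<bar>x3\<bar>\<^sup>2 + \<bar>x4\<bar>\<^sup>2))"
        by (simp add: power2_eq_square algebra_simps)
      finally show ?thesis by simp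
    qed
    then show ?thesis by (simp add: UNIV_bool)
  qed
  then have "sqrt ?S \<le> sqrt ((\<Sum>b\<in>UNIV. \<Sum>c\<in>UNIV. \<bar>fourier_coeff F b c m n\<bar>)\<^sup>2)"
    by (rule real_sqrt_le_mono)
  also have "\<dots> = (\<Sum>b\<in>UNIV. \<Sum>c\<in>UNIV. \<bar>fourier_coeff F b c m n\<bar>)"
    by (simp add: sum_nonneg)
  finally show ?thesis unfolding amplitude_def .
qed

lemma powr_sum_bool_le:
  fixes x :: "bool \<Rightarrow> bool \<Rightarrow> real"
  assumes "0 < p" "\<And>b c. 0 \<le> x b c"
  shows "(\<Sum>b\<in>UNIV. \<Sum>c\<in>UNIV. x b c) powr p \<le> 4 powr p * (\<Sum>b\<in>UNIV. \<Sum>c\<in>UNIV. x b c powr p)"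
proof -
  obtain b0 c0 where max: "\<And>b c. x b c \<le> x b0 c0"
  proof -
    have fin: "finite (range (case_prod x))" by simp
    then have "Max (range (case_prod x)) \<in> range (case_prod x)" by (rule Max_in) simp
    then obtain w where w: "Max (range (case_prod x)) = case_prod x w" by (rule imageE)
    have "case_prod x (b, c) \<le> case_prod x w" for b c
      unfolding w[symmetric] by (rule Max_ge[OF fin]) (rule rangeI)
    then have "x b c \<le> x (fst w) (snd w)" for b c by (simp add: case_prod_beta)
    then show ?thesis using that by blast
  qed
  have "(\<Sum>b\<in>UNIV. \<Sum>c\<in>UNIV. x b c) \<le> (\<Sum>b\<in>(UNIV::bool set). \<Sum>c\<in>(UNIV::bool set). x b0 c0)"
    by (intro sum_mono max)
  also have "\<dots> = 4 * x b0 c0" by (simp add: UNIV_bool)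
  finally have "(\<Sum>b\<in>UNIV. \<Sum>c\<in>UNIV. x b c) powr p \<le> (4 * x b0 c0) powr p"
    using assms by (intro powr_mono2 sum_nonneg) auto
  also have "\<dots> = 4 powr p * x b0 c0 powr p" using assms by (simp add: powr_mult)
  also have "x b0 c0 powr p \<le> (\<Sum>c\<in>UNIV. x b0 c powr p)"
    by (rule member_le_sum) auto
  also have "\<dots> \<le> (\<Sum>b\<in>UNIV. \<Sum>c\<in>UNIV. x b c powr p)"
    by (rule member_le_sum[of b0]) (auto intro: sum_nonneg)
  finally show ?thesis by simp
qed

lemma fst_snd_borel [measurable]:
  "fst \<in> borel_measurable (borel :: (real \<times> real) measure)"
  "snd \<in> borel_measurable (borel :: (real \<times> real) measure)"
  by (auto intro!: borel_measurable_continuous_onI continuous_intros)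

lemma integrable_times_trig:
  assumes "integrable torus F"
  shows "integrable torus (\<lambda>z. F z * (trig b m (fst z) * trig c n (snd z)))"
proof (rule Bochner_Integration.integrable_bound[OF assms])
  show "(\<lambda>z. F z * (trig b m (fst z) * trig c n (snd z))) \<in> borel_measurable torus"
    using borel_measurable_integrable[OF assms] by measurable
  show "AE z in torus. norm (F z * (trig b m (fst z) * trig c n (snd z))) \<le> norm (F z)"
    by (intro AE_I2) (simp add: abs_mult mult_left_le mult_le_one abs_trig_le)
qed

text \<open>The weak type \<open>(1,1)\<close> bound fails on the torus with weights \<open>(m n) powr -2\<close>, so the
  one-dimensional inequality is iterated: first in \<open>y\<close> for the partial coefficients
  \<open>\<integral> F(x, y) e\<^sub>m(x) dx\<close>, then in \<open>x\<close> for almost every \<open>y\<close>.\<close>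

lemma paley_torus_coeff:
  assumes p: "1 < p" "p \<le> 2"
  shows "\<exists>C>0. \<forall>F. integrable torus F \<longrightarrow>
    (coeff_power_sum p F b c)
      \<le> ennreal C * (moment p F)"
proof -
  obtain C1 where C1: "0 < C1" and P1: "\<forall>g::real \<Rightarrow> real. integrable circle g \<longrightarrow>
    (\<Sum>\<^sup>+m. ennreal (real m powr (p - 2) * \<bar>LINT x|circle. g x * trig b m x\<bar> powr p))
      \<le> ennreal C1 * (\<integral>\<^sup>+x. ennreal (\<bar>g x\<bar> powr p) \<partial>circle)"
    using paley_circle[OF p] by blast
  obtain C2 where C2: "0 < C2" and P2: "\<forall>g::real \<Rightarrow> real. integrable circle g \<longrightarrow>
    (\<Sum>\<^sup>+m. ennreal (real m powr (p - 2) * \<bar>LINT x|circle. g x * trig c m x\<bar> powr p))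
      \<le> ennreal C2 * (\<integral>\<^sup>+x. ennreal (\<bar>g x\<bar> powr p) \<partial>circle)"
    using paley_circle[OF p] by blast
  show ?thesis
  proof (intro exI[of _ "C2 * C1"] conjI allI impI)
    show "0 < C2 * C1" using C1 C2 by simp
    fix F :: "real \<times> real \<Rightarrow> real" assume F: "integrable torus F"
    then have [measurable]: "F \<in> borel_measurable borel"
      using borel_measurable_integrable[OF F] by simp
    then have [measurable]: "F \<in> borel_measurable (borel \<Otimes>\<^sub>M borel)" by (simp add: borel_prod)
    define G where "G m y = (LINT x|circle. F (x, y) * trig b m x)" for m y
    have intF: "integrable (circle \<Otimes>\<^sub>M circle) (\<lambda>(x, y). F (x, y) * trig b m x)" for m
      using integrable_times_trig[OF F, of b m False 0] by (simp add: torus_def trig_False_0 case_prod_unfold)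
    have intG: "integrable circle (G m)" for m
      unfolding G_def using circle_pair.integrable_snd[OF intF] by simp
    have coeff: "fourier_coeff F b c m n = (LINT y|circle. G m y * trig c n y)" for m n
    proof -
      have "integrable (circle \<Otimes>\<^sub>M circle) (\<lambda>(x, y). F (x, y) * (trig b m x * trig c n y))"
        using integrable_times_trig[OF F, of b m c n] by (simp add: torus_def case_prod_unfold)
      from circle_pair.integral_snd[OF this]
      have "fourier_coeff F b c m n = (LINT y|circle. LINT x|circle. F (x, y) * (trig b m x * trig c n y))"
        by (simp add: fourier_coeff_def torus_def case_prod_unfold)
      also have "\<dots> = (LINT y|circle. G m y * trig c n y)"
        unfolding G_def by (simp add: mult.assoc[symmetric])
      finally show ?thesis .
    qed
    have [measurable]: "G m \<in> borel_measurable borel" for m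
      using borel_measurable_integrable[OF intG] by simp
    have sections: "AE y in circle. integrable circle (\<lambda>x. F (x, y))"
      using circle_pair.AE_integrable_snd[of "\<lambda>x y. F (x, y)"] F by (simp add: torus_def)
    have "(coeff_power_sum p F b c)
      = (\<Sum>\<^sup>+m. ennreal (real m powr (p - 2)) * (\<Sum>\<^sup>+n. ennreal (real n powr (p - 2) * \<bar>LINT y|circle. G m y * trig c n y\<bar> powr p)))"
      unfolding coeff by (simp add: nn_integral_cmult[symmetric] ennreal_mult[symmetric] mult.assoc)
    also have "\<dots> \<le> (\<Sum>\<^sup>+m. ennreal (real m powr (p - 2)) * (ennreal C2 * (\<integral>\<^sup>+y. ennreal (\<bar>G m y\<bar> powr p) \<partial>circle)))"
      by (intro nn_integral_mono mult_left_mono P2[rule_format] intG) simp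
    also have "\<dots> = ennreal C2 * (\<Sum>\<^sup>+m. (\<integral>\<^sup>+y. ennreal (real m powr (p - 2) * \<bar>G m y\<bar> powr p) \<partial>circle))"
      by (simp add: nn_integral_cmult[symmetric] ennreal_mult[symmetric] mult.left_commute[of _ "ennreal C2"])
    also have "(\<Sum>\<^sup>+m. (\<integral>\<^sup>+y. ennreal (real m powr (p - 2) * \<bar>G m y\<bar> powr p) \<partial>circle))
      = (\<integral>\<^sup>+y. (\<Sum>\<^sup>+m. ennreal (real m powr (p - 2) * \<bar>G m y\<bar> powr p)) \<partial>circle)"
      by (rule nn_integral_count_space_nn_integral[symmetric]) auto
    finally have 1: "(coeff_power_sum p F b c)
      \<le> ennreal C2 * (\<integral>\<^sup>+y. (\<Sum>\<^sup>+m. ennreal (real m powr (p - 2) * \<bar>G m y\<bar> powr p)) \<partial>circle)" .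
    have "(\<integral>\<^sup>+y. (\<Sum>\<^sup>+m. ennreal (real m powr (p - 2) * \<bar>G m y\<bar> powr p)) \<partial>circle)
      \<le> (\<integral>\<^sup>+y. ennreal C1 * (\<integral>\<^sup>+x. ennreal (\<bar>F (x, y)\<bar> powr p) \<partial>circle) \<partial>circle)"
    proof (rule nn_integral_mono_AE)
      show "AE y in circle. (\<Sum>\<^sup>+m. ennreal (real m powr (p - 2) * \<bar>G m y\<bar> powr p))
        \<le> ennreal C1 * (\<integral>\<^sup>+x. ennreal (\<bar>F (x, y)\<bar> powr p) \<partial>circle)"
        using sections unfolding G_def by eventually_elim (rule P1[rule_format])
    qed
    also have "\<dots> = ennreal C1 * (moment p F)"
      by (subst nn_integral_cmult) (auto simp: nn_integral_torus)
    finally show "(coeff_power_sum p F b c)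
      \<le> ennreal (C2 * C1) * (moment p F)"
      using C1 C2 by (intro order_trans[OF 1]) (simp add: ennreal_mult mult.assoc mult_left_mono)
  qed
qed

lemma nn_integral_cmult_count_space:
  "(\<integral>\<^sup>+x. c * f x \<partial>count_space A) = c * (\<integral>\<^sup>+x. f x \<partial>count_space A)"
  by (rule nn_integral_cmult) simp

lemma nn_integral_sum_bool:
  fixes x :: "bool \<Rightarrow> bool \<Rightarrow> nat \<Rightarrow> nat \<Rightarrow> ennreal"
  shows "(\<integral>\<^sup>+m. \<integral>\<^sup>+n. (\<Sum>b\<in>UNIV. \<Sum>c\<in>UNIV. x b c m n) \<partial>count_space A \<partial>count_space B)
    = (\<Sum>b\<in>UNIV. \<Sum>c\<in>UNIV. \<integral>\<^sup>+m. \<integral>\<^sup>+n. x b c m n \<partial>count_space A \<partial>count_space B)"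
  by (simp add: UNIV_bool nn_integral_add)

lemma paley_torus:
  assumes p: "1 < p" "p \<le> 2"
  shows "\<exists>C>0. \<forall>F. integrable torus F \<longrightarrow>
    (amplitude_sum p F)
      \<le> ennreal C * (moment p F)"
proof -
  define Q where "Q b c C \<longleftrightarrow> (\<forall>F. integrable torus F \<longrightarrow>
    (coeff_power_sum p F b c)
      \<le> ennreal C * (moment p F))" for b c C
  have "\<forall>b c. \<exists>C>0. Q b c C" unfolding Q_def by (intro allI paley_torus_coeff p)
  then obtain C where C: "\<And>b c. 0 < C b c" and "\<And>b c. Q b c (C b c)" by metis
  then have P: "\<And>b c F. integrable torus F \<Longrightarrow>
    (coeff_power_sum p F b c)
      \<le> ennreal (C b c) * (moment p F)"
    unfolding Q_def by blast
  define D where "D = 4 powr p * (\<Sum>b\<in>UNIV. \<Sum>c\<in>UNIV. C b c)"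
  have D: "0 < D" unfolding D_def using C by (simp add: UNIV_bool add_pos_pos)
  have "(amplitude_sum p F)
      \<le> ennreal D * (moment p F)" if F: "integrable torus F" for F
  proof -
    have "amplitude F m n powr p \<le> 4 powr p * (\<Sum>b\<in>UNIV. \<Sum>c\<in>UNIV. \<bar>fourier_coeff F b c m n\<bar> powr p)" for m n
      using powr_mono2[OF _ amplitude_nonneg amplitude_le_sum, of p F m n] p
        powr_sum_bool_le[of p "\<lambda>b c. \<bar>fourier_coeff F b c m n\<bar>"] by auto
    then have "real m powr (p - 2) * real n powr (p - 2) * amplitude F m n powr p
      \<le> real m powr (p - 2) * real n powr (p - 2) * (4 powr p * (\<Sum>b\<in>UNIV. \<Sum>c\<in>UNIV. \<bar>fourier_coeff F b c m n\<bar> powr p))" for m n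
      by (intro mult_left_mono) auto
    then have "ennreal (real m powr (p - 2) * real n powr (p - 2) * amplitude F m n powr p)
      \<le> ennreal (4 powr p) * (\<Sum>b\<in>UNIV. \<Sum>c\<in>UNIV. ennreal (real m powr (p - 2) * real n powr (p - 2) * \<bar>fourier_coeff F b c m n\<bar> powr p))" for m n
      by (simp add: sum_nonneg ennreal_mult[symmetric] sum_distrib_left mult_ac ennreal_leI)
    then have "(amplitude_sum p F)
      \<le> (\<Sum>\<^sup>+m. \<Sum>\<^sup>+n. ennreal (4 powr p) * (\<Sum>b\<in>UNIV. \<Sum>c\<in>UNIV. ennreal (real m powr (p - 2) * real n powr (p - 2) * \<bar>fourier_coeff F b c m n\<bar> powr p)))"
      by (intro nn_integral_mono)
    also have "\<dots> = ennreal (4 powr p) * (\<Sum>b\<in>UNIV. \<Sum>c\<in>UNIV. coeff_power_sum p F b c)"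
      by (simp only: nn_integral_cmult_count_space nn_integral_sum_bool)
    also have "\<dots> \<le> ennreal (4 powr p) * (\<Sum>b\<in>UNIV. \<Sum>c\<in>UNIV. ennreal (C b c) * (moment p F))"
      by (intro mult_left_mono sum_mono P F) simp
    also have "\<dots> = ennreal D * (moment p F)"
    proof -
      have "(\<Sum>b\<in>UNIV. \<Sum>c\<in>UNIV. ennreal (C b c)) = ennreal (\<Sum>b\<in>UNIV. \<Sum>c\<in>UNIV. C b c)"
        using C by (simp add: less_imp_le sum_nonneg)
      then show ?thesis using C
        by (simp add: D_def ennreal_mult sum_distrib_right[symmetric] mult.assoc sum_nonneg less_imp_le)
    qed
    finally show ?thesis .
  qed
  then show ?thesis using D by blast
qed

section \<open>Density of trigonometric polynomials\<close>

text \<open>The real trigonometric polynomials in two variables, as the sums of monomials.\<close>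

inductive_set trig_polys :: "(real \<times> real \<Rightarrow> real) set" where
  monomial: "(\<lambda>(x, y). a * trig b m x * trig c n y) \<in> trig_polys"
| add: "S \<in> trig_polys \<Longrightarrow> T \<in> trig_polys \<Longrightarrow> (\<lambda>z. S z + T z) \<in> trig_polys"

lemma trig_times_trig:
  "\<exists>a1 a2 b' m1 m2. \<forall>x. trig b m x * trig c n x = a1 * trig b' m1 x + a2 * trig b' m2 x"
proof -
  define d where "d = nat \<bar>int m - int n\<bar>"
  define \<sigma> :: real where "\<sigma> = (if n \<le> m then 1 else -1)"
  have D: "real m * x - real n * x = \<sigma> * (real d * x)" for x
    by (auto simp: d_def \<sigma>_def algebra_simps of_nat_diff nat_diff_distrib)
  have S: "real m * x + real n * x = real (m + n) * x" for x by (simp add: algebra_simps)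
  have cD: "cos (\<sigma> * u) = cos u" and sD: "sin (\<sigma> * u) = \<sigma> * sin u" for u
    by (auto simp: \<sigma>_def)
  consider "\<not> b" "\<not> c" | "b" "c" | "b" "\<not> c" | "\<not> b" "c" by blast
  then show ?thesis
  proof cases
    case 1
    have "\<forall>x. trig b m x * trig c n x = 1/2 * trig False d x + 1/2 * trig False (m + n) x"
      using 1 by (simp only: trig_def cos_times_cos D S cD if_False) (simp add: field_simps)
    then show ?thesis by blast
  next
    case 2
    have "\<forall>x. trig b m x * trig c n x = 1/2 * trig False d x + (-1/2) * trig False (m + n) x"
      using 2 by (simp only: trig_def sin_times_sin D S cD if_False if_True) (simp add: field_simps)
    then show ?thesis by blast
  next
    case 3
    have "\<forall>x. trig b m x * trig c n x = \<sigma>/2 * trig True d x + 1/2 * trig True (m + n) x"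
      using 3 by (simp only: trig_def sin_times_cos D S sD if_False if_True) (simp add: field_simps)
    then show ?thesis by blast
  next
    case 4
    have "\<forall>x. trig b m x * trig c n x = (-\<sigma>/2) * trig True d x + 1/2 * trig True (m + n) x"
      using 4 by (simp only: trig_def cos_times_sin D S sD if_False if_True) (simp add: field_simps)
    then show ?thesis by blast
  qed
qed

lemma trig_polys_mult:
  assumes "S \<in> trig_polys" "T \<in> trig_polys"
  shows "(\<lambda>z. S z * T z) \<in> trig_polys"
  using assms(1)
proof (induction S)
  case (monomial a b m c n)
  show ?case using assms(2)
  proof (induction T)
    case (monomial a' b' m' c' n')
    obtain p1 p2 e1 k1 k2 where X: "\<And>x. trig b m x * trig b' m' x = p1 * trig e1 k1 x + p2 * trig e1 k2 x"
      using trig_times_trig[of b m b' m'] by blast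
    obtain q1 q2 e2 l1 l2 where Y: "\<And>y. trig c n y * trig c' n' y = q1 * trig e2 l1 y + q2 * trig e2 l2 y"
      using trig_times_trig[of c n c' n'] by blast
    have "(\<lambda>z. (case z of (x, y) \<Rightarrow> a * trig b m x * trig c n y) * (case z of (x, y) \<Rightarrow> a' * trig b' m' x * trig c' n' y))
      = (\<lambda>z. ((case z of (x, y) \<Rightarrow> (a * a' * p1 * q1) * trig e1 k1 x * trig e2 l1 y)
          + (case z of (x, y) \<Rightarrow> (a * a' * p1 * q2) * trig e1 k1 x * trig e2 l2 y))
          + ((case z of (x, y) \<Rightarrow> (a * a' * p2 * q1) * trig e1 k2 x * trig e2 l1 y)
          + (case z of (x, y) \<Rightarrow> (a * a' * p2 * q2) * trig e1 k2 x * trig e2 l2 y)))"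
    proof (rule ext, clarsimp)
      fix x y
      have "a * trig b m x * trig c n y * (a' * trig b' m' x * trig c' n' y)
        = a * a' * (trig b m x * trig b' m' x) * (trig c n y * trig c' n' y)" by simp
      then show "a * trig b m x * trig c n y * (a' * trig b' m' x * trig c' n' y)
        = a * a' * p1 * q1 * trig e1 k1 x * trig e2 l1 y + a * a' * p1 * q2 * trig e1 k1 x * trig e2 l2 y
         + (a * a' * p2 * q1 * trig e1 k2 x * trig e2 l1 y + a * a' * p2 * q2 * trig e1 k2 x * trig e2 l2 y)"
        unfolding X Y by (simp add: algebra_simps)
    qed
    then show ?case by (simp only:) (intro trig_polys.intros)
  next
    case (add S' T')
    then show ?case by (simp only: distrib_left) (rule trig_polys.add)
  qed
next
  case (add S' T')
  then show ?case by (simp only: distrib_right) (rule trig_polys.add)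
qed

text \<open>The parametrisation of the torus in \<open>\<complex> \<times> \<complex>\<close>. Real polynomials on \<open>\<complex> \<times> \<complex>\<close> become trigonometric
  polynomials under it.\<close>

definition torus_map :: "real \<times> real \<Rightarrow> complex \<times> complex" where
  "torus_map = (\<lambda>(x, y). (cis x, cis y))"

lemma polynomial_on_torus_trig_poly:
  assumes "real_polynomial_function q"
  shows "(\<lambda>z. q (torus_map z)) \<in> trig_polys"
  using assms
proof (induction q rule: real_polynomial_function.induct)
  case (linear f)
  interpret bounded_linear f by fact
  have "f (cis x, cis y) = f (1, 0) * trig False 1 x * trig False 0 y + f (\<i>, 0) * trig True 1 x * trig False 0 y
      + (f (0, 1) * trig False 0 x * trig False 1 y + f (0, \<i>) * trig False 0 x * trig True 1 y)" for x y
  proof -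
    have "(cis x, cis y) = (cos x *\<^sub>R (1, 0) + sin x *\<^sub>R (\<i>, 0)) + (cos y *\<^sub>R (0, 1) + sin y *\<^sub>R (0, \<i>))"
      by (simp add: complex_eq_iff)
    then have "f (cis x, cis y) = f ((cos x *\<^sub>R (1, 0) + sin x *\<^sub>R (\<i>, 0)) + (cos y *\<^sub>R (0, 1) + sin y *\<^sub>R (0, \<i>)))"
      by (simp only:)
    also have "\<dots> = cos x * f (1, 0) + sin x * f (\<i>, 0) + (cos y * f (0, 1) + sin y * f (0, \<i>))"
      by (simp only: add scaleR real_scaleR_def)
    finally show ?thesis by (simp add: trig_def mult.commute)
  qed
  then have "(\<lambda>z. f (torus_map z)) = (\<lambda>z. ((case z of (x, y) \<Rightarrow> f (1, 0) * trig False 1 x * trig False 0 y)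
      + (case z of (x, y) \<Rightarrow> f (\<i>, 0) * trig True 1 x * trig False 0 y))
      + ((case z of (x, y) \<Rightarrow> f (0, 1) * trig False 0 x * trig False 1 y)
      + (case z of (x, y) \<Rightarrow> f (0, \<i>) * trig False 0 x * trig True 1 y)))"
    by (auto simp: torus_map_def fun_eq_iff)
  then show ?case by (simp only:) (intro trig_polys.intros)
next
  case (const c)
  have "(\<lambda>z. c) = (\<lambda>(x, y). c * trig False 0 x * trig False 0 y)" by (auto simp: trig_def)
  then show ?case by (metis (no_types) trig_polys.monomial)
next
  case (add f g)
  then show ?case by (intro trig_polys.add)
next
  case (mult f g)
  then show ?case by (intro trig_polys_mult)
qed

text \<open>A continuous \<open>g\<close> that is not periodic can still be approximated away from the boundary of the period
  square: there \<open>torus_map\<close> is injective, so \<open>g\<close> is a continuous function on a compact subset of the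
  torus, which Tietze's theorem extends with the same bound.\<close>

lemma trig_poly_approximation_inside:
  fixes g :: "real \<times> real \<Rightarrow> real"
  assumes g: "continuous_on UNIV g" and bound: "\<And>z. \<bar>g z\<bar> \<le> K" and \<epsilon>: "0 < \<epsilon>"
  shows "\<exists>T\<in>trig_polys. (\<forall>z\<in>{\<epsilon>..2*pi-\<epsilon>} \<times> {\<epsilon>..2*pi-\<epsilon>}. \<bar>T z - g z\<bar> < \<epsilon>) \<and> (\<forall>z. \<bar>T z\<bar> \<le> K + \<epsilon>)"
proof -
  define Q where "Q = {\<epsilon>..2*pi-\<epsilon>} \<times> {\<epsilon>..2*pi-\<epsilon>}"
  have Q: "compact Q" unfolding Q_def by (intro compact_Times compact_Icc)
  have cont: "continuous_on S torus_map" for S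
    unfolding torus_map_def case_prod_beta by (intro continuous_intros)
  \<comment> \<open>Distinct points of an interval shorter than \<open>2\<pi>\<close> have distinct images on the circle.\<close>
  have cis_eq: "x = y" if "cis x = cis y" "x \<in> {\<epsilon>..2*pi-\<epsilon>}" "y \<in> {\<epsilon>..2*pi-\<epsilon>}" for x y
  proof -
    have "sin x = sin y \<and> cos x = cos y" using that(1) by (simp add: complex_eq_iff)
    then obtain n where n: "x = y + 2 * pi * of_int n" using sin_cos_eq_iff[of x y] by (auto simp: mult_ac)
    then have "\<bar>2 * pi * of_int n\<bar> < 2 * pi" using that \<epsilon> by auto
    then have "n = 0" by (simp add: abs_mult)
    then show ?thesis using n by simp
  qed
  have inj: "inj_on torus_map Q"
    unfolding Q_def torus_map_def by (rule inj_onI) (auto intro: cis_eq)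
  define G where "G = g \<circ> the_inv_into Q torus_map"
  have "continuous_on (torus_map ` Q) (the_inv_into Q torus_map)"
    by (rule continuous_on_inv_into[OF cont Q inj])
  then have G: "continuous_on (torus_map ` Q) G"
    unfolding G_def by (rule continuous_on_compose) (rule continuous_on_subset[OF g], simp)
  have K: "0 \<le> K" using bound[of "(0, 0)"] by simp
  have cl: "closedin (top_of_set UNIV) (torus_map ` Q)"
    by (simp add: compact_imp_closed compact_continuous_image[OF cont Q])
  obtain F where F: "continuous_on UNIV F" "\<And>w. w \<in> torus_map ` Q \<Longrightarrow> F w = G w" "\<And>w. norm (F w) \<le> K"
    by (rule Tietze[OF G cl K]) (use bound in \<open>auto simp: G_def\<close>)
  have comp: "compact (sphere 0 1 \<times> sphere 0 1 :: (complex \<times> complex) set)"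
    by (intro compact_Times compact_sphere)
  obtain q where q: "real_polynomial_function q"
    "\<And>w. w \<in> sphere 0 1 \<times> sphere 0 1 \<Longrightarrow> \<bar>F w - q w\<bar> < \<epsilon>"
    by (rule Stone_Weierstrass_real_polynomial_function[OF comp continuous_on_subset[OF F(1)] \<epsilon>]) auto
  have on: "torus_map z \<in> sphere 0 1 \<times> sphere 0 1" for z
    by (auto simp: torus_map_def split: prod.split)
  show ?thesis
  proof (rule bexI[OF _ polynomial_on_torus_trig_poly[OF q(1)]], intro conjI ballI allI)
    fix z assume "z \<in> {\<epsilon>..2*pi-\<epsilon>} \<times> {\<epsilon>..2*pi-\<epsilon>}"
    then have z: "z \<in> Q" by (simp add: Q_def)
    then have "F (torus_map z) = g z" using F(2) by (simp add: G_def the_inv_into_f_f[OF inj])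
    then show "\<bar>q (torus_map z) - g z\<bar> < \<epsilon>" using q(2)[OF on[of z]] by simp
  next
    fix z
    show "\<bar>q (torus_map z)\<bar> \<le> K + \<epsilon>" using q(2)[OF on[of z]] F(3)[of "torus_map z"] by simp
  qed
qed

lemma AE_torus_interior: "AE z in torus. 0 < fst z \<and> fst z < 2 * pi \<and> 0 < snd z \<and> snd z < 2 * pi"
proof -
  have "AE x in lborel. x \<noteq> 0 \<and> x \<noteq> 2 * pi"
    using AE_lborel_singleton[of 0] AE_lborel_singleton[of "2 * pi"] by eventually_elim simp
  then have "AE x in lborel. 0 < (indicator {0..2*pi} x :: ennreal) \<longrightarrow> 0 < x \<and> x < 2 * pi"
    by eventually_elim (auto simp: indicator_def)
  then have *: "AE x in circle. 0 < x \<and> x < 2 * pi"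
    unfolding circle_def by (subst AE_density) auto
  have "AE x in circle. AE y in circle. 0 < fst (x, y) \<and> fst (x, y) < 2 * pi \<and> 0 < snd (x, y) \<and> snd (x, y) < 2 * pi"
    using *
  proof eventually_elim
    case (elim x)
    show ?case using * by eventually_elim (use elim in auto)
  qed
  then show ?thesis unfolding torus_def
  proof (rule circle_pair.AE_pair_measure[rotated])
    show "{z \<in> space (circle \<Otimes>\<^sub>M circle). 0 < fst z \<and> fst z < 2 * pi \<and> 0 < snd z \<and> snd z < 2 * pi}
      \<in> sets (circle \<Otimes>\<^sub>M circle)" by measurable
  qed
qed

text \<open>Continuous functions converging almost everywhere to \<open>\<psi>\<close> are cut off at \<open>\<plusminus>K\<close> and approximated on
  squares that exhaust the period square.\<close>

lemma trig_polys_dense: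
  fixes \<psi> :: "real \<times> real \<Rightarrow> real"
  assumes [measurable]: "\<psi> \<in> borel_measurable borel" and bound: "\<And>z. \<bar>\<psi> z\<bar> \<le> K"
  shows "\<exists>T. (\<forall>k::nat. T k \<in> trig_polys) \<and> (\<forall>k z. \<bar>T k z\<bar> \<le> K + 1)
     \<and> (AE z in torus. (\<lambda>k. T k z) \<longlonglongrightarrow> \<psi> z)"
proof -
  have K: "0 \<le> K" using bound[of "(0, 0)"] by simp
  have "\<psi> measurable_on UNIV"
    by (intro lebesgue_measurable_imp_measurable_on measurable_completion) auto
  then obtain N g where N: "negligible N" and g: "\<And>n. continuous_on UNIV (g n)"
    and lim: "\<And>z. z \<notin> N \<Longrightarrow> (\<lambda>n. g n z) \<longlonglongrightarrow> \<psi> z"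
    unfolding measurable_on_def by auto
  define h where "h n z = max (- K) (min K (g n z))" for n z
  have h: "continuous_on UNIV (h n)" "\<bar>h n z\<bar> \<le> K" for n z
    unfolding h_def using K by (auto intro!: continuous_intros g)
  have limh: "(\<lambda>n. h n z) \<longlonglongrightarrow> \<psi> z" if "z \<notin> N" for z
  proof -
    have "(\<lambda>n. h n z) \<longlonglongrightarrow> max (- K) (min K (\<psi> z))"
      unfolding h_def by (intro tendsto_intros lim that)
    also have "max (- K) (min K (\<psi> z)) = \<psi> z" using bound[of z] by auto
    finally show ?thesis .
  qed
  define \<epsilon> where "\<epsilon> n = inverse (real (Suc n))" for n
  have \<epsilon>: "0 < \<epsilon> n" "\<epsilon> n \<le> 1" for n by (auto simp: \<epsilon>_def field_simps)
  have \<epsilon>0: "\<epsilon> \<longlonglongrightarrow> 0" unfolding \<epsilon>_def by (rule LIMSEQ_inverse_real_of_nat)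
  obtain T where T: "\<And>n. T n \<in> trig_polys"
    "\<And>n z. z \<in> {\<epsilon> n..2*pi-\<epsilon> n} \<times> {\<epsilon> n..2*pi-\<epsilon> n} \<Longrightarrow> \<bar>T n z - h n z\<bar> < \<epsilon> n"
    "\<And>n z. \<bar>T n z\<bar> \<le> K + \<epsilon> n"
  proof -
    have "\<forall>n. \<exists>T\<in>trig_polys. (\<forall>z\<in>{\<epsilon> n..2*pi-\<epsilon> n} \<times> {\<epsilon> n..2*pi-\<epsilon> n}. \<bar>T z - h n z\<bar> < \<epsilon> n)
        \<and> (\<forall>z. \<bar>T z\<bar> \<le> K + \<epsilon> n)"
      by (intro allI trig_poly_approximation_inside h \<epsilon>(1))
    then obtain T where "\<forall>n. T n \<in> trig_polys \<and> (\<forall>z\<in>{\<epsilon> n..2*pi-\<epsilon> n} \<times> {\<epsilon> n..2*pi-\<epsilon> n}. \<bar>T n z - h n z\<bar> < \<epsilon> n)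
        \<and> (\<forall>z. \<bar>T n z\<bar> \<le> K + \<epsilon> n)"
      unfolding Bex_def choice_iff by blast
    then show ?thesis by (intro that[of T]) auto
  qed
  have "AE z in torus. z \<notin> N"
  proof -
    have "AE z in lebesgue. z \<notin> N" using N by (simp add: negligible_iff_null_sets AE_not_in)
    then have "AE z in lborel. z \<notin> N" by (simp add: AE_completion_iff)
    then show ?thesis unfolding torus_eq_density by (subst AE_density) (auto elim: eventually_mono)
  qed
  with AE_torus_interior have conv: "AE z in torus. (\<lambda>k. T k z) \<longlonglongrightarrow> \<psi> z"
  proof eventually_elim
    case (elim z)
    define d where "d = min (min (fst z) (2 * pi - fst z)) (min (snd z) (2 * pi - snd z))"
    have "0 < d" using elim by (auto simp: d_def)
    then have "eventually (\<lambda>n. \<epsilon> n < d) sequentially" using \<epsilon>0 by (auto dest: order_tendstoD)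
    then have "eventually (\<lambda>n. norm (T n z - h n z) \<le> \<epsilon> n) sequentially"
    proof eventually_elim
      case (elim n)
      then have "z \<in> {\<epsilon> n..2*pi-\<epsilon> n} \<times> {\<epsilon> n..2*pi-\<epsilon> n}" by (cases z) (auto simp: d_def)
      from T(2)[OF this] show ?case by simp
    qed
    then have "(\<lambda>n. T n z - h n z) \<longlonglongrightarrow> 0" by (rule Lim_null_comparison) (rule \<epsilon>0)
    from tendsto_add[OF this limh[of z]] elim show ?case by simp
  qed
  have "\<bar>T k z\<bar> \<le> K + 1" for k z using T(3)[where n=k and z=z] \<epsilon>(2)[of k] by linarith
  then show ?thesis by (intro exI[of _ T] conjI allI T(1) conv)
qed

section \<open>The dual of Paley's inequality\<close>

lemma fourier_coeff_monomial:
  "fourier_coeff (\<lambda>(x, y). a * trig b m x * trig c n y) b' c' m' n'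
    = a * (if b = b' \<and> m = m' \<and> \<not> (b \<and> m = 0) then trig_norm m else 0)
        * (if c = c' \<and> n = n' \<and> \<not> (c \<and> n = 0) then trig_norm n else 0)"
proof -
  have "integrable torus (\<lambda>z. (case z of (x, y) \<Rightarrow> a * trig b m x * trig c n y))"
  proof (rule torus.integrable_const_bound[where B="\<bar>a\<bar>"])
    show "(\<lambda>z. (case z of (x, y) \<Rightarrow> a * trig b m x * trig c n y)) \<in> borel_measurable torus"
      unfolding torus_def by measurable
    show "AE z in torus. norm (case z of (x, y) \<Rightarrow> a * trig b m x * trig c n y) \<le> \<bar>a\<bar>"
      by (intro AE_I2) (auto simp: abs_mult mult.assoc intro!: mult_left_le mult_le_one abs_trig_le)
  qed
  from integrable_times_trig[OF this, of b' m' c' n']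
  have "integrable (circle \<Otimes>\<^sub>M circle) (\<lambda>(x, y). (a * trig b m x * trig c n y) * (trig b' m' x * trig c' n' y))"
    by (simp add: torus_def case_prod_unfold)
  from circle_pair.integral_snd[OF this]
  have "fourier_coeff (\<lambda>(x, y). a * trig b m x * trig c n y) b' c' m' n'
    = (LINT y|circle. LINT x|circle. (a * trig b m x * trig c n y) * (trig b' m' x * trig c' n' y))"
    by (simp add: fourier_coeff_def torus_def case_prod_unfold)
  also have "\<dots> = (LINT y|circle. LINT x|circle. (a * (trig c n y * trig c' n' y)) * (trig b m x * trig b' m' x))"
    by (simp add: mult_ac)
  also have "\<dots> = (a * (LINT y|circle. trig c n y * trig c' n' y)) * (LINT x|circle. trig b m x * trig b' m' x)"
    by (simp only: Bochner_Integration.integral_mult_right_zero Bochner_Integration.integral_mult_left_zero)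
  also have "\<dots> = a * (LINT x|circle. trig b m x * trig b' m' x) * (LINT y|circle. trig c n y * trig c' n' y)"
    by (simp only: mult_ac)
  finally show ?thesis unfolding trig_orthogonal .
qed

lemma trig_polys_bounded:
  assumes "T \<in> trig_polys"
  shows "T \<in> borel_measurable borel \<and> (\<exists>K. \<forall>z. \<bar>T z\<bar> \<le> K)"
  using assms
proof induction
  case (monomial a b m c n)
  have "\<bar>case z of (x, y) \<Rightarrow> a * trig b m x * trig c n y\<bar> \<le> \<bar>a\<bar>" for z
    by (cases z) (auto simp: abs_mult mult.assoc intro!: mult_left_le mult_le_one abs_trig_le)
  moreover have "(\<lambda>(x, y). a * trig b m x * trig c n y) \<in> borel_measurable (borel \<Otimes>\<^sub>M borel)" by measurable
  ultimately show ?case by (auto simp: borel_prod)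
next
  case (add S T)
  then obtain K L where "\<And>z. \<bar>S z\<bar> \<le> K" "\<And>z. \<bar>T z\<bar> \<le> L" by blast
  then have "\<bar>S z + T z\<bar> \<le> K + L" for z by (meson abs_triangle_ineq add_mono order_trans)
  then show ?case using add by auto
qed

lemma integrable_times_bounded:
  fixes F T :: "real \<times> real \<Rightarrow> real"
  assumes "integrable torus F" "T \<in> borel_measurable borel" "\<And>z. \<bar>T z\<bar> \<le> K"
  shows "integrable torus (\<lambda>z. F z * T z)"
proof (rule Bochner_Integration.integrable_bound)
  show "integrable torus (\<lambda>z. K * F z)" using assms by simp
  have [measurable]: "T \<in> borel_measurable torus" using assms by simp
  show "(\<lambda>z. F z * T z) \<in> borel_measurable torus" 
    using borel_measurable_integrable[OF assms(1)] by measurable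
  have "\<bar>F z\<bar> * \<bar>T z\<bar> \<le> \<bar>F z\<bar> * \<bar>K\<bar>" for z
    using assms(3)[of z] by (intro mult_left_mono) auto
  then show "AE z in torus. norm (F z * T z) \<le> norm (K * F z)"
    by (intro AE_I2) (simp add: abs_mult mult.commute)
qed

lemma trig_norm_pos: "0 < trig_norm m"
  by (simp add: trig_norm_def)

text \<open>The sum over frequencies at most \<open>M\<close> in Parseval's formula for \<open>\<integral> F T\<close>.\<close>

definition parseval_sum :: "nat \<Rightarrow> (real \<times> real \<Rightarrow> real) \<Rightarrow> (real \<times> real \<Rightarrow> real) \<Rightarrow> real" where
  "parseval_sum M F T = (\<Sum>b\<in>UNIV. \<Sum>c\<in>UNIV. \<Sum>m\<le>M. \<Sum>n\<le>M.
     fourier_coeff F b c m n * fourier_coeff T b c m n / (trig_norm m * trig_norm n))"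

lemma trig_poly_parseval:
  assumes "T \<in> trig_polys"
  shows "\<exists>N. \<forall>M\<ge>N. \<forall>F. integrable torus F \<longrightarrow> (LINT z|torus. F z * T z) = parseval_sum M F T"
  using assms
proof induction
  case (monomial a b m c n)
  show ?case
  proof (intro exI[of _ "max m n"] allI impI)
    fix M :: nat and F :: "real \<times> real \<Rightarrow> real" assume M: "max m n \<le> M" and F: "integrable torus F"
    let ?T = "\<lambda>(x, y). a * trig b m x * trig c n y"
    have "(\<Sum>b'\<in>UNIV. \<Sum>c'\<in>UNIV. \<Sum>m'\<le>M. \<Sum>n'\<le>M. fourier_coeff F b' c' m' n' * fourier_coeff ?T b' c' m' n' / (trig_norm m' * trig_norm n'))
      = (\<Sum>b'\<in>UNIV. \<Sum>c'\<in>UNIV. \<Sum>m'\<le>M. \<Sum>n'\<le>M. if b' = b then if c' = c then if m' = m then if n' = n then a * fourier_coeff F b c m n else 0 else 0 else 0 else 0)"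
    proof (intro sum.cong refl)
      fix b' c' m' n'
      have "fourier_coeff F b c m n = 0" if "b \<and> m = 0 \<or> c \<and> n = 0"
        using that by (auto simp: fourier_coeff_def trig_def)
      then show "fourier_coeff F b' c' m' n' * fourier_coeff ?T b' c' m' n' / (trig_norm m' * trig_norm n')
        = (if b' = b then if c' = c then if m' = m then if n' = n then a * fourier_coeff F b c m n else 0 else 0 else 0 else 0)"
        unfolding fourier_coeff_monomial using trig_norm_pos[of m] trig_norm_pos[of n] by (auto simp: field_simps)
    qed
    also have "\<dots> = a * fourier_coeff F b c m n"
    proof -
      have "(\<Sum>n'\<le>M. if b' = b then if c' = c then if m' = m then if n' = n then g else 0 else 0 else 0 else 0)
        = (if b' = b then if c' = c then if m' = m then g else 0 else 0 else (0::real))" for b' c' m' g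
        using M by (simp add: sum.delta)
      moreover have "(\<Sum>m'\<le>M. if b' = b then if c' = c then if m' = m then g else 0 else 0 else 0)
        = (if b' = b then if c' = c then g else 0 else (0::real))" for b' c' g
        using M by (simp add: sum.delta)
      moreover have "(\<Sum>c'\<in>UNIV. if b' = b then if c' = c then g else 0 else 0)
        = (if b' = b then g else (0::real))" for b' g
        by (simp add: sum.delta)
      ultimately show ?thesis by (simp add: sum.delta)
    qed
    also have "\<dots> = (LINT z|torus. F z * ?T z)"
      unfolding fourier_coeff_def by (simp add: case_prod_unfold mult_ac flip: Bochner_Integration.integral_mult_right_zero)
    finally show "(LINT z|torus. F z * ?T z) = parseval_sum M F ?T"
      unfolding parseval_sum_def by (rule sym)
  qed
next
  case (add S T)
  obtain N1 where 1: "\<forall>M\<ge>N1. \<forall>F. integrable torus F \<longrightarrow> (LINT z|torus. F z * S z) = parseval_sum M F S"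
    using add.IH(1) by (rule exE)
  obtain N2 where 2: "\<forall>M\<ge>N2. \<forall>F. integrable torus F \<longrightarrow> (LINT z|torus. F z * T z) = parseval_sum M F T"
    using add.IH(2) by (rule exE)
  obtain K L where S: "S \<in> borel_measurable borel" "\<And>z. \<bar>S z\<bar> \<le> K" and T: "T \<in> borel_measurable borel" "\<And>z. \<bar>T z\<bar> \<le> L"
    using trig_polys_bounded[OF add.hyps(1)] trig_polys_bounded[OF add.hyps(2)] by blast
  have iS: "integrable torus S" and iT: "integrable torus T"
    using integrable_times_bounded[of "\<lambda>_. 1", OF _ S] integrable_times_bounded[of "\<lambda>_. 1", OF _ T] by simp_all
  have co: "fourier_coeff (\<lambda>z. S z + T z) b c m n = fourier_coeff S b c m n + fourier_coeff T b c m n" for b c m n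
    unfolding fourier_coeff_def using integrable_times_trig[OF iS] integrable_times_trig[OF iT]
    by (simp add: distrib_right)
  show ?case
  proof (intro exI[of _ "max N1 N2"] allI impI)
    fix M :: nat and F :: "real \<times> real \<Rightarrow> real" assume M: "max N1 N2 \<le> M" and F: "integrable torus F"
    have "(LINT z|torus. F z * (S z + T z)) = (LINT z|torus. F z * S z) + (LINT z|torus. F z * T z)"
      using integrable_times_bounded[OF F S] integrable_times_bounded[OF F T] by (simp add: distrib_left)
    also have "\<dots> = parseval_sum M F S + parseval_sum M F T"
      using 1[rule_format, of M F] 2[rule_format, of M F] M F by simp
    also have "\<dots> = parseval_sum M F (\<lambda>z. S z + T z)"
      unfolding parseval_sum_def co distrib_left add_divide_distrib sum.distrib by (rule refl)
    finally show "(LINT z|torus. F z * (S z + T z)) = parseval_sum M F (\<lambda>z. S z + T z)" .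
  qed
qed

lemma conjugate_exponent:
  fixes s q :: real
  assumes "1 < s" "q = s / (s - 1)"
  shows "1 < q" "(q - 1) * (s - 1) = 1" "(s - 1) * q = s" "(s - 2) * q / s = - (q - 2)"
proof -
  show "1 < q" using assms by (simp add: less_divide_eq)
  have qs: "q * (s - 1) = s" using assms by simp
  then show "(q - 1) * (s - 1) = 1" "(s - 1) * q = s" by (simp_all add: algebra_simps)
  from qs have "(s - 2) * q = - (q - 2) * s" by (simp add: algebra_simps)
  then show "(s - 2) * q / s = - (q - 2)" using assms by simp
qed

text \<open>Young's inequality, with the weights \<open>k powr (s - 2)\<close> and \<open>k powr (q - 2)\<close> that are dual to each other
  for conjugate exponents, and a free parameter \<open>\<delta>\<close>.\<close>

lemma young_scaled:
  fixes a b k \<delta> s q :: real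
  assumes "0 \<le> a" "0 \<le> b" "0 < k" "0 < \<delta>" "1 < s" "q = s / (s - 1)"
  shows "a * b \<le> \<delta> powr (-s) * (k powr (s - 2) * a powr s) + \<delta> powr q * (k powr (q - 2) * b powr q)"
proof (cases "a = 0 \<or> b = 0")
  case True
  then show ?thesis by auto
next
  case False
  then have ab: "0 < a" "0 < b" using assms by auto
  define u where "u = a * k powr ((s - 2) / s) / \<delta>"
  define v where "v = b * \<delta> / k powr ((s - 2) / s)"
  have uv: "0 < u" "0 < v" using ab assms by (auto simp: u_def v_def)
  note q = conjugate_exponent(1,2,4)[OF assms(5,6)]
  have "u * v \<le> u powr s + v powr q"
  proof (cases "u \<le> v powr (q - 1)")
    case True
    then have "u * v \<le> v powr (q - 1) * v" using uv by (intro mult_right_mono) auto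
    also have "\<dots> = v powr q" using uv by (simp add: powr_diff)
    finally show ?thesis using powr_ge_zero[of u s] by linarith
  next
    case False
    then have "(v powr (q - 1)) powr (s - 1) \<le> u powr (s - 1)"
      using assms by (intro powr_mono2) auto
    then have "v \<le> u powr (s - 1)" using uv q by (simp add: powr_powr)
    then have "u * v \<le> u * u powr (s - 1)" using uv by (intro mult_left_mono) auto
    also have "\<dots> = u powr s" using uv by (simp add: powr_diff)
    finally show ?thesis using powr_ge_zero[of v q] by linarith
  qed
  moreover have "u * v = a * b" using assms by (simp add: u_def v_def)
  moreover have "u powr s = \<delta> powr (-s) * (k powr (s - 2) * a powr s)"
  proof -
    have "u powr s = a powr s * k powr ((s - 2) / s * s) / \<delta> powr s"
      using assms ab by (simp add: u_def powr_mult powr_divide powr_powr)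
    also have "(s - 2) / s * s = s - 2" using assms by simp
    finally show ?thesis by (simp only: powr_minus divide_inverse mult_ac)
  qed
  moreover have "v powr q = \<delta> powr q * (k powr (q - 2) * b powr q)"
  proof -
    have "v powr q = b powr q * \<delta> powr q / k powr ((s - 2) / s * q)"
      using assms ab by (simp add: v_def powr_mult powr_divide powr_powr)
    also have "(s - 2) / s * q = - (q - 2)" using q(3) by simp
    finally show ?thesis by (simp only: powr_minus divide_inverse inverse_inverse_eq mult_ac)
  qed
  ultimately show ?thesis by simp
qed

lemma sum_le_nn_integral_count_space:
  fixes f :: "nat \<Rightarrow> nat \<Rightarrow> ennreal"
  shows "(\<Sum>m=1..M. \<Sum>n=1..M. f m n) \<le> (\<Sum>\<^sup>+m. \<Sum>\<^sup>+n. f m n)"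
proof -
  have *: "sum g {1..M} \<le> (\<Sum>\<^sup>+n. g n)" for g :: "nat \<Rightarrow> ennreal"
    unfolding infsum_eq_nn_integral_count_space[symmetric]
    by (subst nonneg_infsum_complete) (auto intro!: SUP_upper)
  have "(\<Sum>m=1..M. \<Sum>n=1..M. f m n) \<le> (\<Sum>m=1..M. \<Sum>\<^sup>+n. f m n)"
    by (intro sum_mono *)
  also have "\<dots> \<le> (\<Sum>\<^sup>+m. \<Sum>\<^sup>+n. f m n)" by (rule *)
  finally show ?thesis .
qed

text \<open>Parseval's formula for \<open>\<integral> F T\<close> followed by Young's inequality, frequency by frequency. The factor 4
  counts the kinds of coefficients.\<close>

lemma trig_poly_duality:
  assumes s: "1 < s" "q = s / (s - 1)" and \<delta>: "0 < \<delta>" and T: "T \<in> trig_polys" and F: "integrable torus F"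
    and axes: "\<And>b c m n. m = 0 \<or> n = 0 \<Longrightarrow> fourier_coeff F b c m n = 0"
  shows "ennreal \<bar>LINT z|torus. F z * T z\<bar>
    \<le> 4 * (ennreal (\<delta> powr (-s)) * (amplitude_sum s F)
       + ennreal (\<delta> powr q) * (amplitude_sum q T))"
proof -
  obtain M where M: "(LINT z|torus. F z * T z) = parseval_sum M F T"
    using trig_poly_parseval[OF T] F by blast
  define U where "U m n = real m powr (s - 2) * real n powr (s - 2) * amplitude F m n powr s" for m n
  define V where "V m n = real m powr (q - 2) * real n powr (q - 2) * amplitude T m n powr q" for m n
  have norm1: "1 \<le> trig_norm m" for m using pi_ge_two by (simp add: trig_norm_def)
  have term_le: "\<bar>fourier_coeff F b c m n * fourier_coeff T b c m n / (trig_norm m * trig_norm n)\<bar> \<le> amplitude F m n * amplitude T m n" for b c m n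
  proof -
    have "\<bar>fourier_coeff F b c m n * fourier_coeff T b c m n / (trig_norm m * trig_norm n)\<bar>
       = \<bar>fourier_coeff F b c m n\<bar> * \<bar>fourier_coeff T b c m n\<bar> / (trig_norm m * trig_norm n)"
      using trig_norm_pos by (simp add: abs_mult less_imp_le abs_of_pos)
    also have "\<dots> \<le> \<bar>fourier_coeff F b c m n\<bar> * \<bar>fourier_coeff T b c m n\<bar> / 1"
      using mult_mono[OF norm1 norm1, of m n] trig_norm_pos by (intro divide_left_mono) (auto simp: less_imp_le)
    also have "\<dots> \<le> amplitude F m n * amplitude T m n"
      using abs_coeff_le_amplitude amplitude_nonneg by (simp add: mult_mono)
    finally show ?thesis .
  qed
  have "\<bar>LINT z|torus. F z * T z\<bar> \<le> (\<Sum>b\<in>(UNIV::bool set). \<Sum>c\<in>(UNIV::bool set). \<Sum>m\<le>M. \<Sum>n\<le>M. amplitude F m n * amplitude T m n)"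
    unfolding M parseval_sum_def by (intro order_trans[OF sum_abs] sum_mono term_le)
  also have "\<dots> = 4 * (\<Sum>m\<le>M. \<Sum>n\<le>M. amplitude F m n * amplitude T m n)" by (simp add: UNIV_bool)
  also have "(\<Sum>m\<le>M. \<Sum>n\<le>M. amplitude F m n * amplitude T m n) = (\<Sum>m=1..M. \<Sum>n=1..M. amplitude F m n * amplitude T m n)"
  proof -
    have z: "amplitude F m n = 0" if "m = 0 \<or> n = 0" for m n
      using axes[OF that] by (simp add: amplitude_def)
    have "(\<Sum>n\<le>M. amplitude F m n * amplitude T m n) = (\<Sum>n=1..M. amplitude F m n * amplitude T m n)" for m
      by (rule sum.mono_neutral_right) (auto simp: z not_le)
    moreover have "(\<Sum>m\<le>M. \<Sum>n=1..M. amplitude F m n * amplitude T m n) = (\<Sum>m=1..M. \<Sum>n=1..M. amplitude F m n * amplitude T m n)"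
      by (rule sum.mono_neutral_right) (auto simp: z not_le)
    ultimately show ?thesis by simp
  qed
  also have "\<dots> \<le> (\<Sum>m=1..M. \<Sum>n=1..M. \<delta> powr (-s) * U m n + \<delta> powr q * V m n)"
  proof (intro sum_mono)
    fix m n assume "m \<in> {1..M}" "n \<in> {1..M}"
    then have "0 < real m * real n" by simp
    from young_scaled[OF amplitude_nonneg amplitude_nonneg this \<delta> s]
    show "amplitude F m n * amplitude T m n \<le> \<delta> powr (-s) * U m n + \<delta> powr q * V m n"
      by (simp add: U_def V_def powr_mult)
  qed
  finally have "ennreal \<bar>LINT z|torus. F z * T z\<bar> \<le> ennreal (4 * (\<Sum>m=1..M. \<Sum>n=1..M. \<delta> powr (-s) * U m n + \<delta> powr q * V m n))"
    by (intro ennreal_leI) simp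
  also have "\<dots> = 4 * (ennreal (\<delta> powr (-s)) * (\<Sum>m=1..M. \<Sum>n=1..M. ennreal (U m n))
      + ennreal (\<delta> powr q) * (\<Sum>m=1..M. \<Sum>n=1..M. ennreal (V m n)))"
  proof -
    have UV: "0 \<le> U m n" "0 \<le> V m n" for m n by (auto simp: U_def V_def)
    have "(\<Sum>m=1..M. \<Sum>n=1..M. \<delta> powr (-s) * U m n + \<delta> powr q * V m n)
      = \<delta> powr (-s) * (\<Sum>m=1..M. \<Sum>n=1..M. U m n) + \<delta> powr q * (\<Sum>m=1..M. \<Sum>n=1..M. V m n)"
      by (simp add: sum.distrib sum_distrib_left)
    moreover have "(\<Sum>m=1..M. \<Sum>n=1..M. ennreal (W m n)) = ennreal (\<Sum>m=1..M. \<Sum>n=1..M. W m n)" if "\<And>m n. 0 \<le> W m n" for W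
      using that by (simp add: sum_nonneg)
    ultimately show ?thesis using UV
      by (simp add: ennreal_mult sum_nonneg)
  qed
  also have "\<dots> \<le> 4 * (ennreal (\<delta> powr (-s)) * (\<Sum>\<^sup>+m. \<Sum>\<^sup>+n. ennreal (U m n))
       + ennreal (\<delta> powr q) * (\<Sum>\<^sup>+m. \<Sum>\<^sup>+n. ennreal (V m n)))"
    by (intro mult_left_mono add_mono sum_le_nn_integral_count_space) auto
  finally show ?thesis unfolding U_def V_def .
qed

text \<open>Testing \<open>F\<close> against \<open>\<psi> = sgn F * \<bar>F\<bar> powr (s - 1)\<close>, restricted to \<open>\<bar>F\<bar> \<le> L\<close>, gives
  \<open>\<integral> F \<psi> = \<integral> \<bar>\<psi>\<bar> powr q\<close>. The choice of \<open>\<delta>\<close> makes the contribution of \<open>\<psi>\<close> in Young's inequality at most half of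
  this integral, which is finite because \<open>\<psi>\<close> is bounded, so that it can be absorbed.\<close>

lemma truncated_dual_bound:
  assumes s: "2 \<le> s" "q = s / (s - 1)" and C: "0 < C"
    and paley: "\<And>T. integrable torus T \<Longrightarrow>
      (amplitude_sum q T) \<le> ennreal C * (moment q T)"
    and \<delta>: "0 < \<delta>" "4 * \<delta> powr q * C = 1/2"
    and F: "integrable torus F"
    and axes: "\<And>b c m n. m = 0 \<or> n = 0 \<Longrightarrow> fourier_coeff F b c m n = 0"
  shows "(\<integral>\<^sup>+z. ennreal (\<bar>F z\<bar> powr s) * indicator {z. \<bar>F z\<bar> \<le> L} z \<partial>torus)
    \<le> ennreal (8 * \<delta> powr (-s)) * (amplitude_sum s F)" (is "_ \<le> ennreal (8 * _) * ?S")
proof (cases "?S = \<infinity> \<or> L < 0")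
  case True
  then show ?thesis
  proof
    assume "L < 0"
    then have "indicator {z. \<bar>F z\<bar> \<le> L} z = (0::ennreal)" for z by (auto simp: indicator_def)
    then show ?thesis by simp
  qed (use \<delta> in \<open>simp add: ennreal_mult_top\<close>)
next
  case False
  then have L: "0 \<le> L" by simp
  obtain \<sigma> where \<sigma>: "0 \<le> \<sigma>" "?S = ennreal \<sigma>" using False by (cases ?S) auto
  have s1: "1 < s" using s by simp
  have q: "1 < q" "(s - 1) * q = s" using conjugate_exponent[of s q] s by auto
  have Fm [measurable]: "F \<in> borel_measurable borel" using borel_measurable_integrable[OF F] by simp
  define \<psi> where "\<psi> z = sgn (F z) * (\<bar>F z\<bar> powr (s - 1) * indicator {z. \<bar>F z\<bar> \<le> L} z)" for z
  have [measurable]: "\<psi> \<in> borel_measurable borel" unfolding \<psi>_def[abs_def] indicator_def by measurable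
  define K where "K = L powr (s - 1)"
  have bound: "\<bar>\<psi> z\<bar> \<le> K" for z
  proof (cases "\<bar>F z\<bar> \<le> L")
    case True
    then have "\<bar>F z\<bar> powr (s - 1) \<le> K" unfolding K_def using s by (intro powr_mono2) auto
    then show ?thesis using True by (auto simp: \<psi>_def abs_mult sgn_real_def K_def)
  qed (simp add: \<psi>_def K_def)
  obtain T where T: "\<And>k. T k \<in> trig_polys" "\<And>k z. \<bar>T k z\<bar> \<le> K + 1"
    "AE z in torus. (\<lambda>k. T k z) \<longlonglongrightarrow> \<psi> z"
    using trig_polys_dense[of \<psi> K] bound by auto
  have Tm: "T k \<in> borel_measurable borel" for k using trig_polys_bounded[OF T(1)] by blast
  note [measurable] = Tm
  have iT: "integrable torus (T k)" for k
    using integrable_times_bounded[of "\<lambda>_. 1", OF _ Tm T(2)] by simp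
  have K0: "0 \<le> K" by (simp add: K_def)
  have iTq: "integrable torus (\<lambda>z. \<bar>T k z\<bar> powr q)" for k
    using T(2) q by (intro torus.integrable_const_bound[where B="(K + 1) powr q"]) (auto intro!: AE_I2 powr_mono2)
  have step: "\<bar>LINT z|torus. F z * T k z\<bar> \<le> 4 * \<delta> powr (-s) * \<sigma> + 1/2 * (LINT z|torus. \<bar>T k z\<bar> powr q)" for k
  proof -
    have "ennreal \<bar>LINT z|torus. F z * T k z\<bar> \<le> 4 * (ennreal (\<delta> powr (-s)) * ennreal \<sigma>
       + ennreal (\<delta> powr q) * (ennreal C * (moment q (T k))))"
      unfolding \<sigma>(2)[symmetric]
      by (rule order_trans[OF trig_poly_duality[OF s1 s(2) \<delta>(1) T(1) F axes]], assumption)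
        (intro mult_left_mono add_mono order_refl paley iT zero_le)
    also have "(moment q (T k)) = ennreal (LINT z|torus. \<bar>T k z\<bar> powr q)"
      by (rule nn_integral_eq_integral[OF iTq]) simp
    also have "4 * (ennreal (\<delta> powr (-s)) * ennreal \<sigma> + ennreal (\<delta> powr q) * (ennreal C * ennreal (LINT z|torus. \<bar>T k z\<bar> powr q)))
      = ennreal (4 * (\<delta> powr (-s) * \<sigma> + \<delta> powr q * (C * (LINT z|torus. \<bar>T k z\<bar> powr q))))"
      using \<sigma>(1) C by (simp add: ennreal_mult)
    also have "4 * (\<delta> powr (-s) * \<sigma> + \<delta> powr q * (C * (LINT z|torus. \<bar>T k z\<bar> powr q)))
      = 4 * \<delta> powr (-s) * \<sigma> + (4 * \<delta> powr q * C) * (LINT z|torus. \<bar>T k z\<bar> powr q)"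
      by (simp add: algebra_simps)
    finally show ?thesis unfolding \<delta>(2) using \<sigma>(1)
      by (subst (asm) ennreal_le_iff) (auto intro!: add_nonneg_nonneg)
  qed
  have lim1: "(\<lambda>k. LINT z|torus. F z * T k z) \<longlonglongrightarrow> (LINT z|torus. F z * \<psi> z)"
  proof (rule integral_dominated_convergence[where w="\<lambda>z. (K + 1) * \<bar>F z\<bar>"])
    show "AE z in torus. (\<lambda>k. F z * T k z) \<longlonglongrightarrow> F z * \<psi> z"
      using T(3) by eventually_elim (rule tendsto_mult_left)
    show "AE z in torus. norm (F z * T k z) \<le> (K + 1) * \<bar>F z\<bar>" for k
      using T(2)[of k] by (intro AE_I2) (auto simp: abs_mult mult.commute[of "K + 1"] intro!: mult_left_mono)
    show "integrable torus (\<lambda>z. (K + 1) * \<bar>F z\<bar>)" using F by auto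
  qed measurable
  have lim2: "(\<lambda>k. LINT z|torus. \<bar>T k z\<bar> powr q) \<longlonglongrightarrow> (LINT z|torus. \<bar>\<psi> z\<bar> powr q)"
  proof (rule integral_dominated_convergence[where w="\<lambda>z. (K + 1) powr q"])
    show "AE z in torus. (\<lambda>k. \<bar>T k z\<bar> powr q) \<longlonglongrightarrow> \<bar>\<psi> z\<bar> powr q"
      using T(3) by eventually_elim (use q in \<open>auto intro!: tendsto_powr' tendsto_intros\<close>)
    show "AE z in torus. norm (\<bar>T k z\<bar> powr q) \<le> (K + 1) powr q" for k
      using T(2)[of k] q by (intro AE_I2) (auto intro!: powr_mono2)
  qed simp_all
  have "\<bar>LINT z|torus. F z * \<psi> z\<bar> \<le> 4 * \<delta> powr (-s) * \<sigma> + 1/2 * (LINT z|torus. \<bar>\<psi> z\<bar> powr q)"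
    by (rule LIMSEQ_le[OF tendsto_rabs[OF lim1] tendsto_add[OF tendsto_const tendsto_mult_left[OF lim2]]]) (use step in blast)
  moreover have "F z * \<psi> z = \<bar>\<psi> z\<bar> powr q" and P: "\<bar>\<psi> z\<bar> powr q = \<bar>F z\<bar> powr s * indicator {z. \<bar>F z\<bar> \<le> L} z" for z
  proof -
    show P: "\<bar>\<psi> z\<bar> powr q = \<bar>F z\<bar> powr s * indicator {z. \<bar>F z\<bar> \<le> L} z"
      using q by (cases "F z = 0") (auto simp: \<psi>_def abs_mult sgn_real_def powr_powr split: split_indicator)
    have "F z * \<psi> z = \<bar>F z\<bar> * \<bar>F z\<bar> powr (s - 1) * indicator {z. \<bar>F z\<bar> \<le> L} z"
      by (simp add: \<psi>_def sgn_real_def)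
    also have "\<bar>F z\<bar> * \<bar>F z\<bar> powr (s - 1) = \<bar>F z\<bar> powr s"
      by (cases "F z = 0") (auto simp: powr_diff)
    finally show "F z * \<psi> z = \<bar>\<psi> z\<bar> powr q" unfolding P .
  qed
  ultimately have le: "(LINT z|torus. \<bar>\<psi> z\<bar> powr q) \<le> 8 * \<delta> powr (-s) * \<sigma>" by simp
  have "integrable torus (\<lambda>z. \<bar>\<psi> z\<bar> powr q)"
    using bound q by (intro torus.integrable_const_bound[where B="K powr q"]) (auto intro!: AE_I2 powr_mono2)
  then have eq1: "(moment q \<psi>) = ennreal (LINT z|torus. \<bar>\<psi> z\<bar> powr q)"
    by (rule nn_integral_eq_integral) simp
  have eq2: "(\<integral>\<^sup>+z. ennreal (\<bar>F z\<bar> powr s) * indicator {z. \<bar>F z\<bar> \<le> L} z \<partial>torus) = (moment q \<psi>)"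
    unfolding P by (intro nn_integral_cong) (auto split: split_indicator)
  have eq3: "ennreal (8 * \<delta> powr (-s) * \<sigma>) = ennreal (8 * \<delta> powr (-s)) * ?S"
    unfolding \<sigma>(2) using \<sigma>(1) by (intro ennreal_mult) auto
  show ?thesis unfolding eq2 eq1 eq3[symmetric] by (rule ennreal_leI[OF le])
qed

text \<open>The bound is uniform in the truncation level, so the truncation can be removed. No integrability of
  \<open>F\<close> beyond the first power is needed.\<close>

lemma dual_paley_torus:
  assumes s: "2 \<le> s"
  shows "\<exists>C>0. \<forall>F. integrable torus F \<longrightarrow> (\<forall>b c m n. m = 0 \<or> n = 0 \<longrightarrow> fourier_coeff F b c m n = 0) \<longrightarrow>
    (moment s F)
    \<le> ennreal C * (amplitude_sum s F)"
proof -
  define q where "q = s / (s - 1)"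
  have q: "1 < q" "q \<le> 2" using s by (auto simp: q_def field_simps)
  obtain C where C: "0 < C" and paley: "\<forall>T. integrable torus T \<longrightarrow>
      (amplitude_sum q T) \<le> ennreal C * (moment q T)"
    using paley_torus[OF q] by blast
  \<comment> \<open>This value of \<open>\<delta>\<close> turns the coefficient \<open>4 * \<delta> powr q * C\<close> of the absorbed term into 1/2.\<close>
  define \<delta> where "\<delta> = (1 / (8 * C)) powr (1 / q)"
  have \<delta>: "0 < \<delta>" "4 * \<delta> powr q * C = 1/2" using C q by (auto simp: \<delta>_def powr_powr)
  show ?thesis
  proof (intro exI[of _ "8 * \<delta> powr (-s)"] conjI allI impI)
    show "0 < 8 * \<delta> powr (-s)" using \<delta> by simp
    fix F :: "real \<times> real \<Rightarrow> real"
    assume F: "integrable torus F" and axes: "\<forall>b c m n. m = 0 \<or> n = 0 \<longrightarrow> fourier_coeff F b c m n = 0"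
    have [measurable]: "F \<in> borel_measurable torus" using borel_measurable_integrable[OF F] .
    let ?f = "\<lambda>k z. ennreal (\<bar>F z\<bar> powr s) * indicator {z. \<bar>F z\<bar> \<le> real k} z"
    have "(moment s F) = (\<integral>\<^sup>+z. (SUP k. ?f k z) \<partial>torus)"
    proof (rule nn_integral_cong, rule antisym)
      fix z
      obtain k where "\<bar>F z\<bar> \<le> real k" using real_arch_simple by blast
      then show "ennreal (\<bar>F z\<bar> powr s) \<le> (SUP k. ?f k z)" by (intro SUP_upper2[of k]) auto
      show "(SUP k. ?f k z) \<le> ennreal (\<bar>F z\<bar> powr s)" by (rule SUP_least) (auto split: split_indicator)
    qed
    also have "\<dots> = (SUP k. \<integral>\<^sup>+z. ?f k z \<partial>torus)"
    proof (rule nn_integral_monotone_convergence_SUP)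
      show "incseq ?f" by (auto simp: incseq_def le_fun_def split: split_indicator)
      show "?f k \<in> borel_measurable torus" for k unfolding indicator_def by measurable
    qed
    also have "\<dots> \<le> ennreal (8 * \<delta> powr (-s)) * (amplitude_sum s F)"
      by (rule SUP_least, rule truncated_dual_bound[OF s q_def C paley[rule_format] \<delta> F axes[rule_format]])
    finally show "(moment s F)
      \<le> ennreal (8 * \<delta> powr (-s)) * (amplitude_sum s F)" .
  qed
qed

section \<open>The multiplier of a fractional difference\<close>

text \<open>The modulus \<open>\<bar>1 - exp (i m h)\<bar> powr \<beta>\<close> by which a difference of order \<open>\<beta>\<close> and step \<open>h\<close> acts at
  frequency \<open>m\<close>.\<close>

abbreviation step_factor :: "real \<Rightarrow> nat \<Rightarrow> real \<Rightarrow> real" where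
  "step_factor \<beta> m h \<equiv> \<bar>2 * sin (real m * h / 2)\<bar> powr \<beta>"

text \<open>With \<open>a \<nu> = \<bar>\<alpha> gchoose \<nu>\<bar>\<close> one has \<open>(\<nu> + 1) * a (\<nu> + 1) = (\<nu> - \<alpha>) * a \<nu>\<close> for \<open>\<nu> \<ge> \<alpha>\<close>, so that
  \<open>\<alpha> * a \<nu> = \<nu> * a \<nu> - (\<nu> + 1) * a (\<nu> + 1)\<close> telescopes.\<close>

lemma summable_gbinomial:
  fixes \<alpha> :: real
  assumes "0 < \<alpha>"
  shows "summable (\<lambda>\<nu>. \<bar>\<alpha> gchoose \<nu>\<bar>)"
proof -
  define a where "a \<nu> = \<bar>\<alpha> gchoose \<nu>\<bar>" for \<nu>
  define N where "N = nat \<lceil>\<alpha>\<rceil>"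
  define b where "b \<nu> = real \<nu> * a \<nu>" for \<nu>
  have tele: "\<alpha> * a (\<nu> + N) = b (\<nu> + N) - b (Suc \<nu> + N)" for \<nu>
  proof -
    \<comment> \<open>Beyond \<open>N\<close> the factor \<open>\<nu> - \<alpha>\<close> has a fixed sign.\<close>
    have le: "\<alpha> \<le> real (\<nu> + N)" unfolding N_def by linarith
    have "real (Suc (\<nu> + N)) * (\<alpha> gchoose Suc (\<nu> + N)) = (\<alpha> - real (\<nu> + N)) * (\<alpha> gchoose (\<nu> + N))"
      using gbinomial_mult_1[of \<alpha> "\<nu> + N"] by (simp add: algebra_simps)
    then have "\<bar>real (Suc (\<nu> + N)) * (\<alpha> gchoose Suc (\<nu> + N))\<bar> = \<bar>(\<alpha> - real (\<nu> + N)) * (\<alpha> gchoose (\<nu> + N))\<bar>" by simp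
    then have "real (Suc (\<nu> + N)) * a (Suc (\<nu> + N)) = (real (\<nu> + N) - \<alpha>) * a (\<nu> + N)"
      using le by (simp only: abs_mult a_def) (simp add: abs_if)
    then show ?thesis by (simp add: b_def algebra_simps)
  qed
  have "summable (\<lambda>\<nu>. a (\<nu> + N))"
  proof (rule summableI_nonneg_bounded)
    show "0 \<le> a (\<nu> + N)" for \<nu> by (simp add: a_def)
    fix n
    have "\<alpha> * (\<Sum>\<nu><n. a (\<nu> + N)) = (\<Sum>\<nu><n. b (\<nu> + N) - b (Suc \<nu> + N))"
      by (simp add: sum_distrib_left tele)
    also have "\<dots> = b N - b (n + N)" by (subst sum_lessThan_telescope') simp
    also have "\<dots> \<le> b N" by (simp add: b_def a_def)
    finally show "(\<Sum>\<nu><n. a (\<nu> + N)) \<le> b N / \<alpha>" using assms by (simp add: field_simps)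
  qed
  then have "summable a" by (simp only: summable_iff_shift)
  then show ?thesis by (simp add: a_def[abs_def])
qed

text \<open>The coefficients of the fractional difference of order \<open>\<alpha>\<close>.\<close>

definition diff_coeff :: "real \<Rightarrow> nat \<Rightarrow> real" where
  "diff_coeff \<alpha> \<nu> = (-1) ^ \<nu> * (\<alpha> gchoose \<nu>)"

lemma summable_diff_coeff: "0 < \<alpha> \<Longrightarrow> summable (\<lambda>\<nu>. \<bar>diff_coeff \<alpha> \<nu>\<bar>)"
  using summable_gbinomial[of \<alpha>] by (simp add: diff_coeff_def abs_mult power_abs)

text \<open>The binomial series of \<open>(1 - w) powr \<alpha>\<close> on the unit circle, by continuity from the open disc (Abel); only
  the modulus is needed, which is continuous even at \<open>w = 1\<close>.\<close>

lemma norm_binomial_series_boundary: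
  fixes w :: complex
  assumes \<alpha>: "0 < \<alpha>" and w: "norm w = 1"
  shows "norm (\<Sum>\<nu>. of_real (diff_coeff \<alpha> \<nu>) * w ^ \<nu>) = norm (1 - w) powr \<alpha>"
proof -
  define f where "f \<nu> r = of_real (diff_coeff \<alpha> \<nu>) * (of_real r * w) ^ \<nu>" for \<nu> and r :: real
  have "uniform_limit {0..1} (\<lambda>n r. \<Sum>i<n. f i r) (\<lambda>r. suminf (\<lambda>i. f i r)) sequentially"
  proof (rule Weierstrass_m_test)
    show "norm (f n r) \<le> \<bar>diff_coeff \<alpha> n\<bar>" if "r \<in> {0..1}" for n r
      using that w by (auto simp: f_def norm_mult norm_power power_mult_distrib intro!: mult_left_le power_le_one)
  qed (rule summable_diff_coeff[OF \<alpha>])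
  then have cont: "continuous_on {0..1} (\<lambda>r. \<Sum>i. f i r)"
    by (rule uniform_limit_theorem[rotated]) (auto simp: f_def intro!: always_eventually continuous_intros)
  define r where "r k = 1 - inverse (real (Suc k))" for k
  have r01: "0 \<le> r k" "r k < 1" for k by (auto simp: r_def field_simps)
  have r1: "r \<longlonglongrightarrow> 1"
    unfolding r_def using tendsto_diff[OF tendsto_const[of "1::real"] LIMSEQ_inverse_real_of_nat] by simp
  have "(\<lambda>k. \<Sum>i. f i (r k)) \<longlonglongrightarrow> (\<Sum>i. f i 1)"
    by (rule continuous_on_tendsto_compose[OF cont r1]) (use r01 in \<open>auto intro!: always_eventually less_imp_le\<close>)
  then have 1: "(\<lambda>k. norm (\<Sum>i. f i (r k))) \<longlonglongrightarrow> norm (\<Sum>i. f i 1)" by (rule tendsto_norm)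
  have "norm (\<Sum>i. f i (r k)) = norm (1 - of_real (r k) * w) powr \<alpha>" for k
  proof -
    have "norm (- (of_real (r k) * w)) < 1" using w r01[of k] by (simp add: norm_mult)
    from gen_binomial_complex[OF this, of "of_real \<alpha>"]
    have "(\<lambda>i. f i (r k)) sums (1 - of_real (r k) * w) powr of_real \<alpha>"
    proof -
      have "(of_real \<alpha> gchoose i) * (- (of_real (r k) * w)) ^ i = f i (r k)" for i
      proof -
        have "complex_of_real (\<alpha> gchoose i) = (of_real \<alpha> gchoose i)" by (simp add: gbinomial_prod_rev)
        then show ?thesis
          unfolding power_minus[of "of_real (r k) * w"] by (simp add: f_def diff_coeff_def)
      qed
      with \<open>(\<lambda>n. (complex_of_real \<alpha> gchoose n) * (- (of_real (r k) * w)) ^ n) sums (1 + - (of_real (r k) * w)) powr of_real \<alpha>\<close>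
      show ?thesis by simp
    qed
    then have "(\<Sum>i. f i (r k)) = (1 - of_real (r k) * w) powr of_real \<alpha>" by (rule sums_unique[symmetric])
    then show ?thesis by (simp add: norm_powr_real_powr')
  qed
  moreover have "(\<lambda>k. norm (1 - of_real (r k) * w) powr \<alpha>) \<longlonglongrightarrow> norm (1 - of_real 1 * w) powr \<alpha>"
    using \<alpha> by (intro tendsto_powr' tendsto_intros r1) auto
  ultimately have "norm (\<Sum>i. f i 1) = norm (1 - w) powr \<alpha>"
    using LIMSEQ_unique[OF 1] by simp
  then show ?thesis by (simp add: f_def)
qed

text \<open>\<open>X + i Y\<close> is, up to a factor of modulus one, the binomial series at \<open>w = exp (- i m h)\<close>.\<close>

lemma diff_multiplier:
  fixes h :: real and m :: nat
  assumes \<alpha>: "0 < \<alpha>"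
  defines "X \<equiv> (\<Sum>\<nu>. diff_coeff \<alpha> \<nu> * cos (real m * ((\<alpha> - real \<nu>) * h)))"
    and "Y \<equiv> (\<Sum>\<nu>. diff_coeff \<alpha> \<nu> * sin (real m * ((\<alpha> - real \<nu>) * h)))"
  shows "sqrt (X\<^sup>2 + Y\<^sup>2) = step_factor \<alpha> m h"
proof -
  define w where "w = cis (- (real m * h))"
  define z where "z \<nu> = of_real (diff_coeff \<alpha> \<nu>) * cis (real m * ((\<alpha> - real \<nu>) * h))" for \<nu>
  have sumz: "summable z"
    by (rule summable_norm_cancel) (simp add: z_def norm_mult summable_diff_coeff \<alpha>)
  have "X = Re (suminf z)" "Y = Im (suminf z)"
    unfolding Re_suminf[OF sumz] Im_suminf[OF sumz] X_def Y_def z_def by simp_all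
  then have "sqrt (X\<^sup>2 + Y\<^sup>2) = norm (suminf z)" by (simp add: cmod_def)
  also have "suminf z = (\<Sum>\<nu>. cis (real m * \<alpha> * h) * (of_real (diff_coeff \<alpha> \<nu>) * w ^ \<nu>))"
  proof (rule suminf_cong)
    fix \<nu>
    have "cis (real m * ((\<alpha> - real \<nu>) * h)) = cis (real m * \<alpha> * h) * w ^ \<nu>"
      unfolding w_def Complex.DeMoivre cis_mult by (simp add: algebra_simps)
    then show "z \<nu> = cis (real m * \<alpha> * h) * (of_real (diff_coeff \<alpha> \<nu>) * w ^ \<nu>)" by (simp add: z_def)
  qed
  also have "\<dots> = cis (real m * \<alpha> * h) * (\<Sum>\<nu>. of_real (diff_coeff \<alpha> \<nu>) * w ^ \<nu>)"
  proof (rule suminf_mult)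
    show "summable (\<lambda>\<nu>. of_real (diff_coeff \<alpha> \<nu>) * w ^ \<nu>)"
      by (rule summable_norm_cancel) (simp add: w_def norm_mult norm_power summable_diff_coeff \<alpha>)
  qed
  also have "norm \<dots> = norm (1 - w) powr \<alpha>"
    using norm_binomial_series_boundary[OF \<alpha>, of w] by (simp add: norm_mult w_def)
  also have "norm (1 - w) = \<bar>2 * sin (real m * h / 2)\<bar>"
  proof -
    define u where "u = real m * h / 2"
    have "(norm (1 - w))\<^sup>2 = (1 - cos (2 * u))\<^sup>2 + (sin (2 * u))\<^sup>2"
      by (simp add: cmod_power2 w_def u_def)
    also have "\<dots> = 2 - 2 * cos (2 * u)"
      using sin_cos_squared_add[of "2 * u"] by (simp add: power2_eq_square algebra_simps)
    also have "\<dots> = (2 * sin u)\<^sup>2"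
      by (simp add: cos_double_sin power_mult_distrib)
    finally show ?thesis unfolding u_def by (metis norm_ge_zero real_sqrt_abs real_sqrt_unique)
  qed
  finally show ?thesis .
qed

section \<open>Fractional differences on the torus\<close>

lemma nn_integral_circle_shift:
  fixes f :: "real \<Rightarrow> ennreal"
  assumes [measurable]: "f \<in> borel_measurable borel" and per: "\<And>x. f (x + 2 * pi) = f x"
  shows "(\<integral>\<^sup>+x. f (x + t) \<partial>circle) = (\<integral>\<^sup>+x. f x \<partial>circle)"
proof -
  interpret P: periodic_fun_simple f "2 * pi" by standard (rule per)
  define k where "k = \<lfloor>t / (2 * pi)\<rfloor>"
  define s where "s = t - of_int k * (2 * pi)"
  have s: "0 \<le> s" "s < 2 * pi"
  proof -
    have "of_int k \<le> t / (2 * pi)" "t / (2 * pi) < of_int k + 1" unfolding k_def by linarith+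
    then show "0 \<le> s" "s < 2 * pi" by (auto simp: s_def field_simps)
  qed
  \<comment> \<open>By periodicity the shift \<open>t\<close> may be reduced to \<open>0 \<le> s < 2\<pi>\<close>; the part of \<open>[s, s + 2\<pi>]\<close> beyond \<open>2\<pi>\<close> is then moved back by one period.\<close>
  have ts: "f (x + t) = f (s + 1 * x)" for x
    using P.plus_of_int[of "x + s" k] by (simp add: s_def algebra_simps)
  have AE_ne: "AE x in lborel. x \<noteq> c" for c :: real by (rule AE_lborel_singleton)
  have "(\<integral>\<^sup>+x. f (x + t) \<partial>circle) = (\<integral>\<^sup>+x. f (s + 1 * x) * indicator {s..s + 2*pi} (s + 1 * x) \<partial>lborel)"
    unfolding ts by (subst nn_integral_circle) (auto intro!: nn_integral_cong split: split_indicator)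
  also have "\<dots> = (\<integral>\<^sup>+x. f x * indicator {s..s + 2*pi} x \<partial>lborel)"
    by (subst nn_integral_real_affine[where c=1 and t=s]) auto
  also have "\<dots> = (\<integral>\<^sup>+x. f x * indicator {s..2*pi} x + f x * indicator {2*pi<..s + 2*pi} x \<partial>lborel)"
    using s by (intro nn_integral_cong) (auto split: split_indicator)
  also have "\<dots> = (\<integral>\<^sup>+x. f x * indicator {s..2*pi} x \<partial>lborel) + (\<integral>\<^sup>+x. f x * indicator {2*pi<..s + 2*pi} x \<partial>lborel)"
    by (rule nn_integral_add) auto
  also have "(\<integral>\<^sup>+x. f x * indicator {2*pi<..s + 2*pi} x \<partial>lborel)
      = (\<integral>\<^sup>+x. f (2*pi + 1 * x) * indicator {2*pi<..s + 2*pi} (2*pi + 1 * x) \<partial>lborel)"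
    by (subst nn_integral_real_affine[where c=1 and t="2*pi"]) auto
  also have "\<dots> = (\<integral>\<^sup>+x. f x * indicator {0<..s} x \<partial>lborel)"
    by (intro nn_integral_cong) (auto simp: per add.commute[of "2*pi"] split: split_indicator)
  also have "\<dots> = (\<integral>\<^sup>+x. f x * indicator {0..<s} x \<partial>lborel)"
  proof (rule nn_integral_cong_AE)
    show "AE x in lborel. f x * indicator {0<..s} x = f x * indicator {0..<s} x"
      using AE_ne[of 0] AE_ne[of s] by eventually_elim (auto split: split_indicator)
  qed
  also have "(\<integral>\<^sup>+x. f x * indicator {s..2*pi} x \<partial>lborel) + (\<integral>\<^sup>+x. f x * indicator {0..<s} x \<partial>lborel)
      = (\<integral>\<^sup>+x. f x * indicator {s..2*pi} x + f x * indicator {0..<s} x \<partial>lborel)"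
    by (rule nn_integral_add[symmetric]) auto
  also have "\<dots> = (\<integral>\<^sup>+x. f x * indicator {0..2*pi} x \<partial>lborel)"
    using s by (intro nn_integral_cong) (auto split: split_indicator)
  also have "\<dots> = (\<integral>\<^sup>+x. f x \<partial>circle)" by (simp add: nn_integral_circle)
  finally show ?thesis .
qed

lemma measurable_shift:
  assumes "H \<in> borel_measurable borel"
  shows "(\<lambda>z. H (fst z + t, snd z)) \<in> borel_measurable (borel :: (real \<times> real) measure)"
  by (rule measurable_compose[OF _ assms])
    (auto intro!: borel_measurable_continuous_onI continuous_intros)

lemma nn_integral_torus_shift:
  fixes H :: "real \<times> real \<Rightarrow> ennreal"
  assumes H [measurable]: "H \<in> borel_measurable borel" and per: "\<And>x y. H (x + 2 * pi, y) = H (x, y)"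
  shows "(\<integral>\<^sup>+z. H (fst z + t, snd z) \<partial>torus) = (\<integral>\<^sup>+z. H z \<partial>torus)"
proof -
  have [measurable]: "H \<in> borel_measurable (borel \<Otimes>\<^sub>M borel)" using H by (simp add: borel_prod)
  have "(\<integral>\<^sup>+z. H (fst z + t, snd z) \<partial>torus) = (\<integral>\<^sup>+y. \<integral>\<^sup>+x. H (x + t, y) \<partial>circle \<partial>circle)"
    using measurable_shift[OF H] by (subst nn_integral_torus) auto
  also have "\<dots> = (\<integral>\<^sup>+y. \<integral>\<^sup>+x. H (x, y) \<partial>circle \<partial>circle)"
    by (intro nn_integral_cong nn_integral_circle_shift[where f="\<lambda>x. H (x, y)" for y]) (auto simp: per)
  also have "\<dots> = (\<integral>\<^sup>+z. H z \<partial>torus)" by (simp add: nn_integral_torus)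
  finally show ?thesis .
qed

lemma integral_torus_shift:
  fixes H :: "real \<times> real \<Rightarrow> real"
  assumes H: "integrable torus H" and per: "\<And>x y. H (x + 2 * pi, y) = H (x, y)"
  shows "integrable torus (\<lambda>z. H (fst z + t, snd z))"
    and "(LINT z|torus. H (fst z + t, snd z)) = (LINT z|torus. H z)"
proof -
  have Hm [measurable]: "H \<in> borel_measurable borel" using borel_measurable_integrable[OF H] by simp
  have eq: "(\<integral>\<^sup>+z. ennreal (\<phi> (H (fst z + t, snd z))) \<partial>torus) = (\<integral>\<^sup>+z. ennreal (\<phi> (H z)) \<partial>torus)"
    if [measurable]: "\<phi> \<in> borel_measurable borel" for \<phi> :: "real \<Rightarrow> real"
    using nn_integral_torus_shift[of "\<lambda>z. ennreal (\<phi> (H z))"] by (simp add: per)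
  show int: "integrable torus (\<lambda>z. H (fst z + t, snd z))"
  proof (rule integrableI_bounded)
    show "(\<lambda>z. H (fst z + t, snd z)) \<in> borel_measurable torus" using measurable_shift[OF Hm] by simp
    show "(\<integral>\<^sup>+z. ennreal (norm (H (fst z + t, snd z))) \<partial>torus) < \<infinity>"
      using eq[of norm] H by (simp add: integrable_iff_bounded)
  qed
  show "(LINT z|torus. H (fst z + t, snd z)) = (LINT z|torus. H z)"
    unfolding real_lebesgue_integral_def[OF int] real_lebesgue_integral_def[OF H]
    using eq[of "\<lambda>x. x"] eq[of "\<lambda>x. - x"] by simp
qed

text \<open>Functions on the torus: integrable over a period and periodic everywhere, not merely almost
  everywhere. The class is closed under fractional differences.\<close>

definition torus_fun :: "(real \<times> real \<Rightarrow> real) \<Rightarrow> bool" where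
  "torus_fun F \<longleftrightarrow> integrable torus F \<and> (\<forall>x y. F (x + 2 * pi, y) = F (x, y) \<and> F (x, y + 2 * pi) = F (x, y))"

lemma trig_minus:
  "trig b m (x - t) = cos (real m * t) * trig b m x + (if b then -1 else 1) * sin (real m * t) * trig (\<not> b) m x"
  by (simp add: trig_def right_diff_distrib sin_diff cos_diff)

lemma coeff_shift:
  assumes "torus_fun F"
  shows "(LINT z|torus. F (fst z + t, snd z) * (trig b m (fst z) * trig c n (snd z)))
    = cos (real m * t) * fourier_coeff F b c m n + (if b then -1 else 1) * sin (real m * t) * fourier_coeff F (\<not> b) c m n"
proof -
  have F: "integrable torus F" and per: "\<And>x y. F (x + 2 * pi, y) = F (x, y)" using assms by (auto simp: torus_fun_def)
  have eqH: "F z * (trig b m (fst z - t) * trig c n (snd z))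
     = cos (real m * t) * (F z * (trig b m (fst z) * trig c n (snd z)))
       + ((if b then -1 else 1) * sin (real m * t)) * (F z * (trig (\<not> b) m (fst z) * trig c n (snd z)))" for z
    unfolding trig_minus by (simp add: algebra_simps)
  have H: "integrable torus (\<lambda>z. F z * (trig b m (fst z - t) * trig c n (snd z)))"
    unfolding eqH using integrable_times_trig[OF F] by (intro Bochner_Integration.integrable_add integrable_mult_right) auto
  have perH: "F (x + 2 * pi, y) * (trig b m (fst (x + 2 * pi, y) - t) * trig c n (snd (x + 2 * pi, y)))
     = F (x, y) * (trig b m (fst (x, y) - t) * trig c n (snd (x, y)))" for x y
  proof -
    have "trig b m (x + 2 * pi - t) = trig b m (x - t)"
      using trig_periodic[of b m "x - t"] by (simp add: algebra_simps)
    then show ?thesis by (simp only: per fst_conv snd_conv)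
  qed
  have "(LINT z|torus. F (fst z + t, snd z) * (trig b m (fst z) * trig c n (snd z)))
      = (LINT z|torus. F z * (trig b m (fst z - t) * trig c n (snd z)))"
    using integral_torus_shift(2)[OF H perH, of t] by simp
  also have "\<dots> = cos (real m * t) * fourier_coeff F b c m n + (if b then -1 else 1) * sin (real m * t) * fourier_coeff F (\<not> b) c m n"
    unfolding eqH fourier_coeff_def using integrable_times_trig[OF F]
    by (subst Bochner_Integration.integral_add) auto
  finally show ?thesis .
qed

lemma diff1_terms:
  fixes h :: real
  assumes \<alpha>: "0 < \<alpha>" and F: "torus_fun F"
  defines "g \<equiv> (\<lambda>\<nu> z. diff_coeff \<alpha> \<nu> * F (fst z + (\<alpha> - real \<nu>) * h, snd z))"
  shows "integrable torus (g \<nu>)" "AE z in torus. summable (\<lambda>\<nu>. norm (g \<nu> z))"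
    "summable (\<lambda>\<nu>. LINT z|torus. norm (g \<nu> z))" "diff1 \<alpha> h F z = (\<Sum>\<nu>. g \<nu> z)"
proof -
  have iF: "integrable torus F" and per: "\<And>x y. F (x + 2 * pi, y) = F (x, y)" using F by (auto simp: torus_fun_def)
  show ig: "integrable torus (g \<nu>)" for \<nu>
    unfolding g_def using integral_torus_shift(1)[OF iF per] by auto
  have norm_g: "(LINT z|torus. norm (g \<nu> z)) = \<bar>diff_coeff \<alpha> \<nu>\<bar> * (LINT z|torus. \<bar>F z\<bar>)" for \<nu>
    unfolding g_def using integral_torus_shift(2)[of "\<lambda>z. \<bar>F z\<bar>"] iF by (simp add: abs_mult per)
  show sum: "summable (\<lambda>\<nu>. LINT z|torus. norm (g \<nu> z))"
    unfolding norm_g by (intro summable_mult2 summable_diff_coeff \<alpha>)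
  show "AE z in torus. summable (\<lambda>\<nu>. norm (g \<nu> z))"
  proof -
    have [measurable]: "g \<nu> \<in> borel_measurable torus" for \<nu> using borel_measurable_integrable[OF ig] .
    have "(\<integral>\<^sup>+z. (\<Sum>\<nu>. ennreal (norm (g \<nu> z))) \<partial>torus) = (\<Sum>\<nu>. \<integral>\<^sup>+z. ennreal (norm (g \<nu> z)) \<partial>torus)"
      by (rule nn_integral_suminf) auto
    also have "\<dots> = (\<Sum>\<nu>. ennreal (LINT z|torus. norm (g \<nu> z)))"
      by (intro suminf_cong nn_integral_eq_integral integrable_norm ig) auto
    also have "\<dots> \<noteq> \<infinity>" using sum by (simp add: ennreal_suminf_neq_top)
    finally have "AE z in torus. (\<Sum>\<nu>. ennreal (norm (g \<nu> z))) \<noteq> \<infinity>"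
      by (intro nn_integral_PInf_AE) auto
    then show ?thesis by eventually_elim (auto intro: summable_suminf_not_top)
  qed
  show "diff1 \<alpha> h F z = (\<Sum>\<nu>. g \<nu> z)"
    by (cases z) (simp add: diff1_def g_def diff_coeff_def)
qed

lemma torus_fun_diff1:
  assumes \<alpha>: "0 < \<alpha>" and F: "torus_fun F"
  shows "torus_fun (diff1 \<alpha> h F)"
proof -
  have per: "F (x + 2 * pi, y) = F (x, y)" "F (x, y + 2 * pi) = F (x, y)" for x y using F by (auto simp: torus_fun_def)
  have "integrable torus (\<lambda>z. diff1 \<alpha> h F z)"
    unfolding diff1_terms(4)[OF \<alpha> F] by (rule integrable_suminf[OF diff1_terms(1-3)[OF \<alpha> F]])
  moreover have "diff1 \<alpha> h F (x + 2 * pi, y) = diff1 \<alpha> h F (x, y)" for x y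
  proof -
    have "F (x + 2 * pi + u, y) = F (x + u, y)" for u using per(1)[of "x + u" y] by (simp add: add_ac)
    then show ?thesis by (simp add: diff1_def)
  qed
  moreover have "diff1 \<alpha> h F (x, y + 2 * pi) = diff1 \<alpha> h F (x, y)" for x y
    by (simp add: diff1_def per)
  ultimately show ?thesis by (simp add: torus_fun_def)
qed

text \<open>The difference acts on the coefficient pair of cosine and sine in \<open>x\<close> by the matrix with rows
  \<open>(X, Y)\<close> and \<open>(-Y, X)\<close>.\<close>

lemma fourier_coeff_diff1:
  fixes h :: real
  assumes \<alpha>: "0 < \<alpha>" and F: "torus_fun F"
  defines "X \<equiv> (\<lambda>m::nat. \<Sum>\<nu>. diff_coeff \<alpha> \<nu> * cos (real m * ((\<alpha> - real \<nu>) * h)))"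
    and "Y \<equiv> (\<lambda>m::nat. \<Sum>\<nu>. diff_coeff \<alpha> \<nu> * sin (real m * ((\<alpha> - real \<nu>) * h)))"
  shows "fourier_coeff (diff1 \<alpha> h F) b c m n
    = X m * fourier_coeff F b c m n + (if b then -1 else 1) * Y m * fourier_coeff F (\<not> b) c m n"
proof -
  define g where "g \<nu> z = diff_coeff \<alpha> \<nu> * F (fst z + (\<alpha> - real \<nu>) * h, snd z)" for \<nu> z
  define e where "e z = trig b m (fst z) * trig c n (snd z)" for z
  note T = diff1_terms[OF \<alpha> F, where h=h, folded g_def]
  have e1: "\<bar>e z\<bar> \<le> 1" for z by (simp add: e_def abs_mult mult_le_one abs_trig_le)
  have ige: "integrable torus (\<lambda>z. g \<nu> z * e z)" for \<nu>
    unfolding e_def by (rule integrable_times_trig[OF T(1)])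
  have le: "norm (g \<nu> z * e z) \<le> norm (g \<nu> z)" for \<nu> z
    using e1[of z] by (simp add: abs_mult mult_left_le)
  have ae: "AE z in torus. summable (\<lambda>\<nu>. norm (g \<nu> z * e z))"
    using T(2) by eventually_elim (rule summable_comparison_test'[where N=0], assumption, use le in auto)
  have su: "summable (\<lambda>\<nu>. LINT z|torus. norm (g \<nu> z * e z))"
  proof (rule summable_comparison_test'[OF T(3), where N=0])
    fix \<nu>
    have "(LINT z|torus. norm (g \<nu> z * e z)) \<le> (LINT z|torus. norm (g \<nu> z))"
      by (intro integral_mono le integrable_norm ige T(1))
    then show "norm (LINT z|torus. norm (g \<nu> z * e z)) \<le> (LINT z|torus. norm (g \<nu> z))" by simp
  qed
  have "(LINT z|torus. diff1 \<alpha> h F z * e z) = (LINT z|torus. (\<Sum>\<nu>. g \<nu> z * e z))"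
  proof (rule integral_cong_AE)
    show "(\<lambda>z. diff1 \<alpha> h F z * e z) \<in> borel_measurable torus"
      using integrable_times_trig[of "diff1 \<alpha> h F" b m c n] torus_fun_diff1[OF \<alpha> F, of h]
      by (simp add: e_def torus_fun_def)
    show "(\<lambda>z. \<Sum>\<nu>. g \<nu> z * e z) \<in> borel_measurable torus"
      using integrable_suminf[OF ige ae su] by simp
    show "AE z in torus. diff1 \<alpha> h F z * e z = (\<Sum>\<nu>. g \<nu> z * e z)"
      using T(2) by eventually_elim (simp add: T(4) suminf_mult2 summable_norm_cancel)
  qed
  also have "\<dots> = (\<Sum>\<nu>. LINT z|torus. g \<nu> z * e z)" by (rule integral_suminf[OF ige ae su])
  also have "\<dots> = (\<Sum>\<nu>. diff_coeff \<alpha> \<nu> * cos (real m * ((\<alpha> - real \<nu>) * h)) * fourier_coeff F b c m n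
      + diff_coeff \<alpha> \<nu> * sin (real m * ((\<alpha> - real \<nu>) * h)) * ((if b then -1 else 1) * fourier_coeff F (\<not> b) c m n))"
  proof (rule suminf_cong)
    fix \<nu>
    have "(LINT z|torus. g \<nu> z * e z) = diff_coeff \<alpha> \<nu> * (LINT z|torus. F (fst z + (\<alpha> - real \<nu>) * h, snd z) * (trig b m (fst z) * trig c n (snd z)))"
      by (simp add: g_def e_def mult.assoc)
    then show "(LINT z|torus. g \<nu> z * e z) = diff_coeff \<alpha> \<nu> * cos (real m * ((\<alpha> - real \<nu>) * h)) * fourier_coeff F b c m n
      + diff_coeff \<alpha> \<nu> * sin (real m * ((\<alpha> - real \<nu>) * h)) * ((if b then -1 else 1) * fourier_coeff F (\<not> b) c m n)"
      unfolding coeff_shift[OF F] by (simp add: algebra_simps)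
  qed
  also have "\<dots> = X m * fourier_coeff F b c m n + Y m * ((if b then -1 else 1) * fourier_coeff F (\<not> b) c m n)"
  proof -
    have sX: "summable (\<lambda>\<nu>. diff_coeff \<alpha> \<nu> * cos (real m * ((\<alpha> - real \<nu>) * h)))"
      and sY: "summable (\<lambda>\<nu>. diff_coeff \<alpha> \<nu> * sin (real m * ((\<alpha> - real \<nu>) * h)))"
      by (rule summable_comparison_test'[OF summable_diff_coeff[OF \<alpha>], where N=0]; simp add: abs_mult mult_left_le)+
    have "(\<Sum>\<nu>. diff_coeff \<alpha> \<nu> * cos (real m * ((\<alpha> - real \<nu>) * h)) * u
        + diff_coeff \<alpha> \<nu> * sin (real m * ((\<alpha> - real \<nu>) * h)) * v) = X m * u + Y m * v" for u v
      unfolding X_def Y_def suminf_mult2[OF sX] suminf_mult2[OF sY]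
      by (rule suminf_add[symmetric]; rule summable_mult2; rule sX sY)
    then show ?thesis .
  qed
  finally show ?thesis by (simp add: fourier_coeff_def e_def mult_ac)
qed

lemma amplitude_diff1:
  assumes \<alpha>: "0 < \<alpha>" and F: "torus_fun F"
  shows "amplitude (diff1 \<alpha> h F) m n = step_factor \<alpha> m h * amplitude F m n"
proof -
  define X where "X = (\<Sum>\<nu>. diff_coeff \<alpha> \<nu> * cos (real m * ((\<alpha> - real \<nu>) * h)))"
  define Y where "Y = (\<Sum>\<nu>. diff_coeff \<alpha> \<nu> * sin (real m * ((\<alpha> - real \<nu>) * h)))"
  have fc: "fourier_coeff (diff1 \<alpha> h F) b c m n
    = X * fourier_coeff F b c m n + (if b then -1 else 1) * Y * fourier_coeff F (\<not> b) c m n" for b c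
    unfolding X_def Y_def by (rule fourier_coeff_diff1[OF \<alpha> F])
  have "(\<Sum>b\<in>UNIV. \<Sum>c\<in>UNIV. (fourier_coeff (diff1 \<alpha> h F) b c m n)\<^sup>2)
      = (X\<^sup>2 + Y\<^sup>2) * (\<Sum>b\<in>UNIV. \<Sum>c\<in>UNIV. (fourier_coeff F b c m n)\<^sup>2)"
    unfolding fc by (simp add: UNIV_bool power2_eq_square algebra_simps)
  then have "amplitude (diff1 \<alpha> h F) m n = sqrt (X\<^sup>2 + Y\<^sup>2) * amplitude F m n"
    by (simp add: amplitude_def real_sqrt_mult)
  then show ?thesis using diff_multiplier[OF \<alpha>, of m h] by (simp add: X_def Y_def)
qed

lemma diff2_eq_swap: "diff2 \<alpha> h F = diff1 \<alpha> h (F \<circ> prod.swap) \<circ> prod.swap"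
  by (auto simp: diff1_def diff2_def fun_eq_iff)

lemma integral_torus_swap:
  fixes F :: "real \<times> real \<Rightarrow> real"
  assumes "integrable torus F"
  shows "integrable torus (F \<circ> prod.swap)" "(LINT z|torus. (F \<circ> prod.swap) z) = (LINT z|torus. F z)"
proof -
  have sw: "F \<circ> prod.swap = (\<lambda>(x, y). F (y, x))" by (auto simp: fun_eq_iff)
  show "integrable torus (F \<circ> prod.swap)" unfolding sw
    using circle_pair.integrable_product_swap[of F] assms by (simp add: torus_def)
  show "(LINT z|torus. (F \<circ> prod.swap) z) = (LINT z|torus. F z)" unfolding sw
    using circle_pair.integral_product_swap[of F] borel_measurable_integrable[OF assms] by (simp add: torus_def)
qed

lemma torus_fun_swap: "torus_fun F \<Longrightarrow> torus_fun (F \<circ> prod.swap)"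
  using integral_torus_swap(1) by (simp add: torus_fun_def)

lemma fourier_coeff_swap:
  assumes "integrable torus F"
  shows "fourier_coeff (F \<circ> prod.swap) b c m n = fourier_coeff F c b n m"
  using integral_torus_swap(2)[OF integrable_times_trig[OF assms, of c n b m]]
  by (simp add: fourier_coeff_def comp_def mult_ac)

lemma amplitude_swap:
  assumes "integrable torus F"
  shows "amplitude (F \<circ> prod.swap) m n = amplitude F n m"
  unfolding amplitude_def fourier_coeff_swap[OF assms] by (simp add: UNIV_bool add_ac)

lemma torus_fun_diff2:
  assumes "0 < \<alpha>" "torus_fun F"
  shows "torus_fun (diff2 \<alpha> h F)"
  unfolding diff2_eq_swap by (intro torus_fun_swap torus_fun_diff1 assms)

lemma amplitude_diff2:
  assumes \<alpha>: "0 < \<alpha>" and F: "torus_fun F"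
  shows "amplitude (diff2 \<alpha> h F) m n = step_factor \<alpha> n h * amplitude F m n"
proof -
  have "torus_fun (diff1 \<alpha> h (F \<circ> prod.swap))" by (intro torus_fun_diff1 torus_fun_swap \<alpha> F)
  then show ?thesis unfolding diff2_eq_swap
    using F by (simp add: amplitude_swap amplitude_diff1[OF \<alpha> torus_fun_swap] torus_fun_def)
qed

lemma amplitude_mixed_difference:
  assumes "0 < \<alpha>1" "0 < \<alpha>2" "torus_fun F"
  shows "amplitude (diff1 \<alpha>1 h1 (diff2 \<alpha>2 h2 F)) m n
    = step_factor \<alpha>1 m h1 * step_factor \<alpha>2 n h2 * amplitude F m n"
  using assms by (simp add: amplitude_diff1 amplitude_diff2 torus_fun_diff2)

lemma amplitude_eq_0_iff: "amplitude F m n = 0 \<longleftrightarrow> (\<forall>b c. fourier_coeff F b c m n = 0)"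
  unfolding amplitude_def by (simp add: UNIV_bool all_bool_eq add_nonneg_eq_0_iff) blast

section \<open>Averages of the multiplier over the step\<close>

text \<open>The size of \<open>step_factor \<beta> m h\<close> for steps of order \<open>1/n\<close>, in the mean.\<close>

abbreviation low_weight :: "real \<Rightarrow> nat \<Rightarrow> nat \<Rightarrow> real" where
  "low_weight \<beta> n m \<equiv> min 1 (real m / real n) powr \<beta>"

lemma sin_le_cubic:
  fixes x :: real
  assumes "0 \<le> x" "x \<le> 8/7"
  shows "sin x \<le> x - x ^ 3 / 8"
proof -
  have "\<bar>sin x - (\<Sum>m<5. sin_coeff m * x ^ m)\<bar> \<le> inverse (fact 5) * \<bar>x\<bar> ^ 5"
    by (rule Maclaurin_sin_bound)
  moreover have "(\<Sum>m<5. sin_coeff m * x ^ m) = x - x ^ 3 / 6"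
  proof -
    have "{..<5} = {0, 1, 2, 3, 4::nat}" by auto
    then show ?thesis by (simp add: sin_coeff_def fact_numeral)
  qed
  ultimately have "\<bar>sin x - (x - x ^ 3 / 6)\<bar> \<le> x ^ 5 / 120"
    using assms by (simp add: fact_numeral)
  then have "sin x \<le> x - x ^ 3 / 6 + x ^ 5 / 120"
    using abs_ge_self[of "sin x - (x - x ^ 3 / 6)"] by linarith
  moreover have "x ^ 5 \<le> x ^ 3 * (64/49)"
  proof -
    have "x\<^sup>2 \<le> (8/7)\<^sup>2" using assms by (intro power_mono) auto
    then have "x ^ 3 * x\<^sup>2 \<le> x ^ 3 * (64/49)" using assms by (intro mult_left_mono) (auto simp: power2_eq_square)
    then show ?thesis by (simp add: power_add[symmetric])
  qed
  moreover have "0 \<le> x ^ 3" using assms by simp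
  ultimately show ?thesis by linarith
qed

lemma sin_le_linear:
  fixes x :: real
  assumes "1 \<le> x"
  shows "sin x \<le> 7/8 * x"
proof (cases "x \<le> 8/7")
  case True
  have "x * 1 \<le> x * x\<^sup>2" using assms by (intro mult_left_mono) auto
  then have "x \<le> x ^ 3" by (simp add: power3_eq_cube power2_eq_square)
  then show ?thesis using sin_le_cubic[of x] assms True by simp
next
  case False
  then have "8/7 \<le> x" by simp
  then show ?thesis using sin_le_one[of x] by linarith
qed

text \<open>The mean over \<open>0 \<le> h \<le> 1/n\<close> of \<open>t = (sin (m h / 2) / \<mu>)\<^sup>2\<close> with \<open>\<mu> = min 1 (m/n)\<close> is at least 1/16 by an explicit
  integration. Since \<open>0 \<le> t \<le> 1\<close>, the linear minorant
  \<open>t powr (\<beta>/2) \<ge> (1/32) powr (\<beta>/2) * (t - 1/32)\<close> carries this over to all powers.\<close>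

lemma abs_sin_power_average:
  assumes \<beta>: "0 < \<beta>"
  shows "\<exists>c>0. \<forall>n\<ge>1. \<forall>m::nat. m \<ge> 1 \<longrightarrow>
    ennreal (c / real n * low_weight \<beta> n m)
      \<le> (\<integral>\<^sup>+h. ennreal (step_factor \<beta> m h) * indicator {0..1 / real n} h \<partial>lborel)"
proof -
  define c where "c = (2::real) powr \<beta> * ((1/32) powr (\<beta>/2) * (1/32))"
  have c: "0 < c" by (simp add: c_def)
  have "ennreal (c / real n * low_weight \<beta> n m)
      \<le> (\<integral>\<^sup>+h. ennreal (step_factor \<beta> m h) * indicator {0..1 / real n} h \<partial>lborel)"
    if n: "1 \<le> n" and m: "1 \<le> m" for n m :: nat
  proof -
    define N x where "N = real n" and "x = real m / real n"
    define \<mu> where "\<mu> = min 1 x"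
    have N: "1 \<le> N" using n by (simp add: N_def)
    have x: "0 < x" using n m by (simp add: x_def)
    have \<mu>: "0 < \<mu>" "\<mu> \<le> 1" "\<mu> \<le> x" using x by (auto simp: \<mu>_def)
    have xN: "real m = x * N" using n by (simp add: x_def N_def)
    define t where "t h = (sin (real m * h / 2) / \<mu>)\<^sup>2" for h
    have t1: "t h \<le> 1" if "h \<in> {0..1/N}" for h
    proof -
      have "\<bar>sin (real m * h / 2)\<bar> \<le> \<bar>real m * h / 2\<bar>" by (rule abs_sin_x_le_abs_x)
      also have "\<dots> \<le> x" 
      proof -
        have "N * h \<le> 1" using that N by (auto simp: field_simps)
        then have "x * (N * h) \<le> x * 1" using x by (intro mult_left_mono) auto
        moreover have "0 \<le> real m * h" using that by simp
        ultimately show ?thesis using x unfolding xN by (simp add: mult.assoc)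
      qed
      finally have "\<bar>sin (real m * h / 2)\<bar> \<le> \<mu>" by (simp add: \<mu>_def)
      then have "\<bar>sin (real m * h / 2) / \<mu>\<bar> \<le> 1" using \<mu> by (simp add: abs_divide)
      then show ?thesis unfolding t_def by (simp add: abs_square_le_1)
    qed
    have low: "2 powr \<beta> * \<mu> powr \<beta> * ((1/32) powr (\<beta>/2) * (t h - 1/32)) \<le> step_factor \<beta> m h"
      if h: "h \<in> {0..1/N}" for h
    proof -
      have "(1/32) powr (\<beta>/2) * (t h - 1/32) \<le> t h powr (\<beta>/2)"
      proof (cases "t h \<le> 1/32")
        case True
        then have "(1/32) powr (\<beta>/2) * (t h - 1/32) \<le> 0" by (simp add: mult_nonneg_nonpos)
        then show ?thesis by (rule order_trans) simp
      next
        case False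
        then have "(1/32) powr (\<beta>/2) * (t h - 1/32) \<le> (1/32) powr (\<beta>/2) * 1"
          using t1[OF h] by (intro mult_left_mono) auto
        also have "\<dots> \<le> t h powr (\<beta>/2)" using False \<beta> by (simp add: powr_mono2)
        finally show ?thesis .
      qed
      then have "2 powr \<beta> * \<mu> powr \<beta> * ((1/32) powr (\<beta>/2) * (t h - 1/32)) \<le> 2 powr \<beta> * \<mu> powr \<beta> * t h powr (\<beta>/2)"
        by (intro mult_left_mono) auto
      also have "t h powr (\<beta>/2) = \<bar>sin (real m * h / 2) / \<mu>\<bar> powr \<beta>"
      proof -
        have "t h = \<bar>sin (real m * h / 2) / \<mu>\<bar> powr 2" 
          by (cases "sin (real m * h / 2) = 0") (use \<mu> in \<open>auto simp: t_def powr_numeral power_divide\<close>)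
        then have "t h powr (\<beta>/2) = (\<bar>sin (real m * h / 2) / \<mu>\<bar> powr 2) powr (\<beta>/2)" by (rule arg_cong)
        also have "\<dots> = \<bar>sin (real m * h / 2) / \<mu>\<bar> powr (2 * (\<beta>/2))" by (rule powr_powr)
        finally show ?thesis by simp
      qed
      also have "2 powr \<beta> * \<mu> powr \<beta> * \<bar>sin (real m * h / 2) / \<mu>\<bar> powr \<beta> = step_factor \<beta> m h"
      proof -
        have "2 powr \<beta> * \<mu> powr \<beta> * \<bar>sin (real m * h / 2) / \<mu>\<bar> powr \<beta> = (2 * \<mu> * \<bar>sin (real m * h / 2) / \<mu>\<bar>) powr \<beta>"
          using \<mu> by (simp only: powr_mult)
        also have "2 * \<mu> * \<bar>sin (real m * h / 2) / \<mu>\<bar> = \<bar>2 * sin (real m * h / 2)\<bar>"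
          using \<mu> by (simp add: abs_mult abs_divide)
        finally show ?thesis .
      qed
      finally show ?thesis .
    qed
    have int_t: "((\<lambda>h. 2 powr \<beta> * \<mu> powr \<beta> * ((1/32) powr (\<beta>/2) * (t h - 1/32))) has_integral
       (2 powr \<beta> * \<mu> powr \<beta> * ((1/32) powr (\<beta>/2) * (((1 - sin x / x) / (2 * \<mu>\<^sup>2) - 1/32) / N)))) {0..1/N}"
    proof -
      define F where "F h = (h / 2 - sin (real m * h) / (2 * real m)) / \<mu>\<^sup>2 - h / 32" for h
      have "((\<lambda>h. t h - 1/32) has_integral (F (1/N) - F 0)) {0..1/N}"
      proof (rule fundamental_theorem_of_calculus)
        show "0 \<le> 1/N" using N by simp
        fix h
        have "(F has_real_derivative ((1 / 2 - cos (real m * h) / 2) / \<mu>\<^sup>2 - 1 / 32)) (at h within {0..1/N})"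
          unfolding F_def using m \<mu> by (auto intro!: derivative_eq_intros simp: field_simps)
        moreover have "(1 / 2 - cos (real m * h) / 2) / \<mu>\<^sup>2 = t h"
        proof -
          have "cos (real m * h) = 1 - 2 * (sin (real m * h / 2))\<^sup>2"
            using cos_double_sin[of "real m * h / 2"] by simp
          then have "1 / 2 - cos (real m * h) / 2 = (sin (real m * h / 2))\<^sup>2" by argo
          then show ?thesis by (simp only: t_def power_divide)
        qed
        ultimately show "(F has_vector_derivative t h - 1/32) (at h within {0..1/N})"
          by (simp add: has_real_derivative_iff_has_vector_derivative)
      qed
      moreover have "F (1/N) - F 0 = ((1 - sin x / x) / (2 * \<mu>\<^sup>2) - 1/32) / N"
      proof -
        have "real m * (1/N) = x" by (simp add: x_def N_def)
        moreover have "1/N / 2 - sin x / (2 * real m) = (1 - sin x / x) / (2 * N)"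
          unfolding xN using x N by (simp add: field_simps)
        ultimately show ?thesis unfolding F_def using N \<mu> by (simp add: field_simps)
      qed
      ultimately show ?thesis by (intro has_integral_mult_right) simp
    qed
    \<comment> \<open>The mean of \<open>sin\<^sup>2 (m h / 2)\<close> over the interval is \<open>(1 - sin x / x) / 2\<close> with \<open>x = m/n\<close>.\<close>
    have sinx: "1/8 * \<mu>\<^sup>2 \<le> 1 - sin x / x"
    proof -
      have "sin x \<le> x - x * (\<mu>\<^sup>2/8)"
      proof (cases "1 \<le> x")
        case True
        then show ?thesis using sin_le_linear[OF True] by (simp add: \<mu>_def)
      next
        case False
        then show ?thesis using sin_le_cubic[of x] x by (simp add: \<mu>_def power3_eq_cube power2_eq_square)
      qed
      then have "sin x / x \<le> (x - x * (\<mu>\<^sup>2/8)) / x" using x by (intro divide_right_mono) auto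
      also have "\<dots> = 1 - \<mu>\<^sup>2/8" using x by (simp add: field_simps)
      finally show ?thesis by simp
    qed
    have "c / N * \<mu> powr \<beta> = 2 powr \<beta> * \<mu> powr \<beta> * ((1/32) powr (\<beta>/2) * ((1/16 - 1/32) / N))"
      by (simp add: c_def)
    also have "\<dots> \<le> 2 powr \<beta> * \<mu> powr \<beta> * ((1/32) powr (\<beta>/2) * (((1 - sin x / x) / (2 * \<mu>\<^sup>2) - 1/32) / N))"
      using sinx \<mu> N by (intro mult_left_mono divide_right_mono diff_right_mono) (auto simp: field_simps)
    also have "\<dots> = integral {0..1/N} (\<lambda>h. 2 powr \<beta> * \<mu> powr \<beta> * ((1/32) powr (\<beta>/2) * (t h - 1/32)))"
      using int_t by (rule integral_unique[symmetric])
    also have "\<dots> \<le> integral {0..1/N} (\<lambda>h. step_factor \<beta> m h)"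
    proof (rule integral_le)
      show "(\<lambda>h. step_factor \<beta> m h) integrable_on {0..1/N}"
        by (intro integrable_continuous_real continuous_on_powr') (use \<beta> in \<open>auto intro!: continuous_intros\<close>)
    qed (use int_t low in auto)
    finally have le: "c / N * \<mu> powr \<beta> \<le> integral {0..1/N} (\<lambda>h. step_factor \<beta> m h)" .
    have "(\<integral>\<^sup>+h. ennreal (step_factor \<beta> m h) * indicator {0..1 / N} h \<partial>lborel)
       = ennreal (integral {0..1/N} (\<lambda>h. step_factor \<beta> m h))"
    proof -
      have "((\<lambda>h. if h \<in> {0..1/N} then step_factor \<beta> m h else 0) has_integral
          integral {0..1/N} (\<lambda>h. step_factor \<beta> m h)) UNIV"
        unfolding has_integral_restrict_UNIV
        by (intro integrable_integral integrable_continuous_real continuous_on_powr') (use \<beta> in \<open>auto intro!: continuous_intros\<close>)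
      from nn_integral_has_integral_lborel[OF _ _ this]
      have "(\<integral>\<^sup>+h. ennreal (if h \<in> {0..1/N} then step_factor \<beta> m h else 0) \<partial>lborel)
        = ennreal (integral {0..1/N} (\<lambda>h. step_factor \<beta> m h))" by auto
      moreover have "(\<integral>\<^sup>+h. ennreal (step_factor \<beta> m h) * indicator {0..1 / N} h \<partial>lborel)
        = (\<integral>\<^sup>+h. ennreal (if h \<in> {0..1/N} then step_factor \<beta> m h else 0) \<partial>lborel)"
        by (intro nn_integral_cong) (auto split: split_indicator)
      ultimately show ?thesis by simp
    qed
    then show ?thesis using le by (auto simp: N_def \<mu>_def x_def intro!: ennreal_leI)
  qed
  then show ?thesis using c by blast
qed

lemma abs_sin_power_le:
  assumes "0 < \<beta>" "1 \<le> n" "\<bar>h\<bar> \<le> 1 / real n"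
  shows "step_factor \<beta> m h \<le> 2 powr \<beta> * low_weight \<beta> n m"
proof -
  have "\<bar>sin (real m * h / 2)\<bar> \<le> \<bar>real m * h / 2\<bar>" by (rule abs_sin_x_le_abs_x)
  also have "\<dots> \<le> real m * \<bar>h\<bar>" by (simp add: abs_mult)
  also have "\<dots> \<le> real m * (1 / real n)" using assms by (intro mult_left_mono) auto
  finally have "\<bar>2 * sin (real m * h / 2)\<bar> \<le> 2 * min 1 (real m / real n)" by (simp add: abs_mult)
  then have "step_factor \<beta> m h \<le> (2 * min 1 (real m / real n)) powr \<beta>"
    using assms by (intro powr_mono2) auto
  then show ?thesis by (simp add: powr_mult)
qed

text \<open>A bound that is uniform in the step survives averaging over the step, which replaces the multiplier
  by its lower bound. The unaveraged index \<open>k\<close> allows the lemma to be used once per variable.\<close>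

lemma weighted_sum_average:
  assumes \<beta>: "0 < \<beta>"
  shows "\<exists>C>0. \<forall>n\<ge>1. \<forall>(A::nat \<Rightarrow> nat \<Rightarrow> ennreal) K.
     (\<forall>h\<in>{0..1 / real n}. (\<Sum>\<^sup>+k. \<Sum>\<^sup>+m. A k m * ennreal (step_factor \<beta> m h)) \<le> K) \<longrightarrow>
     (\<Sum>\<^sup>+k. \<Sum>\<^sup>+m. A k m * ennreal (low_weight \<beta> n m))
       \<le> ennreal C * K"
proof -
  obtain c where c: "0 < c" and avg: "\<And>n m::nat. 1 \<le> n \<Longrightarrow> 1 \<le> m \<Longrightarrow>
    ennreal (c / real n * low_weight \<beta> n m)
      \<le> (\<integral>\<^sup>+h. ennreal (step_factor \<beta> m h) * indicator {0..1 / real n} h \<partial>lborel)"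
    using abs_sin_power_average[OF \<beta>] by blast
  have "(\<Sum>\<^sup>+k. \<Sum>\<^sup>+m. A k m * ennreal (low_weight \<beta> n m))
       \<le> ennreal (1 / c) * K"
    if n: "1 \<le> n" and K: "\<forall>h\<in>{0..1 / real n}. (\<Sum>\<^sup>+k. \<Sum>\<^sup>+m. A k m * ennreal (step_factor \<beta> m h)) \<le> K" for n and A :: "nat \<Rightarrow> nat \<Rightarrow> ennreal" and K
  proof -
    let ?S = "\<lambda>m h. ennreal (step_factor \<beta> m h)"
    let ?I = "\<lambda>h. indicator {0..1 / real n} h :: ennreal"
    have meas: "(\<lambda>h. A k m * (?S m h * ?I h)) \<in> borel_measurable lborel" for k m by measurable
    have meas2: "(\<lambda>h. \<Sum>\<^sup>+m. A k m * (?S m h * ?I h)) \<in> borel_measurable lborel" for k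
    proof -
      have "(\<lambda>h. \<Sum>\<^sup>+m. A k m * (?S m h * ?I h))
        = (\<lambda>h. \<Sum>m. A k m * (?S m h * ?I h) * indicator {1..} m)"
        by (rule ext) (subst nn_integral_count_space_indicator, simp, rule nn_integral_count_space_nat)
      then show ?thesis using meas by simp
    qed
    have "ennreal (c / real n) * (\<Sum>\<^sup>+k. \<Sum>\<^sup>+m. A k m * ennreal (low_weight \<beta> n m))
      = (\<Sum>\<^sup>+k. \<Sum>\<^sup>+m. A k m * ennreal (c / real n * low_weight \<beta> n m))"
    proof -
      have "ennreal (c / real n * low_weight \<beta> n m) = ennreal (c / real n) * ennreal (low_weight \<beta> n m)" for m
        using c by (intro ennreal_mult) auto
      then show ?thesis by (simp add: nn_integral_cmult[symmetric] mult.left_commute)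
    qed
    also have "\<dots> \<le> (\<Sum>\<^sup>+k. \<Sum>\<^sup>+m. A k m * (\<integral>\<^sup>+h. ?S m h * ?I h \<partial>lborel))"
      by (intro nn_integral_mono mult_left_mono) (use avg[OF n] in auto)
    also have "\<dots> = (\<Sum>\<^sup>+k. \<Sum>\<^sup>+m. (\<integral>\<^sup>+h. A k m * (?S m h * ?I h) \<partial>lborel))"
      by (subst nn_integral_cmult) auto
    also have "\<dots> = (\<Sum>\<^sup>+k. \<integral>\<^sup>+h. (\<Sum>\<^sup>+m. A k m * (?S m h * ?I h)) \<partial>lborel)"
      by (intro nn_integral_cong nn_integral_count_space_nn_integral[symmetric]) (use meas in auto)
    also have "\<dots> = (\<integral>\<^sup>+h. \<Sum>\<^sup>+k. (\<Sum>\<^sup>+m. A k m * (?S m h * ?I h)) \<partial>lborel)"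
      by (rule nn_integral_count_space_nn_integral[symmetric]; rule meas2 countableI_type)
    also have "\<dots> = (\<integral>\<^sup>+h. (\<Sum>\<^sup>+k. \<Sum>\<^sup>+m. A k m * ?S m h) * ?I h \<partial>lborel)"
      by (simp add: nn_integral_multc[symmetric] mult.assoc)
    also have "\<dots> \<le> (\<integral>\<^sup>+h. K * ?I h \<partial>lborel)"
      using K by (intro nn_integral_mono) (auto split: split_indicator)
    also have "\<dots> = K * ennreal (1 / real n)"
      by (subst nn_integral_cmult) auto
    finally have le: "ennreal (c / real n) * (\<Sum>\<^sup>+k. \<Sum>\<^sup>+m. A k m * ennreal (low_weight \<beta> n m))
      \<le> K * ennreal (1 / real n)" .
    let ?X = "\<Sum>\<^sup>+k. \<Sum>\<^sup>+m. A k m * ennreal (low_weight \<beta> n m)"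
    have "?X = ennreal (real n / c * (c / real n)) * ?X" using c n by simp
    also have "\<dots> = ennreal (real n / c) * (ennreal (c / real n) * ?X)"
      using c n by (subst ennreal_mult) (auto simp: mult.assoc)
    also have "\<dots> \<le> ennreal (real n / c) * (K * ennreal (1 / real n))"
      by (rule mult_left_mono[OF le]) simp
    also have "\<dots> = ennreal (real n / c * (1 / real n)) * K"
      using c n by (subst ennreal_mult) (auto simp: mult_ac)
    also have "real n / c * (1 / real n) = 1 / c" using n by simp
    finally show ?thesis .
  qed
  then show ?thesis using c by (intro exI[of _ "1 / c"]) auto
qed

section \<open>The coefficient sum as a single weighted sum\<close>

lemma ennpow_ennreal: "0 \<le> a \<Longrightarrow> ennpow (ennreal a) r = ennreal (a powr r)"
  by (simp add: ennpow_def)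

lemma ennpow_mono:
  assumes "0 < r" "x \<le> y"
  shows "ennpow x r \<le> ennpow y r"
proof (cases y)
  case (real b)
  then obtain a where "x = ennreal a" "0 \<le> a" "a \<le> b" using assms(2) by (cases x) (auto simp: top_unique)
  then show ?thesis using real assms(1) by (auto simp: ennpow_ennreal intro!: ennreal_leI powr_mono2)
qed (simp add: ennpow_def)

lemma ennpow_cmult:
  assumes "0 < c" "0 < r"
  shows "ennpow (ennreal c * x) r = ennreal (c powr r) * ennpow x r"
proof (cases x)
  case (real a)
  then show ?thesis using assms by (simp add: ennreal_mult[symmetric] ennpow_ennreal powr_mult)
qed (use assms in \<open>simp add: ennpow_def ennreal_mult_top\<close>)

lemma ennpow_ennpow:
  assumes "0 < r" "0 < s" "r * s = 1"
  shows "ennpow (ennpow x r) s = x"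
  using assms by (cases x) (auto simp: ennpow_ennreal powr_powr, simp add: ennpow_def)

lemma ennpow_add_le:
  assumes "0 < r"
  shows "ennpow (x + y) r \<le> ennreal (2 powr r) * (ennpow x r + ennpow y r)"
proof -
  have "x + y \<le> max x y + max x y" by (intro add_mono) auto
  also have "\<dots> = ennreal 2 * max x y" by (simp add: mult_2)
  finally have "x + y \<le> ennreal 2 * max x y" .
  then have "ennpow (x + y) r \<le> ennreal (2 powr r) * ennpow (max x y) r"
    using ennpow_mono[OF assms] ennpow_cmult[of 2 r] assms by fastforce
  also have "ennpow (max x y) r \<le> ennpow x r + ennpow y r" by (simp add: max_def)
  finally show ?thesis by (simp add: mult_left_mono)
qed

lemma nn_integral_count_space_split:
  fixes f :: "nat \<Rightarrow> ennreal"
  shows "(\<Sum>\<^sup>+m. f m) = (\<Sum>m=1..N. f m) + (\<integral>\<^sup>+m. f m \<partial>count_space {N+1..})"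
proof -
  have "infsum f ({1..N} \<union> {N+1..}) = infsum f {1..N} + infsum f {N+1..}"
    by (rule infsum_Un_disjoint; (rule nonneg_summable_on_complete)?) auto
  moreover have "{1..N} \<union> {N+1..} = {1..}" by auto
  ultimately show ?thesis by (simp add: infsum_eq_nn_integral_count_space[symmetric])
qed

text \<open>The terms of the weighted sum comparable with \<open>\<I>(s)\<close>, for an arbitrary family \<open>R\<close> in place of
  \<open>\<rho>\<close>; it is used with \<open>R\<close> either \<open>\<rho>\<close> or the amplitude.\<close>

definition coeff_term :: "real \<Rightarrow> real \<Rightarrow> (nat \<Rightarrow> nat \<Rightarrow> real) \<Rightarrow> nat \<Rightarrow> nat \<Rightarrow> real \<Rightarrow> nat \<Rightarrow> nat \<Rightarrow> ennreal" where
  "coeff_term \<alpha>1 \<alpha>2 R n1 n2 s m n = ennreal (real m powr (s - 2) * real n powr (s - 2) * R m n powr s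
     * low_weight (\<alpha>1 * s) n1 m * low_weight (\<alpha>2 * s) n2 n)"

text \<open>The sum of these terms over all frequencies \<open>m, n \<ge> 1\<close>; its \<open>s\<close>-th root is comparable with \<open>\<I>(s)\<close>.\<close>

definition weighted_coeff_sum :: "real \<Rightarrow> real \<Rightarrow> (nat \<Rightarrow> nat \<Rightarrow> real) \<Rightarrow> nat \<Rightarrow> nat \<Rightarrow> real \<Rightarrow> ennreal" where
  "weighted_coeff_sum \<alpha>1 \<alpha>2 R n1 n2 s
    = (\<Sum>\<^sup>+m. \<Sum>\<^sup>+n. coeff_term \<alpha>1 \<alpha>2 R n1 n2 s m n)"

lemma weight_low:
  assumes "1 \<le> m" "m \<le> n1"
  shows "real m powr (s - 2) * low_weight (\<alpha> * s) n1 m = (1 / real n1 powr \<alpha>) powr s * real m powr ((\<alpha> + 1) * s - 2)"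
proof -
  have "min 1 (real m / real n1) = real m / real n1" using assms by (simp add: min_def)
  then have "real m powr (s - 2) * low_weight (\<alpha> * s) n1 m
    = (real m powr (s - 2) * real m powr (\<alpha> * s)) / real n1 powr (\<alpha> * s)"
    by (simp add: powr_divide)
  also have "real m powr (s - 2) * real m powr (\<alpha> * s) = real m powr ((\<alpha> + 1) * s - 2)"
    by (simp add: powr_add[symmetric] algebra_simps)
  also have "real m powr ((\<alpha> + 1) * s - 2) / real n1 powr (\<alpha> * s)
    = (1 / real n1 powr (\<alpha> * s)) * real m powr ((\<alpha> + 1) * s - 2)" by simp
  also have "1 / real n1 powr (\<alpha> * s) = (1 / real n1 powr \<alpha>) powr s"
    by (simp add: powr_divide powr_powr)
  finally show ?thesis .
qed

lemma weight_high:
  assumes "1 \<le> n1" "n1 < m"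
  shows "low_weight \<beta> n1 m = 1"
proof -
  have "min 1 (real m / real n1) = 1" using assms by (simp add: min_def)
  then show ?thesis by simp
qed

text \<open>On each of the four blocks every minimum is resolved, and the resulting powers of \<open>n1\<close> and \<open>n2\<close> come
  out of the \<open>s\<close>-th root, so that the identity is exact.\<close>

lemma coeff_sum_eq_blocks:
  fixes \<alpha>1 \<alpha>2 :: real and f :: "real \<times> real \<Rightarrow> real"
  assumes n: "1 \<le> n1" "1 \<le> n2" and s: "0 < s"
  defines "T \<equiv> coeff_term \<alpha>1 \<alpha>2 (rho f) n1 n2 s"
  shows "coeff_sum \<alpha>1 \<alpha>2 f n1 n2 s =
     ennpow (\<Sum>m=1..n1. \<Sum>n=1..n2. T m n) (1/s)
   + ennpow (\<Sum>m=1..n1. \<integral>\<^sup>+n. T m n \<partial>count_space {n2+1..}) (1/s)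
   + ennpow (\<integral>\<^sup>+m. (\<Sum>n=1..n2. T m n) \<partial>count_space {n1+1..}) (1/s)
   + ennpow (\<integral>\<^sup>+m. \<integral>\<^sup>+n. T m n \<partial>count_space {n2+1..} \<partial>count_space {n1+1..}) (1/s)"
proof -
  define c1 where "c1 = 1 / real n1 powr \<alpha>1"
  define c2 where "c2 = 1 / real n2 powr \<alpha>2"
  have c: "0 < c1" "0 < c2" using n by (auto simp: c1_def c2_def)
  have root: "ennpow (ennreal (c powr s) * x) (1/s) = ennreal c * ennpow x (1/s)" if "0 < c" for c x
    using that s by (subst ennpow_cmult) (auto simp: powr_powr)
  have T: "T m n = ennreal (rho f m n powr s * (real m powr (s - 2) * low_weight (\<alpha>1 * s) n1 m)
      * (real n powr (s - 2) * low_weight (\<alpha>2 * s) n2 n))" for m n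
    unfolding T_def coeff_term_def by (simp only: mult_ac)
  let ?X1 = "\<lambda>m n. ennreal (rho f m n powr s * real m powr ((\<alpha>1 + 1) * s - 2) * real n powr ((\<alpha>2 + 1) * s - 2))"
  let ?X2 = "\<lambda>m n. ennreal (rho f m n powr s * real m powr ((\<alpha>1 + 1) * s - 2) * real n powr (s - 2))"
  let ?X3 = "\<lambda>m n. ennreal (rho f m n powr s * real m powr (s - 2) * real n powr ((\<alpha>2 + 1) * s - 2))"
  let ?X4 = "\<lambda>m n. ennreal (rho f m n powr s * real (m * n) powr (s - 2))"
  have b1: "T m n = ennreal ((c1 * c2) powr s) * ?X1 m n"
    if "m \<in> {1..n1}" "n \<in> {1..n2}" for m n
    using that c unfolding T by (subst weight_low, simp, simp, subst weight_low, simp, simp)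
      (simp add: c1_def[symmetric] c2_def[symmetric] powr_mult ennreal_mult[symmetric] mult_ac)
  have b2: "T m n = ennreal (c1 powr s) * ?X2 m n"
    if "m \<in> {1..n1}" "n \<in> {n2+1..}" for m n
    using that c n unfolding T by (subst weight_low, simp, simp, subst weight_high, simp, simp)
      (simp add: c1_def[symmetric] ennreal_mult[symmetric] mult_ac)
  have b3: "T m n = ennreal (c2 powr s) * ?X3 m n"
    if "m \<in> {n1+1..}" "n \<in> {1..n2}" for m n
    using that c n unfolding T by (subst weight_high, simp, simp, subst weight_low, simp, simp)
      (simp add: c2_def[symmetric] ennreal_mult[symmetric] mult_ac)
  have b4: "T m n = ?X4 m n"
    if "m \<in> {n1+1..}" "n \<in> {n2+1..}" for m n
    using that n unfolding T by (subst weight_high, simp, simp, subst weight_high, simp, simp) (simp add: powr_mult mult_ac)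
  have cm: "(\<integral>\<^sup>+x. a * g x \<partial>count_space A) = a * (\<integral>\<^sup>+x. g x \<partial>count_space A)" for a and g :: "nat \<Rightarrow> ennreal" and A
    by (rule nn_integral_cmult) simp
  have "(\<Sum>m=1..n1. \<Sum>n=1..n2. T m n) = ennreal ((c1 * c2) powr s) * (\<Sum>m=1..n1. \<Sum>n=1..n2. ?X1 m n)"
    unfolding sum_distrib_left by (intro sum.cong refl b1)
  then have 1: "ennpow (\<Sum>m=1..n1. \<Sum>n=1..n2. T m n) (1/s) = ennreal (c1 * c2) * ennpow (\<Sum>m=1..n1. \<Sum>n=1..n2. ?X1 m n) (1/s)"
    using root[of "c1 * c2"] c by simp
  have "(\<Sum>m=1..n1. \<integral>\<^sup>+n. T m n \<partial>count_space {n2+1..}) = ennreal (c1 powr s) * (\<Sum>m=1..n1. \<integral>\<^sup>+n. ?X2 m n \<partial>count_space {n2+1..})"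
    unfolding sum_distrib_left cm[symmetric] by (intro sum.cong refl nn_integral_cong b2) auto
  then have 2: "ennpow (\<Sum>m=1..n1. \<integral>\<^sup>+n. T m n \<partial>count_space {n2+1..}) (1/s) = ennreal c1 * ennpow (\<Sum>m=1..n1. \<integral>\<^sup>+n. ?X2 m n \<partial>count_space {n2+1..}) (1/s)"
    using root[of c1] c by simp
  have "(\<integral>\<^sup>+m. (\<Sum>n=1..n2. T m n) \<partial>count_space {n1+1..}) = ennreal (c2 powr s) * (\<integral>\<^sup>+m. (\<Sum>n=1..n2. ?X3 m n) \<partial>count_space {n1+1..})"
    unfolding cm[symmetric] sum_distrib_left by (intro sum.cong refl nn_integral_cong b3) auto
  then have 3: "ennpow (\<integral>\<^sup>+m. (\<Sum>n=1..n2. T m n) \<partial>count_space {n1+1..}) (1/s) = ennreal c2 * ennpow (\<integral>\<^sup>+m. (\<Sum>n=1..n2. ?X3 m n) \<partial>count_space {n1+1..}) (1/s)"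
    using root[of c2] c by simp
  have 4: "(\<integral>\<^sup>+m. \<integral>\<^sup>+n. T m n \<partial>count_space {n2+1..} \<partial>count_space {n1+1..}) = (\<integral>\<^sup>+m. \<integral>\<^sup>+n. ?X4 m n \<partial>count_space {n2+1..} \<partial>count_space {n1+1..})"
    by (intro nn_integral_cong b4) auto
  show ?thesis
    unfolding coeff_sum_def infsum_eq_nn_integral_count_space 1 2 3 4 c1_def c2_def by (rule refl)
qed

lemma coeff_sum_le_weighted:
  assumes n: "1 \<le> n1" "1 \<le> n2" and s: "0 < s"
  shows "coeff_sum \<alpha>1 \<alpha>2 f n1 n2 s \<le> 4 * ennpow (weighted_coeff_sum \<alpha>1 \<alpha>2 (rho f) n1 n2 s) (1/s)"
    and "ennpow (weighted_coeff_sum \<alpha>1 \<alpha>2 (rho f) n1 n2 s) (1/s) \<le> ennreal (4 powr (1/s)) * coeff_sum \<alpha>1 \<alpha>2 f n1 n2 s"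
proof -
  define T where "T = coeff_term \<alpha>1 \<alpha>2 (rho f) n1 n2 s"
  define J1 where "J1 = (\<Sum>m=1..n1. \<Sum>n=1..n2. T m n)"
  define J2 where "J2 = (\<Sum>m=1..n1. \<integral>\<^sup>+n. T m n \<partial>count_space {n2+1..})"
  define J3 where "J3 = (\<integral>\<^sup>+m. (\<Sum>n=1..n2. T m n) \<partial>count_space {n1+1..})"
  define J4 where "J4 = (\<integral>\<^sup>+m. \<integral>\<^sup>+n. T m n \<partial>count_space {n2+1..} \<partial>count_space {n1+1..})"
  have J: "weighted_coeff_sum \<alpha>1 \<alpha>2 (rho f) n1 n2 s = (J1 + J2) + (J3 + J4)"
  proof -
    have "weighted_coeff_sum \<alpha>1 \<alpha>2 (rho f) n1 n2 s
      = (\<Sum>\<^sup>+m. ((\<Sum>n=1..n2. T m n) + (\<integral>\<^sup>+n. T m n \<partial>count_space {n2+1..})))"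
      unfolding weighted_coeff_sum_def T_def[symmetric] by (intro nn_integral_cong nn_integral_count_space_split)
    also have "\<dots> = (\<Sum>m=1..n1. (\<Sum>n=1..n2. T m n) + (\<integral>\<^sup>+n. T m n \<partial>count_space {n2+1..}))
      + (\<integral>\<^sup>+m. ((\<Sum>n=1..n2. T m n) + (\<integral>\<^sup>+n. T m n \<partial>count_space {n2+1..})) \<partial>count_space {n1+1..})"
      by (rule nn_integral_count_space_split)
    also have "\<dots> = (J1 + J2) + (J3 + J4)"
      unfolding sum.distrib J1_def J2_def J3_def J4_def by (subst nn_integral_add) simp_all
    finally show ?thesis .
  qed
  have C: "coeff_sum \<alpha>1 \<alpha>2 f n1 n2 s = (ennpow J1 (1/s) + ennpow J2 (1/s)) + (ennpow J3 (1/s) + ennpow J4 (1/s))"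
    unfolding coeff_sum_eq_blocks[OF n s] J1_def J2_def J3_def J4_def T_def by (simp only: add.assoc)
  have s': "0 < 1/s" using s by simp
  let ?W = "ennpow ((J1 + J2) + (J3 + J4)) (1/s)"
  have "coeff_sum \<alpha>1 \<alpha>2 f n1 n2 s \<le> (?W + ?W) + (?W + ?W)"
    unfolding C by (intro add_mono ennpow_mono s') (auto simp: add_increasing add_increasing2)
  also have "\<dots> = 4 * ?W" by (simp add: distrib_right[symmetric] flip: mult_2)
  finally show "coeff_sum \<alpha>1 \<alpha>2 f n1 n2 s \<le> 4 * ennpow (weighted_coeff_sum \<alpha>1 \<alpha>2 (rho f) n1 n2 s) (1/s)"
    unfolding J .
  have "?W \<le> ennreal (2 powr (1/s)) * (ennpow (J1 + J2) (1/s) + ennpow (J3 + J4) (1/s))"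
    by (rule ennpow_add_le[OF s'])
  also have "\<dots> \<le> ennreal (2 powr (1/s)) * (ennreal (2 powr (1/s)) * (ennpow J1 (1/s) + ennpow J2 (1/s))
      + ennreal (2 powr (1/s)) * (ennpow J3 (1/s) + ennpow J4 (1/s)))"
    by (intro mult_left_mono add_mono ennpow_add_le[OF s']) auto
  also have "\<dots> = ennreal (4 powr (1/s)) * coeff_sum \<alpha>1 \<alpha>2 f n1 n2 s"
  proof -
    have "ennreal (2 powr (1/s)) * ennreal (2 powr (1/s)) = ennreal (4 powr (1/s))"
      by (simp add: ennreal_mult[symmetric] powr_mult[symmetric])
    then show ?thesis unfolding C by (simp only: distrib_left[symmetric] mult.assoc[symmetric])
  qed
  finally show "ennpow (weighted_coeff_sum \<alpha>1 \<alpha>2 (rho f) n1 n2 s) (1/s) \<le> ennreal (4 powr (1/s)) * coeff_sum \<alpha>1 \<alpha>2 f n1 n2 s"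
    unfolding J .
qed

lemma weighted_coeff_sum_compare:
  assumes le: "\<And>m n. R m n \<le> c * R' m n" "\<And>m n. 0 \<le> R m n" "\<And>m n. 0 \<le> R' m n" and c: "0 < c" and s: "0 < s"
  shows "weighted_coeff_sum \<alpha>1 \<alpha>2 R n1 n2 s \<le> ennreal (c powr s) * weighted_coeff_sum \<alpha>1 \<alpha>2 R' n1 n2 s"
proof -
  have "coeff_term \<alpha>1 \<alpha>2 R n1 n2 s m n \<le> ennreal (c powr s) * coeff_term \<alpha>1 \<alpha>2 R' n1 n2 s m n" for m n
  proof -
    have "R m n powr s \<le> (c * R' m n) powr s" using le s by (intro powr_mono2) auto
    also have "\<dots> = c powr s * R' m n powr s" using le(3) c by (simp add: powr_mult)
    finally have "real m powr (s - 2) * real n powr (s - 2) * R m n powr s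
       * low_weight (\<alpha>1 * s) n1 m * low_weight (\<alpha>2 * s) n2 n
     \<le> real m powr (s - 2) * real n powr (s - 2) * (c powr s * R' m n powr s)
       * low_weight (\<alpha>1 * s) n1 m * low_weight (\<alpha>2 * s) n2 n"
      by (intro mult_right_mono mult_left_mono) auto
    then show ?thesis unfolding coeff_term_def by (simp add: ennreal_mult[symmetric] mult_ac ennreal_leI)
  qed
  then have "weighted_coeff_sum \<alpha>1 \<alpha>2 R n1 n2 s
     \<le> (\<Sum>\<^sup>+m. \<Sum>\<^sup>+n. ennreal (c powr s) * coeff_term \<alpha>1 \<alpha>2 R' n1 n2 s m n)"
    unfolding weighted_coeff_sum_def by (intro nn_integral_mono)
  also have "\<dots> = ennreal (c powr s) * weighted_coeff_sum \<alpha>1 \<alpha>2 R' n1 n2 s"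
    unfolding weighted_coeff_sum_def by (simp add: nn_integral_cmult)
  finally show ?thesis .
qed

section \<open>Borel representatives\<close>

lemma AE_lborel_shift:
  fixes c :: "real \<times> real"
  assumes "AE z in lborel. P z"
  shows "AE z in lborel. P (z + c)"
proof -
  obtain N where N: "N \<in> null_sets lborel" "{z. \<not> P z} \<subseteq> N"
    using assms by (auto elim!: AE_E simp: null_sets_def)
  have "AE z in lborel. z \<notin> N" using N(1) by (rule AE_not_in)
  then have "AE z in distr lborel borel ((+) c). z \<notin> N" unfolding lborel_distr_plus .
  then have "AE z in lborel. c + z \<notin> N"
    using N(1) by (subst (asm) AE_distr_iff) (auto simp: null_sets_def)
  then show ?thesis by eventually_elim (use N(2) in \<open>auto simp: add.commute\<close>)
qed

lemma AE_lborel_sections: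
  assumes "AE z in lborel. P (z :: real \<times> real)"
  shows "AE x in lborel. AE y in lborel. P (x, y)" "AE y in lborel. AE x in lborel. P (x, y)"
proof -
  obtain N where N: "N \<in> null_sets lborel" "{z. \<not> P z} \<subseteq> N"
    using assms by (auto elim!: AE_E simp: null_sets_def)
  have ae: "AE z in lborel \<Otimes>\<^sub>M lborel. z \<notin> N" unfolding lborel_prod using N(1) by (rule AE_not_in)
  have 1: "AE x in lborel. AE y in lborel. (x, y) \<notin> N" by (rule lborel_pair.AE_pair[OF ae])
  have "{z \<in> space (lborel \<Otimes>\<^sub>M lborel). (fst z, snd z) \<notin> N} \<in> sets (lborel \<Otimes>\<^sub>M lborel)"
  proof -
    have "{z \<in> space (lborel \<Otimes>\<^sub>M lborel). (fst z, snd z) \<notin> N} = space (lborel \<Otimes>\<^sub>M lborel) - N" by auto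
    moreover have "N \<in> sets (lborel \<Otimes>\<^sub>M lborel)" unfolding lborel_prod using N(1) by (rule null_setsD2)
    ultimately show ?thesis by (simp only: sets.compl_sets)
  qed
  from lborel_pair.AE_commute[OF this] 1
  have 2: "AE y in lborel. AE x in lborel. (x, y) \<notin> N" by simp
  show "AE x in lborel. AE y in lborel. P (x, y)"
    using 1 by eventually_elim (erule eventually_mono, use N(2) in auto)
  show "AE y in lborel. AE x in lborel. P (x, y)"
    using 2 by eventually_elim (erule eventually_mono, use N(2) in auto)
qed

text \<open>Completeness of Lebesgue measure: a function that agrees almost everywhere with a Borel function is
  Lebesgue measurable.\<close>

lemma borel_measurable_lebesgue_AE:
  fixes f g :: "'a::euclidean_space \<Rightarrow> real"
  assumes ae: "AE x in lborel. f x = g x" and g: "g \<in> borel_measurable borel"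
  shows "f \<in> borel_measurable lebesgue"
proof (rule measurableI)
  fix B :: "real set" assume B: "B \<in> sets borel"
  have 1: "{x. f x \<noteq> g x} \<in> sets lebesgue"
    using sets_completion_AE[where M=lborel and P="\<lambda>x. f x \<noteq> g x"] ae by (simp add: pred_def)
  have 2: "{x. f x \<noteq> g x \<and> f x \<in> B} \<in> sets lebesgue"
  proof -
    have "AE x in lborel. \<not> (f x \<noteq> g x \<and> f x \<in> B)" using ae by eventually_elim simp
    from sets_completion_AE[OF this] show ?thesis by (simp add: pred_def)
  qed
  have 3: "g -` B \<in> sets lebesgue"
    using measurable_sets[OF g B] by (auto intro: sets_completionI_sets)
  have "f -` B \<inter> space lebesgue = (g -` B - {x. f x \<noteq> g x}) \<union> {x. f x \<noteq> g x \<and> f x \<in> B}" by auto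
  then show "f -` B \<inter> space lebesgue \<in> sets lebesgue" using 1 2 3 by auto
qed simp

lemma Lp_norm_AE_torus:
  assumes ae: "AE z in lborel. g z = G z" and [measurable]: "G \<in> borel_measurable borel"
  shows "Lp_norm p g = ennpow (moment p G) (1 / p)"
proof -
  have "(\<integral>\<^sup>+z\<in>period_box. ennreal (\<bar>g z\<bar> powr p) \<partial>lebesgue) = (\<integral>\<^sup>+z\<in>period_box. ennreal (\<bar>g z\<bar> powr p) \<partial>lborel)"
    by (rule nn_integral_completion)
  also have "\<dots> = (\<integral>\<^sup>+z\<in>period_box. ennreal (\<bar>G z\<bar> powr p) \<partial>lborel)"
    by (rule nn_integral_cong_AE) (use ae in \<open>eventually_elim, simp\<close>)
  also have "\<dots> = (moment p G)"
    by (subst nn_integral_torus_lborel) auto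
  finally show ?thesis by (simp add: Lp_norm_def)
qed

lemma set_integral_lebesgue_eq_lborel:
  fixes f F :: "'a::euclidean_space \<Rightarrow> real"
  assumes ae: "AE x in lborel. f x = F x" and [measurable]: "F \<in> borel_measurable borel" "B \<in> sets borel"
  shows "(LINT x:B|lebesgue. f x) = (LINT x|lborel. indicator B x *\<^sub>R F x)"
proof -
  have ae': "AE x in lborel. indicator B x *\<^sub>R f x = indicator B x *\<^sub>R F x"
    using ae by eventually_elim simp
  have "(LINT x:B|lebesgue. f x) = (LINT x|lebesgue. indicator B x *\<^sub>R F x)"
    unfolding set_lebesgue_integral_def
  proof (rule integral_cong_AE)
    show "(\<lambda>x. indicator B x *\<^sub>R f x) \<in> borel_measurable lebesgue"
      by (rule borel_measurable_lebesgue_AE, rule ae') measurable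
    show "(\<lambda>x. indicator B x *\<^sub>R F x) \<in> borel_measurable lebesgue"
      by (rule measurable_completion) measurable
    show "AE x in lebesgue. indicator B x *\<^sub>R f x = indicator B x *\<^sub>R F x"
      using ae' by (rule AE_completion)
  qed
  also have "\<dots> = (LINT x|lborel. indicator B x *\<^sub>R F x)"
    by (rule integral_completion) measurable
  finally show ?thesis .
qed

lemma set_integral_period_box:
  fixes f F :: "real \<times> real \<Rightarrow> real"
  assumes ae: "AE z in lborel. f z = F z" and F: "F \<in> borel_measurable borel"
  shows "(LINT z:period_box|lebesgue. f z) = (LINT z|torus. F z)"
  unfolding set_integral_lebesgue_eq_lborel[OF ae F period_box_borel] torus_eq_density ennreal_indicator[symmetric]
  by (rule integral_density[symmetric]) (use F in auto)

lemma set_integral_circle: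
  fixes f F :: "real \<Rightarrow> real"
  assumes ae: "AE x in lborel. f x = F x" and F: "F \<in> borel_measurable borel"
  shows "(LINT x:{0..2*pi}|lebesgue. f x) = (LINT x|circle. F x)"
  unfolding set_integral_lebesgue_eq_lborel[OF ae F borel_closed[OF closed_atLeastAtMost]] circle_def ennreal_indicator[symmetric]
  by (rule integral_density[symmetric]) (use F in auto)

text \<open>The representative of a real number modulo \<open>2\<pi>\<close> in \<open>[0, 2\<pi>)\<close>.\<close>

definition reduce :: "real \<Rightarrow> real" where
  "reduce x = x - of_int \<lfloor>x / (2 * pi)\<rfloor> * (2 * pi)"

lemma reduce_periodic: "reduce (x + 2 * pi) = reduce x"
proof -
  have "(x + 2 * pi) / (2 * pi) = x / (2 * pi) + 1" by (simp add: add_divide_distrib)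
  then show ?thesis by (simp add: reduce_def algebra_simps)
qed

text \<open>Composing a Borel version of \<open>f\<close> with \<open>reduce\<close> makes it periodic everywhere. Only countably many
  translates of the exceptional null set are involved, so it still agrees with \<open>f\<close> almost everywhere.\<close>

lemma borel_periodic_representative:
  assumes f: "f \<in> borel_measurable lebesgue"
    and per: "\<And>x y. f (x + 2*pi, y) = f (x, y) \<and> f (x, y + 2*pi) = f (x, y)"
  shows "\<exists>F\<in>borel_measurable borel. (\<forall>x y. F (x + 2*pi, y) = F (x, y) \<and> F (x, y + 2*pi) = F (x, y))
    \<and> (AE z in lborel. f z = (F z :: real))"
proof -
  obtain g where g: "g \<in> borel_measurable lborel" and fg: "AE z in lborel. f z = g z"
    using completion_ex_borel_measurable_real[OF f] by blast
  define F where "F z = g (reduce (fst z), reduce (snd z))" for z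
  have red [measurable]: "reduce \<in> borel_measurable borel" unfolding reduce_def[abs_def] by measurable
  have "(\<lambda>z::real \<times> real. (reduce (fst z), reduce (snd z))) \<in> borel_measurable borel"
    unfolding borel_prod[symmetric] by measurable
  moreover have "g \<in> borel_measurable borel" using g by simp
  ultimately have F: "F \<in> borel_measurable borel" unfolding F_def[abs_def] by (rule measurable_compose)
  have shift: "f (x + of_int k * (2*pi), y + of_int l * (2*pi)) = f (x, y)" for x y k l
  proof -
    interpret X: periodic_fun_simple "\<lambda>x. f (x, y)" "2*pi" for y by standard (simp add: per)
    interpret Y: periodic_fun_simple "\<lambda>y. f (x, y)" "2*pi" for x by standard (simp add: per)
    show ?thesis using X.plus_of_int Y.plus_of_int by simp
  qed
  have "AE z in lborel. \<forall>k l::int. f (z + (of_int k * (2*pi), of_int l * (2*pi))) = g (z + (of_int k * (2*pi), of_int l * (2*pi)))"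
    unfolding AE_all_countable by (intro allI AE_lborel_shift[OF fg])
  then have "AE z in lborel. f z = F z"
  proof eventually_elim
    case (elim z)
    define k where "k = - \<lfloor>fst z / (2 * pi)\<rfloor>"
    define l where "l = - \<lfloor>snd z / (2 * pi)\<rfloor>"
    have eq: "z + (of_int k * (2*pi), of_int l * (2*pi)) = (reduce (fst z), reduce (snd z))"
      by (cases z) (simp add: k_def l_def reduce_def)
    have "F z = f (z + (of_int k * (2*pi), of_int l * (2*pi)))"
      using elim[rule_format, of k l] unfolding F_def eq by simp
    also have "\<dots> = f z" using shift[of "fst z" k "snd z" l] by (cases z) simp
    finally show ?case by simp
  qed
  then show ?thesis using F by (intro bexI[of _ F]) (auto simp: F_def reduce_periodic)
qed

lemma AE_diff1:
  assumes "AE z in lborel. f z = g z"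
  shows "AE z in lborel. diff1 \<alpha> h f z = diff1 \<alpha> h g z"
proof -
  have "AE z in lborel. \<forall>\<nu>::nat. f (z + ((\<alpha> - real \<nu>) * h, 0)) = g (z + ((\<alpha> - real \<nu>) * h, 0))"
    unfolding AE_all_countable by (intro allI AE_lborel_shift[OF assms])
  then show ?thesis by eventually_elim (auto simp: diff1_def split: prod.split)
qed

lemma AE_diff2:
  assumes "AE z in lborel. f z = g z"
  shows "AE z in lborel. diff2 \<alpha> h f z = diff2 \<alpha> h g z"
proof -
  have "AE z in lborel. \<forall>\<nu>::nat. f (z + (0, (\<alpha> - real \<nu>) * h)) = g (z + (0, (\<alpha> - real \<nu>) * h))"
    unfolding AE_all_countable by (intro allI AE_lborel_shift[OF assms])
  then show ?thesis by eventually_elim (auto simp: diff2_def split: prod.split)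
qed

text \<open>Everything in the statement depends on \<open>f\<close> only up to null sets, and may be expressed by a Borel
  function \<open>F\<close>. The two conditions on the marginals of \<open>f\<close> say that \<open>F\<close> has no frequencies on the axes.\<close>

lemma Lp0_torus_representative:
  assumes p: "1 < p" and f: "f \<in> Lp0_torus p"
  obtains F where "torus_fun F" "AE z in lborel. f z = F z"
    "\<And>b c m n. m = 0 \<or> n = 0 \<Longrightarrow> fourier_coeff F b c m n = 0"
    "\<And>m n. rho f m n = (\<Sum>b\<in>UNIV. \<Sum>c\<in>UNIV. \<bar>fourier_coeff F b c m n\<bar>) / pi\<^sup>2"
proof -
  have fm: "f \<in> borel_measurable lebesgue"
    and per: "\<And>x y. f (x + 2*pi, y) = f (x, y) \<and> f (x, y + 2*pi) = f (x, y)"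
    and fin: "Lp_norm p f < \<infinity>"
    and zx: "AE x in lborel. (LINT y:{0..2*pi}|lebesgue. f (x, y)) = 0"
    and zy: "AE y in lborel. (LINT x:{0..2*pi}|lebesgue. f (x, y)) = 0"
    using f by (auto simp: Lp0_torus_def Lp_torus_def AE_completion_iff)
  obtain F where F [measurable]: "F \<in> borel_measurable borel"
    and perF: "\<forall>x y. F (x + 2*pi, y) = F (x, y) \<and> F (x, y + 2*pi) = F (x, y)"
    and ae: "AE z in lborel. f z = F z"
    using borel_periodic_representative[OF fm per] by blast
  have [measurable]: "F \<in> borel_measurable (borel \<Otimes>\<^sub>M borel)" by (simp add: borel_prod)
  have iF: "integrable torus F"
  proof (rule integrableI_bounded)
    show "F \<in> borel_measurable torus" by simp
    have fin': "(moment p F) \<noteq> \<infinity>"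
      using fin unfolding Lp_norm_AE_torus[OF ae F] ennpow_def by (auto split: if_splits)
    have "(\<integral>\<^sup>+z. ennreal (norm (F z)) \<partial>torus) \<le> (\<integral>\<^sup>+z. 1 + ennreal (\<bar>F z\<bar> powr p) \<partial>torus)"
    proof (rule nn_integral_mono)
      fix z
      have "\<bar>F z\<bar> \<le> 1 + \<bar>F z\<bar> powr p"
      proof (cases "\<bar>F z\<bar> \<le> 1")
        case False
        then have "\<bar>F z\<bar> powr 1 \<le> \<bar>F z\<bar> powr p" using p by (intro powr_mono) auto
        then show ?thesis using False by simp
      qed (simp add: add_increasing2)
      then have "ennreal (norm (F z)) \<le> ennreal (1 + \<bar>F z\<bar> powr p)" by (intro ennreal_leI) simp
      then show "ennreal (norm (F z)) \<le> 1 + ennreal (\<bar>F z\<bar> powr p)" by (simp add: ennreal_plus)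
    qed
    also have "\<dots> = emeasure torus UNIV + (moment p F)"
      by (subst nn_integral_add) auto
    also have "\<dots> < \<infinity>" using fin' by (simp add: less_top[symmetric])
    finally show "(\<integral>\<^sup>+z. ennreal (norm (F z)) \<partial>torus) < \<infinity>" .
  qed
  have tF: "torus_fun F" using iF perF by (simp add: torus_fun_def)
  have iF2: "integrable (circle \<Otimes>\<^sub>M circle) (\<lambda>(x, y). F (x, y) * (trig b m x * trig c n y))" for b c m n
    using integrable_times_trig[OF iF, of b m c n] by (simp add: torus_def case_prod_unfold)
  have sx: "AE x in circle. (LINT y|circle. F (x, y)) = 0"
  proof (rule AE_circle)
    show "AE x in lborel. (LINT y|circle. F (x, y)) = 0"
      using AE_lborel_sections(1)[OF ae] zx
    proof eventually_elim
      case (elim x)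
      show ?case using set_integral_circle[OF elim(1)] elim(2) by simp
    qed
  qed
  have sy: "AE y in circle. (LINT x|circle. F (x, y)) = 0"
  proof (rule AE_circle)
    show "AE y in lborel. (LINT x|circle. F (x, y)) = 0"
      using AE_lborel_sections(2)[OF ae] zy
    proof eventually_elim
      case (elim y)
      show ?case using set_integral_circle[OF elim(1)] elim(2) by simp
    qed
  qed
  have axis1: "fourier_coeff F b c 0 n = 0" for b c n
  proof (cases b)
    case True
    then show ?thesis by (simp add: fourier_coeff_def trig_def)
  next
    case False
    have "fourier_coeff F b c 0 n = (LINT y|circle. LINT x|circle. F (x, y) * (trig b 0 x * trig c n y))"
      using circle_pair.integral_snd[OF iF2] by (simp add: fourier_coeff_def torus_def case_prod_unfold)
    also have "\<dots> = (LINT y|circle. (LINT x|circle. F (x, y)) * trig c n y)"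
      using False by (simp add: trig_def)
    also have "\<dots> = (LINT y|circle. 0)"
      by (rule integral_cong_AE) (measurable, use sy in \<open>eventually_elim, simp\<close>)
    finally show ?thesis by simp
  qed
  have axis2: "fourier_coeff F b c m 0 = 0" for b c m
  proof (cases c)
    case True
    then show ?thesis by (simp add: fourier_coeff_def trig_def)
  next
    case False
    have "fourier_coeff F b c m 0 = (LINT x|circle. LINT y|circle. F (x, y) * (trig b m x * trig c 0 y))"
      using circle_pair.integral_fst[OF iF2] by (simp add: fourier_coeff_def torus_def case_prod_unfold)
    also have "\<dots> = (LINT x|circle. (LINT y|circle. F (x, y)) * trig b m x)"
      using False by (simp add: trig_def)
    also have "\<dots> = (LINT x|circle. 0)"
      by (rule integral_cong_AE) (measurable, use sx in \<open>eventually_elim, simp\<close>)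
    finally show ?thesis by simp
  qed
  have coeff: "(LINT z:period_box|lebesgue. f z * (trig b m (fst z) * trig c n (snd z))) = fourier_coeff F b c m n" for b c m n
    unfolding fourier_coeff_def
    by (rule set_integral_period_box) (use ae in \<open>eventually_elim, simp\<close>, measurable)
  have co: "coeff_a f m n = fourier_coeff F False False m n / pi\<^sup>2" "coeff_b f m n = fourier_coeff F True False m n / pi\<^sup>2"
    "coeff_c f m n = fourier_coeff F False True m n / pi\<^sup>2" "coeff_d f m n = fourier_coeff F True True m n / pi\<^sup>2" for m n
    unfolding coeff_a_def coeff_b_def coeff_c_def coeff_d_def coeff[symmetric]
    by (simp_all add: trig_def case_prod_unfold mult.assoc)
  have "rho f m n = (\<Sum>b\<in>UNIV. \<Sum>c\<in>UNIV. \<bar>fourier_coeff F b c m n\<bar>) / pi\<^sup>2" for m n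
    unfolding rho_def co by (simp add: UNIV_bool abs_divide add_divide_distrib)
  then show ?thesis using tF ae axis1 axis2 by (intro that) auto
qed

section \<open>Two-sided estimates for the mixed modulus\<close>

text \<open>The \<open>L\<^sub>p\<close> norm over the torus, for Borel functions.\<close>

definition torus_norm :: "real \<Rightarrow> (real \<times> real \<Rightarrow> real) \<Rightarrow> ennreal" where
  "torus_norm p G = ennpow (moment p G) (1 / p)"

text \<open>Norm monotonicity in the exponent on a finite measure space, from \<open>t powr r \<le> 1 + t powr s\<close> applied to
  \<open>\<bar>G\<bar>\<close> divided by its norm.\<close>

lemma torus_norm_mono_exponent:
  assumes r: "0 < r" "r \<le> s"
  shows "\<exists>K>0. \<forall>G\<in>borel_measurable borel. torus_norm r G \<le> ennreal K * torus_norm s G"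
proof -
  define \<mu> where "\<mu> = measure torus UNIV"
  have \<mu>: "0 \<le> \<mu>" "emeasure torus UNIV = ennreal \<mu>"
    by (auto simp: \<mu>_def torus.emeasure_eq_measure)
  define K where "K = (\<mu> + 1) powr (1/r)"
  have K: "0 < K" using \<mu> by (simp add: K_def)
  have "torus_norm r G \<le> ennreal K * torus_norm s G" if [measurable]: "G \<in> borel_measurable borel" for G
  proof (cases "\<integral>\<^sup>+z. ennreal (\<bar>G z\<bar> powr s) \<partial>torus")
    case top
    then show ?thesis using K by (simp add: torus_norm_def ennpow_def ennreal_mult_top)
  next
    case (real I)
    show ?thesis
    proof (cases "I = 0")
      case True
      then have "(moment s G) = 0" using real by simp
      then have "AE z in torus. ennreal (\<bar>G z\<bar> powr s) = 0"
        by (subst (asm) nn_integral_0_iff_AE) auto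
      then have "(moment r G) = (\<integral>\<^sup>+z. 0 \<partial>torus)"
        by (intro nn_integral_cong_AE) (auto elim!: eventually_mono)
      then show ?thesis using r by (simp add: torus_norm_def ennpow_def)
    next
      case False
      then have I: "0 < I" using real by simp
      define A where "A = I powr (1/s)"
      have A: "0 < A" "A powr s = I" using I r by (auto simp: A_def powr_powr)
      have pt: "\<bar>G z\<bar> powr r \<le> A powr r * (1 + \<bar>G z\<bar> powr s / I)" for z
      proof -
        define t where "t = \<bar>G z\<bar> / A"
        have t: "0 \<le> t" using A by (simp add: t_def)
        have "t powr r \<le> 1 + t powr s"
        proof (cases "t \<le> 1")
          case True
          then have "t powr r \<le> 1" using t r by (simp add: powr_le1)
          then show ?thesis by (simp add: add_increasing2)
        next
          case False
          then have "t powr r \<le> t powr s" using r by (intro powr_mono) auto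
          then show ?thesis by simp
        qed
        then have "A powr r * t powr r \<le> A powr r * (1 + t powr s)" by (rule mult_left_mono) simp
        moreover have "A powr r * t powr r = \<bar>G z\<bar> powr r"
          using A by (simp add: t_def powr_divide)
        moreover have "t powr s = \<bar>G z\<bar> powr s / I" using A by (simp add: t_def powr_divide)
        ultimately show ?thesis by simp
      qed
      have "(moment r G)
        \<le> (\<integral>\<^sup>+z. ennreal (A powr r) * (1 + ennreal (1 / I) * ennreal (\<bar>G z\<bar> powr s)) \<partial>torus)"
      proof (rule nn_integral_mono)
        fix z
        have "ennreal (A powr r) * (1 + ennreal (1 / I) * ennreal (\<bar>G z\<bar> powr s)) = ennreal (A powr r * (1 + \<bar>G z\<bar> powr s / I))"
          using I by (simp add: ennreal_mult[symmetric] ennreal_plus[symmetric] del: ennreal_plus flip: ennreal_1)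
        then show "ennreal (\<bar>G z\<bar> powr r) \<le> ennreal (A powr r) * (1 + ennreal (1 / I) * ennreal (\<bar>G z\<bar> powr s))"
          using pt[of z] by (simp add: ennreal_leI)
      qed
      also have "\<dots> = ennreal (A powr r) * (ennreal \<mu> + ennreal (1 / I) * ennreal I)"
        by (subst nn_integral_cmult, measurable, subst nn_integral_add, measurable, subst nn_integral_cmult, measurable)
          (simp add: \<mu>(2) real)
      also have "\<dots> = ennreal (A powr r * (\<mu> + 1))"
        using I \<mu> by (simp add: ennreal_mult[symmetric] ennreal_plus[symmetric] del: ennreal_plus flip: ennreal_1)
      finally have "torus_norm r G \<le> ennpow (ennreal (A powr r * (\<mu> + 1))) (1/r)"
        unfolding torus_norm_def using r by (intro ennpow_mono) auto
      also have "\<dots> = ennreal (K * A)"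
        using r \<mu> A by (simp add: ennpow_ennreal powr_mult powr_powr K_def mult.commute)
      also have "\<dots> = ennreal K * torus_norm s G"
        using real K A by (simp add: torus_norm_def ennpow_ennreal A_def ennreal_mult)
      finally show ?thesis .
    qed
  qed
  then show ?thesis using K by blast
qed

text \<open>The upper estimate for a single pair of steps: the dual Paley inequality together with
  \<open>\<bar>2 sin (m h / 2)\<bar> \<le> 2 * min 1 (m/n)\<close> for \<open>\<bar>h\<bar> \<le> 1/n\<close>.\<close>

lemma difference_norm_upper:
  assumes s: "2 \<le> s" and \<alpha>: "0 < \<alpha>1" "0 < \<alpha>2"
  shows "\<exists>C>0. \<forall>F n1 n2 h1 h2. torus_fun F \<longrightarrow> (\<forall>b c m n. m = 0 \<or> n = 0 \<longrightarrow> fourier_coeff F b c m n = 0) \<longrightarrow>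
    1 \<le> n1 \<longrightarrow> 1 \<le> n2 \<longrightarrow> \<bar>h1\<bar> \<le> 1 / real n1 \<longrightarrow> \<bar>h2\<bar> \<le> 1 / real n2 \<longrightarrow>
    (moment s (diff1 \<alpha>1 h1 (diff2 \<alpha>2 h2 F)))
      \<le> ennreal C * weighted_coeff_sum \<alpha>1 \<alpha>2 (amplitude F) n1 n2 s"
proof -
  define Q where "Q C \<longleftrightarrow> (\<forall>F. integrable torus F \<longrightarrow> (\<forall>b c m n. m = 0 \<or> n = 0 \<longrightarrow> fourier_coeff F b c m n = 0) \<longrightarrow>
    (moment s F)
    \<le> ennreal C * (amplitude_sum s F))" for C
  obtain C where C: "0 < C" and "Q C" using dual_paley_torus[OF s] unfolding Q_def[symmetric] by blast
  note dual = \<open>Q C\<close>[unfolded Q_def, rule_format]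
  define D where "D = 2 powr (\<alpha>1 * s) * 2 powr (\<alpha>2 * s)"
  have D: "0 < D" by (simp add: D_def)
  show ?thesis
  proof (intro exI[of _ "C * D"] conjI allI impI)
    show "0 < C * D" using C D by simp
    fix F :: "real \<times> real \<Rightarrow> real" and n1 n2 :: nat and h1 h2 :: real
    assume F: "torus_fun F" and axes: "\<forall>b c m n. m = 0 \<or> n = 0 \<longrightarrow> fourier_coeff F b c m n = 0"
      and n: "1 \<le> n1" "1 \<le> n2" and h: "\<bar>h1\<bar> \<le> 1 / real n1" "\<bar>h2\<bar> \<le> 1 / real n2"
    define G where "G = diff1 \<alpha>1 h1 (diff2 \<alpha>2 h2 F)"
    have G: "integrable torus G"
      using torus_fun_diff1[OF \<alpha>(1) torus_fun_diff2[OF \<alpha>(2) F]] by (simp add: torus_fun_def G_def)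
    have amp: "amplitude G m n = step_factor \<alpha>1 m h1 * step_factor \<alpha>2 n h2 * amplitude F m n" for m n
      unfolding G_def by (rule amplitude_mixed_difference[OF \<alpha> F])
    have axesG: "fourier_coeff G b c m n = 0" if "m = 0 \<or> n = 0" for b c m n
    proof -
      have "amplitude F m n = 0" unfolding amplitude_eq_0_iff using axes that by blast
      then have "amplitude G m n = 0" by (simp add: amp)
      then show ?thesis by (simp add: amplitude_eq_0_iff)
    qed
    have "(moment s G)
      \<le> ennreal C * (amplitude_sum s G)"
      by (rule dual[OF G axesG])
    also have "\<dots> \<le> ennreal C * (\<Sum>\<^sup>+m. \<Sum>\<^sup>+n. ennreal D * coeff_term \<alpha>1 \<alpha>2 (amplitude F) n1 n2 s m n)"
    proof (intro mult_left_mono nn_integral_mono)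
      fix m n
      have s0: "0 < \<alpha>1 * s" "0 < \<alpha>2 * s" using s \<alpha> by auto
      have "amplitude G m n powr s = step_factor (\<alpha>1 * s) m h1 * step_factor (\<alpha>2 * s) n h2 * amplitude F m n powr s"
        unfolding amp using amplitude_nonneg[of F m n] by (simp add: powr_mult powr_powr)
      also have "\<dots> \<le> (2 powr (\<alpha>1 * s) * low_weight (\<alpha>1 * s) n1 m) * (2 powr (\<alpha>2 * s) * low_weight (\<alpha>2 * s) n2 n) * amplitude F m n powr s"
        by (intro mult_right_mono mult_mono abs_sin_power_le s0 n h) auto
      finally have "real m powr (s - 2) * real n powr (s - 2) * amplitude G m n powr s
        \<le> real m powr (s - 2) * real n powr (s - 2) * ((2 powr (\<alpha>1 * s) * low_weight (\<alpha>1 * s) n1 m) * (2 powr (\<alpha>2 * s) * low_weight (\<alpha>2 * s) n2 n) * amplitude F m n powr s)"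
        by (intro mult_left_mono) auto
      also have "\<dots> = D * (real m powr (s - 2) * real n powr (s - 2) * amplitude F m n powr s
         * low_weight (\<alpha>1 * s) n1 m * low_weight (\<alpha>2 * s) n2 n)"
        by (simp only: D_def mult_ac)
      finally show "ennreal (real m powr (s - 2) * real n powr (s - 2) * amplitude G m n powr s)
        \<le> ennreal D * coeff_term \<alpha>1 \<alpha>2 (amplitude F) n1 n2 s m n"
        unfolding coeff_term_def using D by (simp add: ennreal_mult[symmetric] ennreal_leI)
    qed simp
    also have "\<dots> = ennreal (C * D) * weighted_coeff_sum \<alpha>1 \<alpha>2 (amplitude F) n1 n2 s"
      using C D by (simp add: nn_integral_cmult weighted_coeff_sum_def ennreal_mult mult.assoc)
    finally show "(moment s (diff1 \<alpha>1 h1 (diff2 \<alpha>2 h2 F)))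
      \<le> ennreal (C * D) * weighted_coeff_sum \<alpha>1 \<alpha>2 (amplitude F) n1 n2 s"
      unfolding G_def .
  qed
qed

text \<open>The lower estimate: if all mixed differences with admissible nonnegative steps have \<open>s\<close>-th moment at
  most \<open>K\<close>, then Paley's inequality bounds a sum that contains the multipliers of both steps; these are
  replaced by their averages first in \<open>h2\<close>, then in \<open>h1\<close>.\<close>

lemma difference_norm_lower:
  assumes s: "1 < s" "s \<le> 2" and \<alpha>: "0 < \<alpha>1" "0 < \<alpha>2"
  shows "\<exists>C>0. \<forall>F n1 n2 K. torus_fun F \<longrightarrow> 1 \<le> n1 \<longrightarrow> 1 \<le> n2 \<longrightarrow>
    (\<forall>h1\<in>{0..1 / real n1}. \<forall>h2\<in>{0..1 / real n2}.
       (moment s (diff1 \<alpha>1 h1 (diff2 \<alpha>2 h2 F))) \<le> K) \<longrightarrow>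
    weighted_coeff_sum \<alpha>1 \<alpha>2 (amplitude F) n1 n2 s \<le> ennreal C * K"
proof -
  have s0: "0 < \<alpha>1 * s" "0 < \<alpha>2 * s" using s \<alpha> by auto
  obtain C where C: "0 < C" and paley: "\<forall>F. integrable torus F \<longrightarrow>
    (amplitude_sum s F)
      \<le> ennreal C * (moment s F)"
    using paley_torus[OF s] by blast
  define Q where "Q \<beta> C \<longleftrightarrow> (\<forall>n\<ge>1. \<forall>(A::nat \<Rightarrow> nat \<Rightarrow> ennreal) K.
     (\<forall>h\<in>{0..1 / real n}. (\<Sum>\<^sup>+k. \<Sum>\<^sup>+m. A k m * ennreal (step_factor \<beta> m h)) \<le> K) \<longrightarrow>
     (\<Sum>\<^sup>+k. \<Sum>\<^sup>+m. A k m * ennreal (low_weight \<beta> n m))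
       \<le> ennreal C * K)" for \<beta> C
  obtain C1 where C1: "0 < C1" and "Q (\<alpha>1 * s) C1"
    using weighted_sum_average[OF s0(1)] unfolding Q_def[symmetric] by blast
  note avg1 = \<open>Q (\<alpha>1 * s) C1\<close>[unfolded Q_def, rule_format]
  obtain C2 where C2: "0 < C2" and "Q (\<alpha>2 * s) C2"
    using weighted_sum_average[OF s0(2)] unfolding Q_def[symmetric] by blast
  note avg2 = \<open>Q (\<alpha>2 * s) C2\<close>[unfolded Q_def, rule_format]
  show ?thesis
  proof (intro exI[of _ "C1 * (C2 * C)"] conjI allI impI)
    show "0 < C1 * (C2 * C)" using C C1 C2 by simp
    fix F :: "real \<times> real \<Rightarrow> real" and n1 n2 :: nat and K
    assume F: "torus_fun F" and n: "1 \<le> n1" "1 \<le> n2"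
      and K: "\<forall>h1\<in>{0..1 / real n1}. \<forall>h2\<in>{0..1 / real n2}.
       (moment s (diff1 \<alpha>1 h1 (diff2 \<alpha>2 h2 F))) \<le> K"
    define B where "B m n = ennreal (real m powr (s - 2) * real n powr (s - 2) * amplitude F m n powr s)" for m n
    define S where "S \<beta> m h = ennreal (step_factor \<beta> m h)" for \<beta> and m :: nat and h
    define W where "W \<beta> N m = ennreal (low_weight \<beta> N m)" for \<beta> and N m :: nat
    have base: "(\<Sum>\<^sup>+m. \<Sum>\<^sup>+n. (B m n * S (\<alpha>1 * s) m h1) * S (\<alpha>2 * s) n h2) \<le> ennreal C * K"
      if h: "h1 \<in> {0..1 / real n1}" "h2 \<in> {0..1 / real n2}" for h1 h2
    proof -
      define G where "G = diff1 \<alpha>1 h1 (diff2 \<alpha>2 h2 F)"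
      have G: "integrable torus G"
        using torus_fun_diff1[OF \<alpha>(1) torus_fun_diff2[OF \<alpha>(2) F]] by (simp add: torus_fun_def G_def)
      have "(B m n * S (\<alpha>1 * s) m h1) * S (\<alpha>2 * s) n h2 = ennreal (real m powr (s - 2) * real n powr (s - 2) * amplitude G m n powr s)" for m n
        unfolding B_def S_def G_def amplitude_mixed_difference[OF \<alpha> F]
        using amplitude_nonneg[of F m n] by (simp add: powr_mult powr_powr ennreal_mult[symmetric] mult_ac)
      then have "(\<Sum>\<^sup>+m. \<Sum>\<^sup>+n. (B m n * S (\<alpha>1 * s) m h1) * S (\<alpha>2 * s) n h2)
        \<le> ennreal C * (moment s G)"
        using paley[rule_format, OF G] by simp
      also have "\<dots> \<le> ennreal C * K"
        using K h by (intro mult_left_mono) (auto simp: G_def)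
      finally show ?thesis .
    qed
    have swap: "(\<Sum>\<^sup>+m. \<Sum>\<^sup>+n. H m n) = (\<Sum>\<^sup>+n. \<Sum>\<^sup>+m. H m n)"
      for H :: "nat \<Rightarrow> nat \<Rightarrow> ennreal"
      by (rule nn_integral_count_space_nn_integral) auto
    have step: "(\<Sum>\<^sup>+n. \<Sum>\<^sup>+m. (B m n * W (\<alpha>2 * s) n2 n) * S (\<alpha>1 * s) m h1) \<le> ennreal C2 * (ennreal C * K)"
      if h: "h1 \<in> {0..1 / real n1}" for h1
    proof -
      have "(\<Sum>\<^sup>+m. \<Sum>\<^sup>+n. (B m n * S (\<alpha>1 * s) m h1) * W (\<alpha>2 * s) n2 n) \<le> ennreal C2 * (ennreal C * K)"
        unfolding W_def by (rule avg2[OF n(2)], rule base[unfolded S_def[of "\<alpha>2 * s"], OF h])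
      moreover have "(\<Sum>\<^sup>+m. \<Sum>\<^sup>+n. (B m n * S (\<alpha>1 * s) m h1) * W (\<alpha>2 * s) n2 n)
        = (\<Sum>\<^sup>+n. \<Sum>\<^sup>+m. (B m n * W (\<alpha>2 * s) n2 n) * S (\<alpha>1 * s) m h1)"
        by (subst swap) (simp only: mult_ac)
      ultimately show ?thesis by simp
    qed
    have "(\<Sum>\<^sup>+n. \<Sum>\<^sup>+m. (B m n * W (\<alpha>2 * s) n2 n) * W (\<alpha>1 * s) n1 m) \<le> ennreal C1 * (ennreal C2 * (ennreal C * K))"
      unfolding W_def[of "\<alpha>1 * s"] by (rule avg1[OF n(1)], rule step[unfolded S_def])
    moreover have "(\<Sum>\<^sup>+n. \<Sum>\<^sup>+m. (B m n * W (\<alpha>2 * s) n2 n) * W (\<alpha>1 * s) n1 m)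
       = weighted_coeff_sum \<alpha>1 \<alpha>2 (amplitude F) n1 n2 s"
    proof -
      have "(B m n * W (\<alpha>2 * s) n2 n) * W (\<alpha>1 * s) n1 m = coeff_term \<alpha>1 \<alpha>2 (amplitude F) n1 n2 s m n" for m n
        unfolding B_def W_def coeff_term_def by (simp add: ennreal_mult[symmetric] mult_ac)
      then show ?thesis unfolding weighted_coeff_sum_def by (subst swap) simp
    qed
    ultimately show "weighted_coeff_sum \<alpha>1 \<alpha>2 (amplitude F) n1 n2 s \<le> ennreal (C1 * (C2 * C)) * K"
      using C C1 C2 by (simp add: ennreal_mult mult.assoc)
  qed
qed

theorem theorem7p1:
  fixes p \<alpha>1 \<alpha>2 :: real
  assumes "1 < p" and "\<alpha>1 > 0" and "\<alpha>2 > 0"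
  shows "\<exists>C>0. \<forall>f\<in>Lp0_torus p. \<forall>n1\<ge>1. \<forall>n2\<ge>1.
    coeff_sum \<alpha>1 \<alpha>2 f n1 n2 (min 2 p)
      \<le> ennreal C * mixed_modulus p \<alpha>1 \<alpha>2 f (1 / real n1) (1 / real n2)
    \<and> mixed_modulus p \<alpha>1 \<alpha>2 f (1 / real n1) (1 / real n2)
      \<le> ennreal C * coeff_sum \<alpha>1 \<alpha>2 f n1 n2 (max 2 p)"
proof -
  define \<tau> where "\<tau> = max 2 p"
  define \<theta> where "\<theta> = min 2 p"
  have \<tau>: "2 \<le> \<tau>" "0 < p" "p \<le> \<tau>" "0 < \<tau>" and \<theta>: "1 < \<theta>" "\<theta> \<le> 2" "0 < \<theta>" "\<theta> \<le> p"
    using assms by (auto simp: \<tau>_def \<theta>_def)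
  obtain K1 where K1: "0 < K1" and norm1: "\<forall>G\<in>borel_measurable borel. torus_norm p G \<le> ennreal K1 * torus_norm \<tau> G"
    using torus_norm_mono_exponent[OF \<tau>(2,3)] by blast
  obtain K2 where K2: "0 < K2" and norm2: "\<forall>G\<in>borel_measurable borel. torus_norm \<theta> G \<le> ennreal K2 * torus_norm p G"
    using torus_norm_mono_exponent[OF \<theta>(3,4)] by blast
  obtain C1 where C1: "0 < C1" and upper: "\<forall>F n1 n2 h1 h2. torus_fun F \<longrightarrow> (\<forall>b c m n. m = 0 \<or> n = 0 \<longrightarrow> fourier_coeff F b c m n = 0) \<longrightarrow>
    1 \<le> n1 \<longrightarrow> 1 \<le> n2 \<longrightarrow> \<bar>h1\<bar> \<le> 1 / real n1 \<longrightarrow> \<bar>h2\<bar> \<le> 1 / real n2 \<longrightarrow>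
    (moment \<tau> (diff1 \<alpha>1 h1 (diff2 \<alpha>2 h2 F)))
      \<le> ennreal C1 * weighted_coeff_sum \<alpha>1 \<alpha>2 (amplitude F) n1 n2 \<tau>"
    using difference_norm_upper[OF \<tau>(1) assms(2,3)] by (elim exE conjE)
  obtain C2 where C2: "0 < C2" and lower: "\<forall>F n1 n2 K. torus_fun F \<longrightarrow> 1 \<le> n1 \<longrightarrow> 1 \<le> n2 \<longrightarrow>
    (\<forall>h1\<in>{0..1 / real n1}. \<forall>h2\<in>{0..1 / real n2}.
       (moment \<theta> (diff1 \<alpha>1 h1 (diff2 \<alpha>2 h2 F))) \<le> K) \<longrightarrow>
    weighted_coeff_sum \<alpha>1 \<alpha>2 (amplitude F) n1 n2 \<theta> \<le> ennreal C2 * K"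
    using difference_norm_lower[OF \<theta>(1,2) assms(2,3)] by (elim exE conjE)
  define D1 where "D1 = K1 * (C1 powr (1/\<tau>) * pi\<^sup>2 * 4 powr (1/\<tau>))"
  define D2 where "D2 = 4 * (4 * C2 powr (1/\<theta>) * K2)"
  have D: "0 < D1" "0 < D2" using K1 K2 C1 C2 by (auto simp: D1_def D2_def)
  show ?thesis
  proof (intro exI[of _ "max D1 D2"] conjI ballI allI impI)
    show "0 < max D1 D2" using D by simp
    fix f and n1 n2 :: nat assume f: "f \<in> Lp0_torus p" and n: "1 \<le> n1" "1 \<le> n2"
    obtain F where F: "torus_fun F" and ae: "AE z in lborel. f z = F z"
      and axes: "\<And>b c m n. m = 0 \<or> n = 0 \<Longrightarrow> fourier_coeff F b c m n = 0"
      and rho: "\<And>m n. rho f m n = (\<Sum>b\<in>UNIV. \<Sum>c\<in>UNIV. \<bar>fourier_coeff F b c m n\<bar>) / pi\<^sup>2"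
      by (fact Lp0_torus_representative[OF assms(1) f])
    let ?I = "coeff_sum \<alpha>1 \<alpha>2 f n1 n2"
    let ?W = "\<lambda>s R. weighted_coeff_sum \<alpha>1 \<alpha>2 R n1 n2 s"
    define G where "G h1 h2 = diff1 \<alpha>1 h1 (diff2 \<alpha>2 h2 F)" for h1 h2
    have Gm: "G h1 h2 \<in> borel_measurable borel" for h1 h2
    proof -
      have "integrable torus (G h1 h2)"
        using torus_fun_diff1[OF assms(2) torus_fun_diff2[OF assms(3) F]] by (simp add: torus_fun_def G_def)
      then show ?thesis using borel_measurable_integrable[of torus "G h1 h2"] by simp
    qed
    have Lp: "Lp_norm p (diff1 \<alpha>1 h1 (diff2 \<alpha>2 h2 f)) = torus_norm p (G h1 h2)" for h1 h2
      unfolding torus_norm_def by (rule Lp_norm_AE_torus[OF _ Gm]) (unfold G_def, intro AE_diff1 AE_diff2 ae)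
    have rho0: "0 \<le> rho f m n" for m n by (simp add: rho_def)
    have amp_le: "amplitude F m n \<le> pi\<^sup>2 * rho f m n" for m n
      using amplitude_le_sum[of F m n] by (simp add: rho)
    have rho_le: "rho f m n \<le> 4 * amplitude F m n" for m n
    proof -
      have "(\<Sum>b\<in>UNIV. \<Sum>c\<in>UNIV. \<bar>fourier_coeff F b c m n\<bar>) \<le> (\<Sum>b\<in>(UNIV::bool set). \<Sum>c\<in>(UNIV::bool set). amplitude F m n)"
        by (intro sum_mono abs_coeff_le_amplitude)
      also have "\<dots> = 4 * amplitude F m n" by (simp add: UNIV_bool)
      finally have "rho f m n \<le> 4 * amplitude F m n / pi\<^sup>2" unfolding rho by (rule divide_right_mono) simp
      also have "\<dots> \<le> 4 * amplitude F m n / 1"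
        using pi_ge_two amplitude_nonneg[of F m n] by (intro divide_left_mono) (auto intro!: one_le_power)
      finally show ?thesis by simp
    qed
    define \<omega> where "\<omega> = mixed_modulus p \<alpha>1 \<alpha>2 f (1 / real n1) (1 / real n2)"
    have G_le: "torus_norm p (G h1 h2) \<le> \<omega>" if "\<bar>h1\<bar> \<le> 1 / real n1" "\<bar>h2\<bar> \<le> 1 / real n2" for h1 h2
      unfolding \<omega>_def mixed_modulus_def Lp[symmetric] by (rule SUP_upper2[of "(h1, h2)"]) (use that in auto)
    have "\<omega> \<le> ennreal D1 * ?I \<tau>"
      unfolding \<omega>_def mixed_modulus_def
    proof (rule SUP_least, clarify)
      fix h1 h2 assume h: "\<bar>h1\<bar> \<le> 1 / real n1" "\<bar>h2\<bar> \<le> 1 / real n2"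
      have "torus_norm \<tau> (G h1 h2) \<le> ennpow (ennreal C1 * ?W \<tau> (amplitude F)) (1/\<tau>)"
        unfolding torus_norm_def G_def using \<tau>
        by (intro ennpow_mono upper[rule_format, OF F axes n h]) auto
      also have "\<dots> \<le> ennpow (ennreal C1 * (ennreal ((pi\<^sup>2) powr \<tau>) * ?W \<tau> (rho f))) (1/\<tau>)"
        using \<tau> by (intro ennpow_mono mult_left_mono weighted_coeff_sum_compare amp_le amplitude_nonneg rho0) auto
      also have "\<dots> = ennreal (C1 powr (1/\<tau>) * pi\<^sup>2) * ennpow (?W \<tau> (rho f)) (1/\<tau>)"
        using C1 \<tau> by (simp add: ennpow_cmult powr_powr ennreal_mult mult.assoc)
      also have "\<dots> \<le> ennreal (C1 powr (1/\<tau>) * pi\<^sup>2) * (ennreal (4 powr (1/\<tau>)) * ?I \<tau>)"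
        by (intro mult_left_mono coeff_sum_le_weighted(2) n \<tau>) simp
      finally have "ennreal K1 * torus_norm \<tau> (G h1 h2)
        \<le> ennreal K1 * (ennreal (C1 powr (1/\<tau>) * pi\<^sup>2) * (ennreal (4 powr (1/\<tau>)) * ?I \<tau>))"
        by (rule mult_left_mono) simp
      also have "\<dots> = ennreal D1 * ?I \<tau>"
        using K1 C1 by (simp add: D1_def ennreal_mult mult.assoc)
      finally show "Lp_norm p (diff1 \<alpha>1 h1 (diff2 \<alpha>2 h2 f)) \<le> ennreal D1 * ?I \<tau>"
        unfolding Lp by (rule order_trans[OF norm1[rule_format, OF Gm]])
    qed
    also have "\<dots> \<le> ennreal (max D1 D2) * ?I \<tau>"
      by (intro mult_right_mono ennreal_leI) auto
    finally show "mixed_modulus p \<alpha>1 \<alpha>2 f (1 / real n1) (1 / real n2) \<le> ennreal (max D1 D2) * coeff_sum \<alpha>1 \<alpha>2 f n1 n2 (max 2 p)"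
      unfolding \<omega>_def \<tau>_def .
    have "(moment \<theta> (G h1 h2)) \<le> ennpow (ennreal K2 * \<omega>) \<theta>"
      if h: "h1 \<in> {0..1 / real n1}" "h2 \<in> {0..1 / real n2}" for h1 h2
    proof -
      have "torus_norm \<theta> (G h1 h2) \<le> ennreal K2 * torus_norm p (G h1 h2)" using norm2 Gm by blast
      also have "\<dots> \<le> ennreal K2 * \<omega>" using h by (intro mult_left_mono G_le) auto
      finally have "ennpow (torus_norm \<theta> (G h1 h2)) \<theta> \<le> ennpow (ennreal K2 * \<omega>) \<theta>"
        by (rule ennpow_mono[OF \<theta>(3)])
      then show ?thesis unfolding torus_norm_def using \<theta> by (simp add: ennpow_ennpow)
    qed
    then have "?W \<theta> (amplitude F) \<le> ennreal C2 * ennpow (ennreal K2 * \<omega>) \<theta>"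
      unfolding G_def by (intro lower[rule_format, OF F n]) auto
    then have "ennreal (4 powr \<theta>) * ?W \<theta> (amplitude F)
      \<le> ennreal (4 powr \<theta>) * (ennreal C2 * ennpow (ennreal K2 * \<omega>) \<theta>)" by (rule mult_left_mono) simp
    moreover have "?W \<theta> (rho f) \<le> ennreal (4 powr \<theta>) * ?W \<theta> (amplitude F)"
      by (intro weighted_coeff_sum_compare rho_le rho0 amplitude_nonneg \<theta>) simp
    ultimately have "?W \<theta> (rho f) \<le> ennreal (4 powr \<theta>) * (ennreal C2 * ennpow (ennreal K2 * \<omega>) \<theta>)"
      by (rule order_trans[rotated])
    then have "ennpow (?W \<theta> (rho f)) (1/\<theta>) \<le> ennpow (ennreal (4 powr \<theta>) * (ennreal C2 * ennpow (ennreal K2 * \<omega>) \<theta>)) (1/\<theta>)"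
      using \<theta> by (intro ennpow_mono) auto
    also have "\<dots> = ennreal 4 * (ennreal (C2 powr (1/\<theta>)) * (ennreal K2 * \<omega>))"
      using C2 \<theta> by (simp add: ennpow_cmult[of "4 powr \<theta>"] ennpow_cmult[of C2] ennpow_ennpow powr_powr)
    also have "\<dots> = ennreal (4 * C2 powr (1/\<theta>) * K2) * \<omega>"
      using C2 K2 by (simp only: ennreal_mult mult.assoc powr_ge_zero mult_nonneg_nonneg less_imp_le zero_le_numeral)
    finally have "4 * ennpow (?W \<theta> (rho f)) (1/\<theta>) \<le> 4 * (ennreal (4 * C2 powr (1/\<theta>) * K2) * \<omega>)"
      by (rule mult_left_mono) simp
    moreover have "?I \<theta> \<le> 4 * ennpow (?W \<theta> (rho f)) (1/\<theta>)"
      by (rule coeff_sum_le_weighted(1)[OF n \<theta>(3)])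
    ultimately have "?I \<theta> \<le> 4 * (ennreal (4 * C2 powr (1/\<theta>) * K2) * \<omega>)"
      by (rule order_trans[rotated])
    also have "\<dots> = ennreal D2 * \<omega>"
      unfolding D2_def using C2 K2 by (subst ennreal_mult) (auto simp: mult.assoc)
    also have "\<dots> \<le> ennreal (max D1 D2) * \<omega>" by (intro mult_right_mono ennreal_leI) auto
    finally show "coeff_sum \<alpha>1 \<alpha>2 f n1 n2 (min 2 p) \<le> ennreal (max D1 D2) * mixed_modulus p \<alpha>1 \<alpha>2 f (1 / real n1) (1 / real n2)"
      unfolding \<omega>_def \<theta>_def .
  qed
qed

end
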